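(* Let $(M^{m+1},g(t),p(t))$, $t\in[0,T)$, be a solution to the conformal Ricci flow on a closed connected manifold of dimension $m+1\ge 3$ with constant scalar curvature $R_{g(t)}\equiv -m(m+1)$, and let $v$ be a solution of the linear heat equation $\partial_t v-\Delta_{g(t)}v=\bar p(t)v$, where $\bar p(t)=\max_{x\in M}p(x,t)$. Let $h,k$ be smooth functions of $t$ and suppose that $$\mathscr{R}ic_f\le\Big(\frac{k(t)}{2h(t)}+\frac{R_g}{m+1}\Big)g ,\qquad R_g=-m(m+1).$$ Let $0<a<b<T$. If $h(t)<0$ and $v(\cdot,b)=0$, then $v(\cdot,t)=0$ for any $t\in[a,b)$.
   Context: $M$ is a closed (compact, without boundary) connected manifold of dimension $m+1\ge3$ and $T>0$. $(M^{m+1},g(t),p(t))$, $t\in[0,T)$, solves the conformal Ricci flow if $g(t)$ is a smooth family of Riemannian metrics and $p(t)=p(\cdot,t)\ge 0$ a family of functions (the conformal pressure) on $M$ with $$\partial_t g=-2\big(Ric(t)+(m+p(t))g(t)\big),\qquad (-\Delta_{g(t)}+(m+1))p(t)=\tfrac1m|Ric+mg|^2\quad\text{on }M\times[0,T),$$ $g(0)=g_0$, where $g_0$ has constant scalar curvature $-m(m+1)$; the flow preserves $R_{g(t)}\equiv-m(m+1)$. $Ric$, $\Delta_{g(t)}$, $\nabla$, $d\mu_{g(t)}$ are the Ricci tensor, Laplace-Beltrami operator, Levi-Civita connection/gradient and volume element of $g(t)$. Weighted measure: let $\tau(t)=T-t$ and let $H(t)=(4\pi\tau(t))^{-\frac{m+1}{2}}e^{-f(t)}$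 be the (positive) fundamental solution of the conjugate heat equation $\partial_tH=-\Delta_{g(t)}H+(m+1)p(t)H$ along the flow; this defines $f=f(t)$, which satisfies $\partial_tf=-\Delta f+|\nabla f|^2-(m+1)\big(p-\frac{1}{2\tau}\big)$. The weighted measure is $dV_{g(t)}=H(t)\,d\mu_{g(t)}$, with $\int_M dV_{g(t)}=1$. Bakry-Émery Ricci tensor: $\mathscr{R}ic_f=Ric+\operatorname{Hess}f$. Inequalities between symmetric 2-tensors are in the sense of quadratic forms. The function $v$ is smooth with $v(\cdot,t),\partial_tv(\cdot,t)\in W^{2,2}_0(dV)$. *)

theory Defs
  imports "HOL-Analysis.Analysis"
begin

section \<open>Smooth maps\<close>

text \<open>
  Derivatives are taken within \<open>S\<close>, so that \<open>S\<close> may be a product \<open>U \<times> {0..<T}\<close> with \<open>U\<close> open, on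
  which one-sided time derivatives are meant at time \<open>0\<close>. The definition is only used for sets
  \<open>S\<close> (open sets, half-open intervals, such products) in which this derivative is unique.
\<close>

primrec Ck_on :: "nat \<Rightarrow> 'a::euclidean_space set \<Rightarrow> ('a \<Rightarrow> 'b::real_normed_vector) \<Rightarrow> bool" where
  "Ck_on 0 S f \<longleftrightarrow> continuous_on S f"
| "Ck_on (Suc k) S f \<longleftrightarrow>
     f differentiable_on S \<and> (\<forall>w. Ck_on k S (\<lambda>x. frechet_derivative f (at x within S) w))"

definition smooth_on :: "'a::euclidean_space set \<Rightarrow> ('a \<Rightarrow> 'b::real_normed_vector) \<Rightarrow> bool" where
  "smooth_on S f \<longleftrightarrow> (\<forall>k. Ck_on k S f)"

section \<open>Manifolds and tensor fields\<close>

text \<open>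
  A chart is a domain together with a coordinate map; the values of the map outside the domain are
  irrelevant. The manifold is a subset \<open>M\<close> of a Hausdorff space with the subspace topology, and its
  dimension is \<open>CARD('n)\<close>.
\<close>

type_synonym ('a, 'n) chart = "'a set \<times> ('a \<Rightarrow> real^'n)"

definition chart_img :: "('a, 'n::finite) chart \<Rightarrow> (real^'n) set" where
  "chart_img c = snd c ` fst c"

definition chart_inv :: "('a, 'n::finite) chart \<Rightarrow> real^'n \<Rightarrow> 'a" where
  "chart_inv c = inv_into (fst c) (snd c)"

definition transition :: "('a, 'n::finite) chart \<Rightarrow> ('a, 'n) chart \<Rightarrow> real^'n \<Rightarrow> real^'n" where
  "transition c d = snd d \<circ> chart_inv c"

definition smooth_atlas :: "'a::t2_space set \<Rightarrow> ('a, 'n::finite) chart set \<Rightarrow> bool" where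
  "smooth_atlas M A \<longleftrightarrow>
     (\<Union>c\<in>A. fst c) = M \<and>
     (\<forall>c\<in>A. openin (top_of_set M) (fst c) \<and> open (chart_img c) \<and>
        homeomorphism (fst c) (chart_img c) (snd c) (chart_inv c)) \<and>
     (\<forall>c\<in>A. \<forall>d\<in>A. smooth_on (snd c ` (fst c \<inter> fst d)) (transition c d))"

definition closed_connected_manifold :: "'a::t2_space set \<Rightarrow> ('a, 'n::finite) chart set \<Rightarrow> bool" where
  "closed_connected_manifold M A \<longleftrightarrow> smooth_atlas M A \<and> compact M \<and> connected M \<and> M \<noteq> {}"

text \<open>
  A covariant 2-tensor field is given by its component matrix in each chart, as a function of the
  coordinates of that chart, subject to the usual transformation law.
\<close>

type_synonym ('a, 'n) tensor2 = "('a, 'n) chart \<Rightarrow> real^'n \<Rightarrow> real^'n^'n"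

definition is_tensor2 :: "('a, 'n::finite) chart set \<Rightarrow> ('a, 'n) tensor2 \<Rightarrow> bool" where
  "is_tensor2 A S \<longleftrightarrow>
     (\<forall>c\<in>A. \<forall>d\<in>A. \<forall>y \<in> snd c ` (fst c \<inter> fst d).
        let J = matrix (frechet_derivative (transition c d) (at y))
        in S c y = transpose J ** S d (transition c d y) ** J)"

definition riemannian_metric :: "('a, 'n::finite) chart set \<Rightarrow> ('a, 'n) tensor2 \<Rightarrow> bool" where
  "riemannian_metric A g \<longleftrightarrow>
     is_tensor2 A g \<and>
     (\<forall>c\<in>A. smooth_on (chart_img c) (g c) \<and>
        (\<forall>y\<in>chart_img c. transpose (g c y) = g c y \<and> (\<forall>\<xi>. \<xi> \<noteq> 0 \<longrightarrow> 0 < \<xi> \<bullet> (g c y *v \<xi>))))"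

definition smooth_fun :: "('a, 'n::finite) chart set \<Rightarrow> ('a \<Rightarrow> real) \<Rightarrow> bool" where
  "smooth_fun A u \<longleftrightarrow> (\<forall>c\<in>A. smooth_on (chart_img c) (u \<circ> chart_inv c))"

text \<open>Joint smoothness on \<open>M \<times> [0,T)\<close>.\<close>

definition smooth_fun_family ::
    "('a, 'n::finite) chart set \<Rightarrow> real \<Rightarrow> (real \<Rightarrow> 'a \<Rightarrow> real) \<Rightarrow> bool" where
  "smooth_fun_family A T u \<longleftrightarrow>
     (\<forall>c\<in>A. smooth_on (chart_img c \<times> {0..<T}) (\<lambda>(y, t). u t (chart_inv c y)))"

definition smooth_metric_family ::
    "('a, 'n::finite) chart set \<Rightarrow> real \<Rightarrow> (real \<Rightarrow> ('a, 'n) tensor2) \<Rightarrow> bool" where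
  "smooth_metric_family A T g \<longleftrightarrow>
     (\<forall>t\<in>{0..<T}. riemannian_metric A (g t)) \<and>
     (\<forall>c\<in>A. smooth_on (chart_img c \<times> {0..<T}) (\<lambda>(y, t). g t c y))"

section \<open>Riemannian geometry in coordinates\<close>

definition pd :: "'n::finite \<Rightarrow> (real^'n \<Rightarrow> real) \<Rightarrow> real^'n \<Rightarrow> real" where
  "pd i F y = frechet_derivative F (at y) (axis i 1)"

text \<open>\<open>christoffel G k i j\<close> is \<open>\<Gamma>\<^sup>k\<^bsub>ij\<^esub>\<close>, for the component matrix \<open>G\<close> of the metric in one chart.\<close>

definition christoffel ::
    "(real^'n \<Rightarrow> real^'n^'n) \<Rightarrow> 'n::finite \<Rightarrow> 'n \<Rightarrow> 'n \<Rightarrow> real^'n \<Rightarrow> real" where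
  "christoffel G k i j y =
     (1/2) * (\<Sum>l\<in>UNIV. matrix_inv (G y) $ k $ l *
        (pd i (\<lambda>z. G z $ j $ l) y + pd j (\<lambda>z. G z $ i $ l) y - pd l (\<lambda>z. G z $ i $ j) y))"

text \<open>The sign is the one for which round spheres have positive Ricci curvature.\<close>

definition ricci_coord :: "(real^'n \<Rightarrow> real^'n^'n) \<Rightarrow> real^'n \<Rightarrow> real^'n^'n::finite" where
  "ricci_coord G y = (\<chi> i j. \<Sum>k\<in>UNIV.
     pd k (christoffel G k i j) y - pd j (christoffel G k i k) y +
     (\<Sum>l\<in>UNIV. christoffel G k k l y * christoffel G l i j y
              - christoffel G k j l y * christoffel G l i k y))"

definition hess_coord ::
    "(real^'n \<Rightarrow> real^'n^'n) \<Rightarrow> (real^'n \<Rightarrow> real) \<Rightarrow> real^'n \<Rightarrow> real^'n^'n::finite" where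
  "hess_coord G F y = (\<chi> i j. pd i (pd j F) y - (\<Sum>k\<in>UNIV. christoffel G k i j y * pd k F y))"

definition tr_metric :: "real^'n^'n \<Rightarrow> real^'n^'n \<Rightarrow> real" where
  "tr_metric G S = (\<Sum>i\<in>UNIV. \<Sum>j\<in>UNIV. matrix_inv G $ i $ j * S $ i $ j)"

definition norm2_metric :: "real^'n^'n \<Rightarrow> real^'n^'n \<Rightarrow> real" where
  "norm2_metric G S = (\<Sum>i\<in>UNIV. \<Sum>j\<in>UNIV. \<Sum>k\<in>UNIV. \<Sum>l\<in>UNIV.
     matrix_inv G $ i $ k * matrix_inv G $ j $ l * S $ i $ j * S $ k $ l)"

text \<open>The same objects on the manifold: components in the chart \<open>c\<close> at the point \<open>x\<close>.\<close>

definition metric_at :: "('a, 'n::finite) tensor2 \<Rightarrow> ('a, 'n) chart \<Rightarrow> 'a \<Rightarrow> real^'n^'n" where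
  "metric_at g c x = g c (snd c x)"

definition Ric :: "('a, 'n::finite) tensor2 \<Rightarrow> ('a, 'n) chart \<Rightarrow> 'a \<Rightarrow> real^'n^'n" where
  "Ric g c x = ricci_coord (g c) (snd c x)"

definition Hess ::
    "('a, 'n::finite) tensor2 \<Rightarrow> ('a, 'n) chart \<Rightarrow> ('a \<Rightarrow> real) \<Rightarrow> 'a \<Rightarrow> real^'n^'n" where
  "Hess g c u x = hess_coord (g c) (u \<circ> chart_inv c) (snd c x)"

definition scalar_curv :: "('a, 'n::finite) tensor2 \<Rightarrow> ('a, 'n) chart \<Rightarrow> 'a \<Rightarrow> real" where
  "scalar_curv g c x = tr_metric (metric_at g c x) (Ric g c x)"

definition Laplacian ::
    "('a, 'n::finite) tensor2 \<Rightarrow> ('a, 'n) chart \<Rightarrow> ('a \<Rightarrow> real) \<Rightarrow> 'a \<Rightarrow> real" where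
  "Laplacian g c u x = tr_metric (metric_at g c x) (Hess g c u x)"

definition grad_norm2 ::
    "('a, 'n::finite) tensor2 \<Rightarrow> ('a, 'n) chart \<Rightarrow> ('a \<Rightarrow> real) \<Rightarrow> 'a \<Rightarrow> real" where
  "grad_norm2 g c u x =
     (\<Sum>i\<in>UNIV. \<Sum>j\<in>UNIV. matrix_inv (metric_at g c x) $ i $ j *
        pd i (u \<circ> chart_inv c) (snd c x) * pd j (u \<circ> chart_inv c) (snd c x))"

definition Ric_BE ::
    "('a, 'n::finite) tensor2 \<Rightarrow> ('a \<Rightarrow> real) \<Rightarrow> ('a, 'n) chart \<Rightarrow> 'a \<Rightarrow> real^'n^'n" where
  "Ric_BE g f c x = Ric g c x + Hess g c f x"

definition quad_le :: "real^'n^'n \<Rightarrow> real^'n^'n \<Rightarrow> bool" where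
  "quad_le S S' \<longleftrightarrow> (\<forall>\<xi>. \<xi> \<bullet> (S *v \<xi>) \<le> \<xi> \<bullet> (S' *v \<xi>))"

section \<open>Volume and weighted measure\<close>

text \<open>
  The Riemannian measure is the unique Borel measure on \<open>M\<close> which in every chart has density
  \<open>sqrt (det g)\<close> with respect to Lebesgue measure of the coordinates.
\<close>

definition vol :: "'a::t2_space set \<Rightarrow> ('a, 'n::finite) chart set \<Rightarrow> ('a, 'n) tensor2 \<Rightarrow> 'a measure" where
  "vol M A g = (THE \<mu>. sets \<mu> = sets (restrict_space borel M) \<and>
     (\<forall>c\<in>A. \<forall>E\<in>sets \<mu>. E \<subseteq> fst c \<longrightarrow>
        emeasure \<mu> E =
          (\<integral>\<^sup>+ y. ennreal (sqrt (det (g c y))) * indicator (snd c ` E) y \<partial>lborel)))"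

definition weighted_measure ::
    "'a::t2_space set \<Rightarrow> ('a, 'n::finite) chart set \<Rightarrow> ('a, 'n) tensor2 \<Rightarrow> ('a \<Rightarrow> real) \<Rightarrow> 'a measure" where
  "weighted_measure M A g H = density (vol M A g) (\<lambda>x. ennreal (H x))"

text \<open>An arbitrary chart around \<open>x\<close>; only used for quantities independent of this choice.\<close>

definition chart_at :: "('a, 'n::finite) chart set \<Rightarrow> 'a \<Rightarrow> ('a, 'n) chart" where
  "chart_at A x = (SOME c. c \<in> A \<and> x \<in> fst c)"

definition W22_norm2 ::
    "('a, 'n::finite) chart set \<Rightarrow> ('a, 'n) tensor2 \<Rightarrow> 'a measure \<Rightarrow> ('a \<Rightarrow> real) \<Rightarrow> ennreal" where
  "W22_norm2 A g V u =
     (\<integral>\<^sup>+ x. ennreal ((u x)\<^sup>2 + grad_norm2 g (chart_at A x) u x +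
        norm2_metric (metric_at g (chart_at A x) x) (Hess g (chart_at A x) u x)) \<partial>V)"

text \<open>
  \<open>W\<^sup>2\<^sup>,\<^sup>2\<^sub>0\<close> is the completion of the smooth compactly supported functions, realised inside
  \<open>L\<^sup>2\<close>. The manifold being compact, all smooth functions are compactly supported.
\<close>

definition W22_0 ::
    "('a, 'n::finite) chart set \<Rightarrow> ('a, 'n) tensor2 \<Rightarrow> 'a measure \<Rightarrow> ('a \<Rightarrow> real) set" where
  "W22_0 A g V = {u \<in> borel_measurable V. \<exists>\<phi>::nat \<Rightarrow> 'a \<Rightarrow> real.
     (\<forall>n. smooth_fun A (\<phi> n) \<and> W22_norm2 A g V (\<phi> n) < \<infinity>) \<and>
     (\<forall>e>0. \<exists>N. \<forall>i\<ge>N. \<forall>j\<ge>N. W22_norm2 A g V (\<lambda>x. \<phi> i x - \<phi> j x) < e) \<and>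
     (\<lambda>n. \<integral>\<^sup>+ x. ennreal ((\<phi> n x - u x)\<^sup>2) \<partial>V) \<longlonglongrightarrow> 0}"

section \<open>Conformal Ricci flow and heat equations\<close>

definition conformal_ricci_flow ::
    "nat \<Rightarrow> 'a::t2_space set \<Rightarrow> ('a, 'n::finite) chart set \<Rightarrow> real \<Rightarrow>
     (real \<Rightarrow> ('a, 'n) tensor2) \<Rightarrow> (real \<Rightarrow> 'a \<Rightarrow> real) \<Rightarrow> bool" where
  "conformal_ricci_flow m M A T g p \<longleftrightarrow>
     smooth_metric_family A T g \<and> smooth_fun_family A T p \<and>
     (\<forall>t\<in>{0..<T}. \<forall>x\<in>M. 0 \<le> p t x) \<and>
     (\<forall>t\<in>{0..<T}. \<forall>c\<in>A. \<forall>x\<in>fst c.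
        ((\<lambda>s. metric_at (g s) c x) has_vector_derivative
           (-2) *\<^sub>R (Ric (g t) c x + (real m + p t x) *\<^sub>R metric_at (g t) c x))
           (at t within {0..<T}) \<and>
        - Laplacian (g t) c (p t) x + (real m + 1) * p t x =
           (1 / real m) *
           norm2_metric (metric_at (g t) c x) (Ric (g t) c x + real m *\<^sub>R metric_at (g t) c x))"

definition pmax :: "'a set \<Rightarrow> (real \<Rightarrow> 'a \<Rightarrow> real) \<Rightarrow> real \<Rightarrow> real" where
  "pmax M p t = (SUP x\<in>M. p t x)"

text \<open>
  The conjugate equation is a backward equation; its fundamental solution has its pole at some
  point \<open>x\<^sub>0\<close> at the final time \<open>T\<close>, where the metric itself need not be defined.
\<close>

definition conjugate_fundamental_solution ::
    "nat \<Rightarrow> 'a::t2_space set \<Rightarrow> ('a, 'n::finite) chart set \<Rightarrow> real \<Rightarrow>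
     (real \<Rightarrow> ('a, 'n) tensor2) \<Rightarrow> (real \<Rightarrow> 'a \<Rightarrow> real) \<Rightarrow> (real \<Rightarrow> 'a \<Rightarrow> real) \<Rightarrow> bool" where
  "conjugate_fundamental_solution m M A T g p H \<longleftrightarrow>
     smooth_fun_family A T H \<and>
     (\<forall>t\<in>{0..<T}. \<forall>x\<in>M. 0 < H t x) \<and>
     (\<forall>t\<in>{0..<T}. \<forall>c\<in>A. \<forall>x\<in>fst c.
        ((\<lambda>s. H s x) has_real_derivative
           - Laplacian (g t) c (H t) x + (real m + 1) * p t x * H t x) (at t within {0..<T})) \<and>
     (\<exists>x\<^sub>0\<in>M. \<forall>\<phi>::'a \<Rightarrow> real. continuous_on M \<phi> \<longrightarrow>
        ((\<lambda>t. LINT x|weighted_measure M A (g t) (H t). \<phi> x) \<longlongrightarrow> \<phi> x\<^sub>0) (at_left T))"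

text \<open>The linear equation \<open>\<partial>\<^sub>t v - \<Delta> v = \<bar>p v\<close>, with potential \<open>q\<close> depending on time only.\<close>

definition heat_solution ::
    "('a, 'n::finite) chart set \<Rightarrow> real \<Rightarrow> (real \<Rightarrow> ('a, 'n) tensor2) \<Rightarrow> (real \<Rightarrow> real) \<Rightarrow>
     (real \<Rightarrow> 'a \<Rightarrow> real) \<Rightarrow> bool" where
  "heat_solution A T g q v \<longleftrightarrow>
     smooth_fun_family A T v \<and>
     (\<forall>t\<in>{0..<T}. \<forall>c\<in>A. \<forall>x\<in>fst c.
        ((\<lambda>s. v s x) has_real_derivative Laplacian (g t) c (v t) x + q t * v t x)
          (at t within {0..<T}))"

end

theory Submission
  imports Defs
begin

text \<open>
  The theorem is backward uniqueness for the heat equation along a smooth family of metrics on a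
  closed manifold. It rests on the \<^emph>\<open>frequency\<close> of the solution, the quotient \<open>D / E\<close> of its Dirichlet
  energy \<open>D\<close> by its \<open>L\<^sup>2\<close> energy \<open>E\<close>. Where \<open>E\<close> is positive, \<open>D / E\<close> grows at most exponentially. As
  \<open>E' = - 2 D + ...\<close>, a bounded frequency gives \<open>E' \<ge> - C E\<close>, so an energy that is positive at some
  time cannot vanish at a later one (\<open>frequency_bound_imp_positive\<close>).

  Both energies are built from coordinates. Finitely many balls in charts are chosen such that the
  balls of half the radius still cover the manifold. In each of them the solution \<open>V\<close> is multiplied
  by a cutoff \<open>\<phi>\<close>, and \<open>w = \<phi> V\<close> is integrated against Lebesgue measure. With the symmetric operator
  \<open>L w = \<Sum>\<^sub>i\<^sub>j \<partial>\<^sub>i (g\<^sup>i\<^sup>j \<partial>\<^sub>j w)\<close> the heat equation reads \<open>\<partial>\<^sub>t w = L w + R\<close>, and in the error \<open>R\<close> the second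
  derivatives of \<open>V\<close> cancel (\<open>R_first_order\<close>), so that \<open>R\<^sup>2 \<le> C (V\<^sup>2 + |\<nabla>V|\<^sup>2)\<close>. Put \<open>X = \<partial>\<^sub>t w - R / 2\<close>.
  Integration by parts gives
  \<open>E' = 2 \<langle>X, w\<rangle> + \<langle>w, R\<rangle>\<close>, \<open>D = - \<langle>X, w\<rangle> + \<langle>w, R\<rangle> / 2\<close> and \<open>D' = - 2 |X|\<^sup>2 + |R|\<^sup>2 / 2 + O(D)\<close>,
  and with the Cauchy-Schwarz inequality \<open>\<langle>X, w\<rangle>\<^sup>2 \<le> |X|\<^sup>2 E\<close> the leading terms of \<open>D' E - D E'\<close> have
  the right sign; what remains is \<open>(|R|\<^sup>2 / 2 + O(D)) E\<close>.

  All these relations are linear in the integrals, once the Cauchy-Schwarz inequality is kept in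
  the form \<open>0 \<le> |X + \<mu> w|\<^sup>2\<close> for all \<open>\<mu>\<close>. They can therefore be added over the charts
  (\<open>energy_balance_sum\<close>), however much the charts overlap, and no global integral is involved. Only
  the bound of \<open>|R|\<^sup>2\<close> by \<open>E + D\<close> is global: near the boundary of a ball \<open>\<phi>\<close> degenerates, and the
  energies of that chart do not control \<open>V\<close> there. But every such point lies in the half ball of
  some other chart, where the cutoff is bounded below (\<open>half_ball_bound\<close>), and the change of
  variables formula carries the integral of \<open>V\<^sup>2 + |\<nabla>V|\<^sup>2\<close> over to that chart
  (\<open>chart_overlap_transfer\<close>).
\<close>

section \<open>Functions of class \<open>C\<^sup>k\<close> on open sets\<close>

definition dir_deriv :: "'a::euclidean_space \<Rightarrow> ('a \<Rightarrow> real) \<Rightarrow> 'a \<Rightarrow> real" where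
  "dir_deriv w f x = frechet_derivative f (at x) w"

lemma dir_deriv_works:
  "f differentiable (at x) \<Longrightarrow> (f has_derivative (\<lambda>w. dir_deriv w f x)) (at x)"
  unfolding dir_deriv_def by (simp add: frechet_derivative_works)

lemma dir_deriv_eqI:
  "(f has_derivative f') (at x) \<Longrightarrow> dir_deriv w f x = f' w"
  unfolding dir_deriv_def using frechet_derivative_at by metis

lemma dir_deriv_cong_open:
  assumes "open U" "x \<in> U" "\<And>z. z \<in> U \<Longrightarrow> f z = g z"
  shows "dir_deriv w f x = dir_deriv w g x"
proof -
  have "(f has_derivative D) (at x) \<longleftrightarrow> (g has_derivative D) (at x)" for D
    using assms has_derivative_transform_within_open[of f D x UNIV U g]
      has_derivative_transform_within_open[of g D x UNIV U f] by auto
  then show ?thesis unfolding dir_deriv_def frechet_derivative_def by simp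
qed

lemma Ck_on_cong:
  assumes "\<And>x. x \<in> S \<Longrightarrow> f x = g x" and "Ck_on k S f"
  shows "Ck_on k S g"
  using assms
proof (induction k arbitrary: f g)
  case 0
  then show ?case using continuous_on_cong[of S S f g] by simp
next
  case (Suc k)
  have d: "(f has_derivative D) (at x within S) \<longleftrightarrow> (g has_derivative D) (at x within S)"
    if "x \<in> S" for x D
    using has_derivative_transform[of x S g f D] has_derivative_transform[of x S f g D]
      that Suc.prems(1) by auto
  have 1: "g differentiable_on S"
    using Suc.prems(2) d unfolding Ck_on.simps differentiable_on_def differentiable_def by metis
  have "frechet_derivative f (at x within S) w = frechet_derivative g (at x within S) w"
    if "x \<in> S" for x w
    using d[OF that] unfolding frechet_derivative_def by simp
  note fd = this
  have "Ck_on k S (\<lambda>x. frechet_derivative g (at x within S) w)" for w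
  proof (rule Suc.IH)
    show "frechet_derivative f (at x within S) w = frechet_derivative g (at x within S) w"
      if "x \<in> S" for x
      by (rule fd[OF that])
    show "Ck_on k S (\<lambda>x. frechet_derivative f (at x within S) w)"
      using Suc.prems(2) by (simp only: Ck_on.simps)
  qed
  then show ?case unfolding Ck_on.simps using 1 by blast
qed

lemma Ck_on_Suc_open:
  assumes "open U"
  shows "Ck_on (Suc k) U f \<longleftrightarrow> (\<forall>x\<in>U. f differentiable (at x)) \<and> (\<forall>w. Ck_on k U (dir_deriv w f))"
proof -
  have "f differentiable_on U \<longleftrightarrow> (\<forall>x\<in>U. f differentiable (at x))"
    unfolding differentiable_on_def by (simp add: at_within_open[OF _ assms])
  moreover have "Ck_on k U (\<lambda>x. frechet_derivative f (at x within U) w) \<longleftrightarrow> Ck_on k U (dir_deriv w f)" for w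
  proof -
    have "frechet_derivative f (at x within U) w = dir_deriv w f x" if "x \<in> U" for x
      unfolding dir_deriv_def by (simp add: at_within_open[OF that assms])
    then show ?thesis
      using Ck_on_cong[of U "\<lambda>x. frechet_derivative f (at x within U) w" "dir_deriv w f" k]
        Ck_on_cong[of U "dir_deriv w f" "\<lambda>x. frechet_derivative f (at x within U) w" k] by metis
  qed
  ultimately show ?thesis unfolding Ck_on.simps by metis
qed

lemma Ck_on_SucD:
  assumes "open U" "Ck_on (Suc k) U f"
  shows "x \<in> U \<Longrightarrow> f differentiable (at x)" "Ck_on k U (dir_deriv w f)"
  using assms Ck_on_Suc_open by blast+

lemma Ck_on_open_subset:
  assumes "Ck_on k S f" "U \<subseteq> S" "open U"
  shows "Ck_on k U f"
  using assms(1)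
proof (induction k arbitrary: f)
  case 0
  then show ?case using assms continuous_on_subset by auto
next
  case (Suc k)
  have "at x within S = at x within U" if "x \<in> U" for x
    using that assms by (metis at_within_interior at_within_open interior_maximal subset_iff)
  moreover have "Ck_on k U (\<lambda>x. frechet_derivative f (at x within S) w)" for w
    using Suc by simp
  ultimately have "Ck_on k U (\<lambda>x. frechet_derivative f (at x within U) w)" for w
    using Ck_on_cong[of U "\<lambda>x. frechet_derivative f (at x within S) w"
        "\<lambda>x. frechet_derivative f (at x within U) w" k] by auto
  then show ?case using Suc.prems assms differentiable_on_subset by auto
qed

lemma Ck_on_continuous_on: "Ck_on k S f \<Longrightarrow> continuous_on S f"
  by (cases k) (auto simp: differentiable_imp_continuous_on)

lemma Ck_on_Suc_imp: "Ck_on (Suc k) S f \<Longrightarrow> Ck_on k S f"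
proof (induction k arbitrary: f)
  case 0
  then show ?case by (auto simp: differentiable_imp_continuous_on)
next
  case (Suc k)
  have "f differentiable_on S"
    using Suc.prems by (simp only: Ck_on.simps)
  moreover have "\<forall>w. Ck_on k S (\<lambda>x. frechet_derivative f (at x within S) w)"
    using Suc.prems Suc.IH by (simp only: Ck_on.simps) blast
  ultimately show ?case by simp
qed

lemma Ck_on_le: "Ck_on k S f \<Longrightarrow> j \<le> k \<Longrightarrow> Ck_on j S f"
proof (induction k)
  case (Suc k)
  then show ?case using Ck_on_Suc_imp[of k S f] by (metis le_Suc_eq)
qed simp

lemma Ck_on_const: "open U \<Longrightarrow> Ck_on k U (\<lambda>x. c :: real)"
proof (induction k arbitrary: c)
  case (Suc k)
  have "dir_deriv w (\<lambda>x::'a. c) = (\<lambda>x. 0)" for w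
    by (rule ext, rule dir_deriv_eqI) simp
  then show ?case using Suc by (simp add: Ck_on_Suc_open del: Ck_on.simps)
qed simp

lemma Ck_on_add:
  fixes f g :: "'a::euclidean_space \<Rightarrow> real"
  assumes "open U" "Ck_on k U f" "Ck_on k U g"
  shows "Ck_on k U (\<lambda>x. f x + g x)"
  using assms(2,3)
proof (induction k arbitrary: f g)
  case 0
  then show ?case by (auto intro: continuous_intros)
next
  case (Suc k)
  note f = Ck_on_SucD[OF assms(1) Suc.prems(1)] and g = Ck_on_SucD[OF assms(1) Suc.prems(2)]
  have "Ck_on k U (dir_deriv w (\<lambda>x. f x + g x))" for w
  proof (rule Ck_on_cong[OF _ Suc.IH[OF f(2) g(2)]])
    show "dir_deriv w f x + dir_deriv w g x = dir_deriv w (\<lambda>x. f x + g x) x" if "x \<in> U" for x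
      by (rule dir_deriv_eqI[symmetric])
        (auto intro!: derivative_eq_intros dir_deriv_works f g that)
  qed
  then show ?case using f g assms(1) by (simp add: Ck_on_Suc_open del: Ck_on.simps)
qed

lemma Ck_on_mult:
  fixes f g :: "'a::euclidean_space \<Rightarrow> real"
  assumes "open U" "Ck_on k U f" "Ck_on k U g"
  shows "Ck_on k U (\<lambda>x. f x * g x)"
  using assms(2,3)
proof (induction k arbitrary: f g)
  case 0
  then show ?case by (auto intro: continuous_intros)
next
  case (Suc k)
  note f = Ck_on_SucD[OF assms(1) Suc.prems(1)] and g = Ck_on_SucD[OF assms(1) Suc.prems(2)]
  have "Ck_on k U (dir_deriv w (\<lambda>x. f x * g x))" for w
  proof (rule Ck_on_cong[OF _ Ck_on_add[OF assms(1)
          Suc.IH[OF Ck_on_Suc_imp[OF Suc.prems(1)] g(2)] Suc.IH[OF f(2) Ck_on_Suc_imp[OF Suc.prems(2)]]]])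
    show "f x * dir_deriv w g x + dir_deriv w f x * g x = dir_deriv w (\<lambda>x. f x * g x) x"
      if "x \<in> U" for x
      by (rule dir_deriv_eqI[symmetric])
        (auto intro!: derivative_eq_intros dir_deriv_works f g that)
  qed
  then show ?case using f g assms(1) by (simp add: Ck_on_Suc_open del: Ck_on.simps)
qed

lemma Ck_on_sum:
  fixes f :: "'i \<Rightarrow> 'a::euclidean_space \<Rightarrow> real"
  assumes "open U" "\<And>i. i \<in> I \<Longrightarrow> Ck_on k U (f i)"
  shows "Ck_on k U (\<lambda>x. \<Sum>i\<in>I. f i x)"
  using assms(2)
  by (induction I rule: infinite_finite_induct) (auto intro: Ck_on_const Ck_on_add assms(1))

lemma Ck_on_prod:
  fixes f :: "'i \<Rightarrow> 'a::euclidean_space \<Rightarrow> real"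
  assumes "open U" "\<And>i. i \<in> I \<Longrightarrow> Ck_on k U (f i)"
  shows "Ck_on k U (\<lambda>x. \<Prod>i\<in>I. f i x)"
  using assms(2)
  by (induction I rule: infinite_finite_induct) (auto intro: Ck_on_const Ck_on_mult assms(1))

lemma Ck_on_inverse:
  fixes f :: "'a::euclidean_space \<Rightarrow> real"
  assumes "open U" "Ck_on k U f" "\<And>x. x \<in> U \<Longrightarrow> f x \<noteq> 0"
  shows "Ck_on k U (\<lambda>x. inverse (f x))"
  using assms(2)
proof (induction k)
  case 0
  then show ?case using assms by (auto intro: continuous_intros)
next
  case (Suc k)
  note f = Ck_on_SucD[OF assms(1) Suc.prems]
  note IH = Suc.IH[OF Ck_on_Suc_imp[OF Suc.prems]]
  have "Ck_on k U (dir_deriv w (\<lambda>x. inverse (f x)))" for w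
  proof (rule Ck_on_cong[OF _ Ck_on_mult[OF assms(1) Ck_on_mult[OF assms(1) Ck_on_const[OF assms(1), of _ "-1"] f(2)]
            Ck_on_mult[OF assms(1) IH IH]]])
    show "- 1 * dir_deriv w f x * (inverse (f x) * inverse (f x)) = dir_deriv w (\<lambda>x. inverse (f x)) x"
      if "x \<in> U" for x
      by (rule dir_deriv_eqI[symmetric])
        (auto intro!: derivative_eq_intros dir_deriv_works f that assms(3))
  qed
  moreover have "(\<lambda>x. inverse (f x)) differentiable (at x)" if "x \<in> U" for x
    using f(1)[OF that] assms(3)[OF that] by (intro differentiable_inverse) auto
  ultimately show ?case using assms(1) by (simp add: Ck_on_Suc_open del: Ck_on.simps)
qed

lemma Ck_on_bounded_linear:
  fixes f :: "'a::euclidean_space \<Rightarrow> 'b::real_normed_vector" and L :: "'b \<Rightarrow> 'c::real_normed_vector"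
  assumes "open U" "bounded_linear L" "Ck_on k U f"
  shows "Ck_on k U (\<lambda>x. L (f x))"
  using assms(3)
proof (induction k arbitrary: f)
  case 0
  then show ?case by (auto intro: bounded_linear.continuous_on[OF assms(2)])
next
  case (Suc k)
  have *: "((\<lambda>x. L (f x)) has_derivative (\<lambda>w. L (frechet_derivative f (at x within U) w))) (at x within U)"
    if "x \<in> U" for x
    by (rule bounded_linear.has_derivative[OF assms(2)])
      (use Suc.prems that in \<open>simp add: differentiable_on_def frechet_derivative_works[symmetric]\<close>)
  have "Ck_on k U (\<lambda>x. frechet_derivative (\<lambda>x. L (f x)) (at x within U) w)" for w
  proof (rule Ck_on_cong)
    show "Ck_on k U (\<lambda>x. L (frechet_derivative f (at x within U) w))"
      using Suc by simp
    show "L (frechet_derivative f (at x within U) w) = frechet_derivative (\<lambda>x. L (f x)) (at x within U) w"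
      if "x \<in> U" for x
      using frechet_derivative_at *[OF that] that at_within_open[OF that assms(1)] by metis
  qed
  moreover have "(\<lambda>x. L (f x)) differentiable_on U"
    using * by (auto simp: differentiable_on_def differentiable_def)
  ultimately show ?case by simp
qed

lemma Ck_on_det:
  fixes G :: "'a::euclidean_space \<Rightarrow> real^'n^'n"
  assumes "open U" "\<And>i j. Ck_on k U (\<lambda>x. G x $ i $ j)"
  shows "Ck_on k U (\<lambda>x. det (G x))"
  unfolding det_def using assms
  by (intro Ck_on_sum Ck_on_mult Ck_on_prod Ck_on_const) auto

lemma matrix_inv_works:
  fixes G :: "real^'n^'n"
  assumes "invertible G"
  shows "G ** matrix_inv G = mat 1" "matrix_inv G ** G = mat 1"
  using assms someI_ex[of "\<lambda>B. G ** B = mat 1 \<and> B ** G = mat 1"]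
  unfolding invertible_def matrix_inv_def by auto

text \<open>
  Cramer's rule, which displays the entries of the inverse as quotients of polynomials in the entries
  of the matrix; the inverse metric is therefore as smooth as the metric.
\<close>

lemma matrix_inv_entry:
  fixes G :: "real^'n^'n"
  assumes "invertible G"
  shows "matrix_inv G $ i $ j =
    det (\<chi> p q. if q = i then axis j 1 $ p else G $ p $ q) * inverse (det G)"
proof -
  have d: "det G \<noteq> 0" using assms invertible_det_nz by blast
  have "G *v (matrix_inv G *v axis j 1) = axis j 1"
    by (simp add: matrix_vector_mul_assoc matrix_inv_works(1)[OF assms])
  then have "matrix_inv G *v axis j 1 =
      (\<chi> k. det (\<chi> p q. if q = k then axis j 1 $ p else G $ p $ q) / det G)"
    using cramer[OF d] by blast
  then have "(matrix_inv G *v axis j 1) $ i =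
      det (\<chi> p q. if q = i then axis j 1 $ p else G $ p $ q) / det G" by simp
  moreover have "(matrix_inv G *v axis j 1) $ i = matrix_inv G $ i $ j"
    by (simp add: matrix_vector_mul_component inner_axis)
  ultimately show ?thesis by (simp add: divide_inverse)
qed

lemma Ck_on_matrix_inv:
  fixes G :: "'a::euclidean_space \<Rightarrow> real^'n^'n"
  assumes "open U" "Ck_on k U G" "\<And>x. x \<in> U \<Longrightarrow> invertible (G x)"
  shows "Ck_on k U (\<lambda>x. matrix_inv (G x) $ i $ j)"
proof -
  have e: "Ck_on k U (\<lambda>x. G x $ p $ q)" for p q
    using Ck_on_bounded_linear[OF assms(1) _ assms(2), of "\<lambda>A. A $ p $ q"]
    by (simp add: bounded_linear_compose[OF bounded_linear_vec_nth bounded_linear_vec_nth])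
  have m: "Ck_on k U (\<lambda>x. if q = i then axis j 1 $ p else G x $ p $ q)" for p q
    using e assms(1) by (cases "q = i") (auto intro: Ck_on_const)
  have "Ck_on k U (\<lambda>x. det (\<chi> p q. if q = i then axis j 1 $ p else G x $ p $ q) * inverse (det (G x)))"
    using assms e m
    by (intro Ck_on_mult Ck_on_det Ck_on_inverse) (auto simp: invertible_det_nz)
  then show ?thesis
    by (rule Ck_on_cong[rotated]) (simp add: matrix_inv_entry assms(3))
qed

section \<open>Symmetry of second derivatives\<close>

lemma dir_deriv_line:
  assumes "f differentiable (at (p + s *\<^sub>R u))"
  shows "((\<lambda>s. f (p + s *\<^sub>R u)) has_real_derivative dir_deriv u f (p + s *\<^sub>R u)) (at s)"
proof -
  have "(f has_derivative (\<lambda>w. dir_deriv w f (p + s *\<^sub>R u))) (at (p + s *\<^sub>R u))"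
    using assms dir_deriv_works by blast
  moreover have "((\<lambda>s. p + s *\<^sub>R u) has_derivative (\<lambda>h. h *\<^sub>R u)) (at s)"
    by (auto intro!: derivative_eq_intros)
  ultimately have *: "((\<lambda>s. f (p + s *\<^sub>R u)) has_derivative (\<lambda>h. dir_deriv (h *\<^sub>R u) f (p + s *\<^sub>R u))) (at s)"
    using has_derivative_compose by fastforce
  have "dir_deriv (h *\<^sub>R u) f (p + s *\<^sub>R u) = dir_deriv u f (p + s *\<^sub>R u) * h" for h
    using linear_cmul[OF has_derivative_linear[OF dir_deriv_works[OF assms]]] by simp
  with * show ?thesis by (simp add: has_field_derivative_def)
qed

text \<open>
  The second difference of \<open>F\<close> over a small parallelogram is symmetric in \<open>u\<close> and \<open>w\<close>, and by the mean
  value theorem it is a value of the mixed derivative. Comparing the two orders proves that mixed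
  derivatives commute.
\<close>

lemma second_difference_mean_value:
  assumes "open U" "Ck_on 2 U F" "0 < h"
    and sub: "\<And>s r. s \<in> {0..h} \<Longrightarrow> r \<in> {0..h} \<Longrightarrow> x + s *\<^sub>R u + r *\<^sub>R w \<in> U"
  shows "\<exists>s\<in>{0..h}. \<exists>r\<in>{0..h}. F (x + h *\<^sub>R u + h *\<^sub>R w) - F (x + h *\<^sub>R u) - F (x + h *\<^sub>R w) + F x
     = h\<^sup>2 * dir_deriv w (dir_deriv u F) (x + s *\<^sub>R u + r *\<^sub>R w)"
proof -
  have F2: "Ck_on (Suc (Suc 0)) U F" using assms(2) by (simp add: numeral_2_eq_2)
  note F1 = Ck_on_SucD[OF assms(1) F2]
  note F0 = Ck_on_SucD[OF assms(1) F1(2)]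
  define G where "G s = F ((x + h *\<^sub>R w) + s *\<^sub>R u) - F (x + s *\<^sub>R u)" for s
  have "\<exists>z>0. z < h \<and> G h - G 0 = (h - 0) *
      (dir_deriv u F ((x + h *\<^sub>R w) + z *\<^sub>R u) - dir_deriv u F (x + z *\<^sub>R u))"
  proof (rule MVT2[OF \<open>0 < h\<close>])
    fix s assume s: "0 \<le> s" "s \<le> h"
    have "x + h *\<^sub>R w + s *\<^sub>R u \<in> U" "x + s *\<^sub>R u \<in> U"
      using sub[of s h] sub[of s 0] s assms(3) by (auto simp: add_ac)
    then show "(G has_real_derivative
        dir_deriv u F ((x + h *\<^sub>R w) + s *\<^sub>R u) - dir_deriv u F (x + s *\<^sub>R u)) (at s)"
      unfolding G_def by (intro DERIV_diff dir_deriv_line F1)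
  qed
  then obtain s where s: "0 < s" "s < h" and Gs: "G h - G 0 = h *
      (dir_deriv u F ((x + h *\<^sub>R w) + s *\<^sub>R u) - dir_deriv u F (x + s *\<^sub>R u))" by auto
  define K where "K r = dir_deriv u F ((x + s *\<^sub>R u) + r *\<^sub>R w)" for r
  have "\<exists>z>0. z < h \<and> K h - K 0 = (h - 0) * dir_deriv w (dir_deriv u F) ((x + s *\<^sub>R u) + z *\<^sub>R w)"
  proof (rule MVT2[OF \<open>0 < h\<close>])
    fix r assume r: "0 \<le> r" "r \<le> h"
    have "(x + s *\<^sub>R u) + r *\<^sub>R w \<in> U" using sub[of s r] s r by auto
    then show "(K has_real_derivative dir_deriv w (dir_deriv u F) ((x + s *\<^sub>R u) + r *\<^sub>R w)) (at r)"
      unfolding K_def by (intro dir_deriv_line F0)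
  qed
  then obtain r where r: "0 < r" "r < h"
    and Kr: "K h - K 0 = h * dir_deriv w (dir_deriv u F) ((x + s *\<^sub>R u) + r *\<^sub>R w)" by auto
  have "G h - G 0 = h * (K h - K 0)"
    unfolding Gs K_def by (simp add: add_ac)
  then have "G h - G 0 = h\<^sup>2 * dir_deriv w (dir_deriv u F) ((x + s *\<^sub>R u) + r *\<^sub>R w)"
    using Kr by (simp add: power2_eq_square)
  then show ?thesis using s r unfolding G_def
    by (intro bexI[of _ s] bexI[of _ r]) (auto simp: add_ac)
qed

lemma mixed_dir_deriv_commute:
  fixes F :: "'a::euclidean_space \<Rightarrow> real"
  assumes "open U" "Ck_on 2 U F" "x \<in> U"
  shows "dir_deriv u (dir_deriv w F) x = dir_deriv w (dir_deriv u F) x"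
proof -
  define A where "A = dir_deriv w (dir_deriv u F)"
  define B where "B = dir_deriv u (dir_deriv w F)"
  have F2: "Ck_on (Suc (Suc 0)) U F" using assms(2) by (simp add: numeral_2_eq_2)
  have "continuous_on U A" "continuous_on U B"
    unfolding A_def B_def
    using Ck_on_continuous_on[OF Ck_on_SucD(2)[OF assms(1) Ck_on_SucD(2)[OF assms(1) F2]]] by auto
  then have cont: "isCont A x" "isCont B x"
    using assms by (auto simp: continuous_on_eq_continuous_at)
  have "\<bar>A x - B x\<bar> < 2 * e" if "e > 0" for e
  proof -
    obtain d1 where d1: "d1 > 0" "\<And>y. dist y x < d1 \<Longrightarrow> dist (A y) (A x) < e"
      using cont(1) \<open>e > 0\<close> unfolding continuous_at_eps_delta by metis
    obtain d2 where d2: "d2 > 0" "\<And>y. dist y x < d2 \<Longrightarrow> dist (B y) (B x) < e"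
      using cont(2) \<open>e > 0\<close> unfolding continuous_at_eps_delta by metis
    obtain d3 where d3: "d3 > 0" "ball x d3 \<subseteq> U" using assms openE by blast
    define d where "d = min d1 (min d2 d3)"
    define h where "h = d / (norm u + norm w + 1)"
    have "d > 0" using d1 d2 d3 by (simp add: d_def)
    then have h: "h > 0" by (simp add: h_def add_nonneg_pos)
    have close: "dist (x + s *\<^sub>R u + r *\<^sub>R w) x < d" if "s \<in> {0..h}" "r \<in> {0..h}" for s r
    proof -
      have "norm (s *\<^sub>R u + r *\<^sub>R w) \<le> s * norm u + r * norm w"
        using norm_triangle_ineq[of "s *\<^sub>R u" "r *\<^sub>R w"] that by simp
      also have "\<dots> \<le> h * norm u + h * norm w"
        using that by (intro add_mono mult_right_mono) auto
      also have "\<dots> < h * (norm u + norm w + 1)" using h by (simp add: algebra_simps)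
      also have "\<dots> = d"
        unfolding h_def using norm_ge_zero[of u] norm_ge_zero[of w] by (simp add: field_simps add_nonneg_eq_0_iff) 
      finally show ?thesis by (simp add: dist_norm add.assoc)
    qed
    have sub: "x + s *\<^sub>R u + r *\<^sub>R w \<in> U" if "s \<in> {0..h}" "r \<in> {0..h}" for s r
      using close[OF that] d3 by (auto simp: d_def dist_commute)
    have sub': "x + s *\<^sub>R w + r *\<^sub>R u \<in> U" if "s \<in> {0..h}" "r \<in> {0..h}" for s r
      using sub[OF that(2,1)] by (simp add: add_ac)
    obtain s r where sr: "s \<in> {0..h}" "r \<in> {0..h}" and
      1: "F (x + h *\<^sub>R u + h *\<^sub>R w) - F (x + h *\<^sub>R u) - F (x + h *\<^sub>R w) + F x
        = h\<^sup>2 * A (x + s *\<^sub>R u + r *\<^sub>R w)"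
      using second_difference_mean_value[OF assms(1,2) h sub] unfolding A_def by blast
    obtain s' r' where sr': "s' \<in> {0..h}" "r' \<in> {0..h}" and
      2: "F (x + h *\<^sub>R w + h *\<^sub>R u) - F (x + h *\<^sub>R w) - F (x + h *\<^sub>R u) + F x
        = h\<^sup>2 * B (x + s' *\<^sub>R w + r' *\<^sub>R u)"
      using second_difference_mean_value[OF assms(1,2) h sub'] unfolding B_def by blast
    have "F (x + h *\<^sub>R w + h *\<^sub>R u) = F (x + h *\<^sub>R u + h *\<^sub>R w)" by (simp add: add_ac)
    then have "h\<^sup>2 * A (x + s *\<^sub>R u + r *\<^sub>R w) = h\<^sup>2 * B (x + s' *\<^sub>R w + r' *\<^sub>R u)"
      using 1 2 by linarith
    then have eq: "A (x + s *\<^sub>R u + r *\<^sub>R w) = B (x + r' *\<^sub>R u + s' *\<^sub>R w)"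
      using h by (simp add: add_ac)
    have "dist (A (x + s *\<^sub>R u + r *\<^sub>R w)) (A x) < e"
      using close[OF sr] by (intro d1) (simp add: d_def)
    moreover have "dist (B (x + r' *\<^sub>R u + s' *\<^sub>R w)) (B x) < e"
      using close[OF sr'(2,1)] by (intro d2) (simp add: d_def)
    ultimately show ?thesis using eq by (simp add: dist_real_def)
  qed
  from this[of "\<bar>A x - B x\<bar> / 2"] have "A x = B x" by fastforce
  then show ?thesis by (simp add: A_def B_def)
qed

section \<open>Integration by parts\<close>

text \<open>
  Extended by zero, \<open>F\<close> is \<open>C\<^sup>1\<close> on the whole space. The integral of its translate \<open>F (x + s e)\<close> does not
  depend on \<open>s\<close>, and its derivative at \<open>s = 0\<close> is the integral of the directional derivative.
\<close>

lemma integral_dir_deriv_compact_support: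
  fixes F :: "'a::euclidean_space \<Rightarrow> real"
  assumes "open U" "compact K" "K \<subseteq> cbox l u" "cbox l u \<subseteq> U" and F: "Ck_on 1 U F"
    and zero: "\<And>x. x \<in> U \<Longrightarrow> x \<notin> K \<Longrightarrow> F x = 0"
  shows "integral (cbox l u) (dir_deriv e F) = 0"
proof -
  define F0 where "F0 x = (if x \<in> U then F x else 0)" for x
  have F1: "Ck_on (Suc 0) U F" using F by simp
  have KU: "U \<union> - K = UNIV" "open (- K)"
    using assms(2-4) by (auto intro: compact_imp_closed)
  have F0z: "F0 x = 0" if "x \<in> - K" for x using zero that by (auto simp: F0_def)
  have C1: "Ck_on (Suc 0) U F0"
    by (rule Ck_on_cong[OF _ F1]) (simp add: F0_def)
  have C2: "Ck_on (Suc 0) (- K) F0"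
    by (rule Ck_on_cong[OF _ Ck_on_const[OF KU(2), of "Suc 0" 0]]) (simp add: F0z)
  have diff: "F0 differentiable (at x)" for x
    using Ck_on_SucD(1)[OF assms(1) C1, of x] Ck_on_SucD(1)[OF KU(2) C2, of x] KU(1) by blast
  have "continuous_on (U \<union> - K) (dir_deriv e F0)"
    using Ck_on_SucD(2)[OF assms(1) C1, of e] Ck_on_SucD(2)[OF KU(2) C2, of e]
    by (intro continuous_on_open_Un assms(1) KU(2)) auto
  then have cont: "continuous_on UNIV (dir_deriv e F0)" by (simp only: KU)
  have contF0: "continuous_on UNIV F0"
    using diff by (simp add: continuous_on_eq_continuous_at differentiable_imp_continuous_within)
  have dz: "dir_deriv e F0 x = 0" if "x \<notin> K" for x
  proof -
    have "dir_deriv e F0 x = dir_deriv e (\<lambda>x. 0) x"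
      by (rule dir_deriv_cong_open[OF KU(2)]) (use that F0z in auto)
    also have "\<dots> = 0" by (rule dir_deriv_eqI) simp
    finally show ?thesis .
  qed
  have dF: "dir_deriv e F0 x = dir_deriv e F x" if "x \<in> U" for x
    by (rule dir_deriv_cong_open[OF assms(1) that]) (simp add: F0_def)
  \<comment> \<open>a box that contains the support together with all its translates by at most \<open>e\<close>\<close>
  obtain R where R: "K \<subseteq> ball 0 R" "R > 0"
    using compact_imp_bounded[OF assms(2)] bounded_subset_ballD by blast
  obtain c where c: "cball 0 (R + norm e) \<subseteq> cbox (- c) (c :: 'a)"
    using bounded_subset_cbox_symmetric[OF bounded_cball] by blast
  define I where "I s = integral (cbox (- c) c) (\<lambda>x. F0 (x + s *\<^sub>R e))" for s :: real
  have int_eq: "integral (cbox p q) f = integral UNIV f"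
    if "continuous_on UNIV f" "\<And>x. x \<notin> K \<Longrightarrow> f x = 0" "K \<subseteq> cbox p q" for f :: "'a \<Rightarrow> real" and p q
  proof -
    have "f integrable_on cbox p q"
      using that(1) by (intro integrable_continuous) (auto intro: continuous_on_subset)
    then have "(f has_integral integral (cbox p q) f) (cbox p q)" by blast
    then have "(f has_integral integral (cbox p q) f) UNIV"
      by (rule has_integral_on_superset) (use that in auto)
    then show ?thesis by (simp add: integral_unique)
  qed
  have I_const: "I s = integral UNIV F0" if "s \<in> {-1<..<1}" for s
  proof -
    have "K \<subseteq> cbox (- c + s *\<^sub>R e) (c + s *\<^sub>R e)"
    proof
      fix x assume "x \<in> K"
      then have "norm (x - s *\<^sub>R e) \<le> R + norm e"
        using R norm_triangle_ineq4[of x "s *\<^sub>R e"] that mult_right_mono[of "\<bar>s\<bar>" 1 "norm e"]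
        by (force simp: subset_iff)
      then have "x - s *\<^sub>R e \<in> cbox (- c) c" using c by auto
      then show "x \<in> cbox (- c + s *\<^sub>R e) (c + s *\<^sub>R e)"
        by (simp add: mem_box inner_simps algebra_simps)
    qed
    then have "integral (cbox (- c + s *\<^sub>R e) (c + s *\<^sub>R e)) F0 = integral UNIV F0"
      by (rule int_eq[OF contF0, rotated]) (simp add: F0z)
    then show ?thesis
      using integral_shift_cbox[of "- c + s *\<^sub>R e" "s *\<^sub>R e" "c + s *\<^sub>R e" F0] by (simp add: I_def)
  qed
  have "(I has_field_derivative integral (cbox (- c) c) (\<lambda>x. dir_deriv e F0 (x + 0 *\<^sub>R e))) (at 0 within UNIV)"
    unfolding I_def
  proof (rule leibniz_rule_field_derivative)
    show "((\<lambda>s. F0 (x + s *\<^sub>R e)) has_field_derivative dir_deriv e F0 (x + s *\<^sub>R e)) (at s)" for x s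
      by (rule dir_deriv_line[OF diff])
    show "(\<lambda>x. F0 (x + s *\<^sub>R e)) integrable_on cbox (- c) c" for s
      by (intro integrable_continuous continuous_on_compose2[OF contF0] continuous_intros) auto
    show "continuous_on (UNIV \<times> cbox (- c) c) (\<lambda>(s, x). dir_deriv e F0 (x + s *\<^sub>R e))"
      unfolding split_beta by (intro continuous_on_compose2[OF cont] continuous_intros) auto
  qed auto
  moreover have "(I has_field_derivative 0) (at 0)"
    by (rule has_field_derivative_transform_within_open[of "\<lambda>s. integral UNIV F0" 0 0 "{-1<..<1}"])
      (auto simp: I_const)
  ultimately have "integral (cbox (- c) c) (dir_deriv e F0) = 0"
    using DERIV_unique by fastforce
  moreover have "K \<subseteq> cbox (- c) c" 
  proof
    fix x assume "x \<in> K"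
    then have "norm x < R" using R(1) by auto
    then have "x \<in> cball 0 (R + norm e)" by (simp add: add_increasing2)
    then show "x \<in> cbox (- c) c" using c by blast
  qed
  moreover have "integral (cbox p q) (dir_deriv e F0) = integral UNIV (dir_deriv e F0)"
    if "K \<subseteq> cbox p q" for p q
    by (rule int_eq[OF cont _ that]) (rule dz)
  ultimately have "integral (cbox l u) (dir_deriv e F0) = 0"
    using assms(3) by metis
  moreover have "integral (cbox l u) (dir_deriv e F0) = integral (cbox l u) (dir_deriv e F)"
    using dF assms(4) by (intro integral_cong) auto
  ultimately show ?thesis by simp
qed

section \<open>Change of variables\<close>

text \<open>
  The change of variables formula holds for \<open>real^'n\<close> with a finite, well-ordered index type. For an arbitrary
  finite type the coordinates are relabelled by an initial segment of the natural numbers; the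
  relabelling preserves norms and Lebesgue measure.
\<close>

typedef ('n::finite) ord_index = "{..<CARD('n)}"
  by (rule exI[of _ 0]) simp

lemma card_ord_index: "CARD('n::finite ord_index) = CARD('n)"
  using type_definition.card[OF type_definition_ord_index[where 'n = 'n]] by simp

instance ord_index :: (finite) finite
  by standard
    (metis card_ord_index card.infinite zero_less_card_finite less_irrefl)

instantiation ord_index :: (finite) wellorder
begin

definition "x \<le> y \<longleftrightarrow> Rep_ord_index x \<le> Rep_ord_index y"
definition "x < y \<longleftrightarrow> Rep_ord_index x < Rep_ord_index y"

instance
proof
  fix P :: "'a ord_index \<Rightarrow> bool" and a
  assume "\<And>x. (\<And>y. y < x \<Longrightarrow> P y) \<Longrightarrow> P x"
  then show "P a"
    using measure_induct_rule[of Rep_ord_index P a] by (simp add: less_ord_index_def)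
qed (auto simp: less_eq_ord_index_def less_ord_index_def Rep_ord_index_inject)

end

definition reindex :: "('k \<Rightarrow> 'n) \<Rightarrow> real^'n \<Rightarrow> real^'k" where
  "reindex e x = (\<chi> i. x $ e i)"

lemma reindex_inverse: "bij e \<Longrightarrow> reindex (inv e) (reindex e x) = x"
  "bij e \<Longrightarrow> reindex e (reindex (inv e) y) = y"
  by (auto simp: reindex_def vec_eq_iff bij_is_surj surj_f_inv_f bij_is_inj)

lemma linear_reindex: "linear (reindex e)"
  by (rule linearI) (auto simp: reindex_def vec_eq_iff)

lemma norm_reindex:
  assumes "bij e"
  shows "norm (reindex e x :: real^'k::finite) = norm (x :: real^'n::finite)"
proof -
  have "(\<Sum>i\<in>UNIV. (x $ e i)\<^sup>2) = (\<Sum>j\<in>UNIV. (x $ j)\<^sup>2)"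
    using sum.reindex_bij_betw[of e UNIV UNIV "\<lambda>j. (x $ j)\<^sup>2"] assms by simp
  then show ?thesis by (simp add: norm_vec_def L2_set_def reindex_def)
qed

lemma prod_Basis_vec: "prod f (Basis :: (real^'n::finite) set) = (\<Prod>i\<in>UNIV. f (axis i 1))"
proof -
  have B: "(Basis :: (real^'n) set) = (\<lambda>i. axis i 1) ` UNIV" by (auto simp: Basis_vec_def)
  have "inj (\<lambda>i::'n. axis i (1::real))" by (auto simp: inj_on_def axis_eq_axis)
  then show ?thesis unfolding B by (subst prod.reindex) auto
qed

lemma distr_lborel_reindex:
  assumes "bij (e :: 'k::finite \<Rightarrow> 'n::finite)"
  shows "distr lborel borel (reindex e) = lborel"
proof (rule lborel_eqI[symmetric])
  have meas: "reindex e \<in> borel_measurable borel"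
    by (intro borel_measurable_continuous_onI linear_continuous_on
        linear_conv_bounded_linear[THEN iffD1] linear_reindex)
  fix l u :: "real^'k"
  assume "\<And>b. b \<in> Basis \<Longrightarrow> l \<bullet> b \<le> u \<bullet> b"
  from this[of "axis i 1" for i] have lu: "l $ i \<le> u $ i" for i
    by (auto simp: Basis_vec_def inner_axis)
  have vimage: "reindex e -` box l u = box (reindex (inv e) l) (reindex (inv e) u)"
  proof (intro set_eqI iffI)
    fix x assume x: "x \<in> reindex e -` box l u"
    then have "l $ inv e j < reindex e x $ inv e j \<and> reindex e x $ inv e j < u $ inv e j" for j
      by (simp add: mem_box_cart)
    then show "x \<in> box (reindex (inv e) l) (reindex (inv e) u)"
      using assms by (simp add: mem_box_cart reindex_def bij_is_surj surj_f_inv_f)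
  next
    fix x assume "x \<in> box (reindex (inv e) l) (reindex (inv e) u)"
    then have "reindex (inv e) l $ e i < x $ e i \<and> x $ e i < reindex (inv e) u $ e i" for i
      by (simp add: mem_box_cart)
    then show "x \<in> reindex e -` box l u"
      using assms by (simp add: mem_box_cart reindex_def bij_is_inj)
  qed
  have "emeasure (distr lborel borel (reindex e)) (box l u)
      = emeasure lborel (box (reindex (inv e) l) (reindex (inv e) u))"
    using meas by (subst emeasure_distr) (auto simp: vimage)
  also have "\<dots> = (\<Prod>b\<in>Basis. (reindex (inv e) u - reindex (inv e) l) \<bullet> b)"
    using lu by (intro emeasure_lborel_box) (auto simp: Basis_vec_def inner_axis reindex_def)
  also have "(\<Prod>b\<in>Basis. (reindex (inv e) u - reindex (inv e) l) \<bullet> b) = (\<Prod>j\<in>UNIV. (u - l) $ inv e j)"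
    by (simp add: prod_Basis_vec inner_axis reindex_def)
  also have "\<dots> = (\<Prod>i\<in>UNIV. (u - l) $ i)"
    using prod.reindex_bij_betw[of "inv e" UNIV UNIV "\<lambda>i. (u - l) $ i"] assms bij_imp_bij_inv by blast
  also have "\<dots> = (\<Prod>b\<in>Basis. (u - l) \<bullet> b)"
    by (simp add: prod_Basis_vec inner_axis)
  finally show "emeasure (distr lborel borel (reindex e)) (box l u) = (\<Prod>b\<in>Basis. (u - l) \<bullet> b)" .
qed simp

lemma continuous_on_compact_absolutely_integrable:
  fixes f :: "'a::euclidean_space \<Rightarrow> real"
  assumes "compact S" "continuous_on S f"
  shows "f absolutely_integrable_on S"
    "integral S f = (LINT x|lborel. indicator S x *\<^sub>R f x)"
proof -
  have *: "set_integrable lborel S f"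
    using borel_integrable_compact[OF assms] by (simp add: set_integrable_def)
  show "integral S f = (LINT x|lborel. indicator S x *\<^sub>R f x)"
    using set_borel_integral_eq_integral(2)[OF *] by (simp add: set_lebesgue_integral_def)
  show "f absolutely_integrable_on S"
  proof (rule absolutely_integrable_onI)
    show "f integrable_on S"
      using * by (rule set_borel_integral_eq_integral(1))
    have "set_integrable lborel S (\<lambda>x. norm (f x))"
      using borel_integrable_compact[OF assms(1) continuous_on_norm[OF assms(2)]]
      by (simp add: set_integrable_def)
    then show "(\<lambda>x. norm (f x)) integrable_on S"
      by (rule set_borel_integral_eq_integral(1))
  qed
qed

lemma integral_reindex:
  fixes f :: "real^'n::finite \<Rightarrow> real" and e :: "'k::finite \<Rightarrow> 'n"
  assumes e: "bij e" and "compact S" "continuous_on S f"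
  shows "integral (reindex e ` S) (\<lambda>y. f (reindex (inv e) y)) = integral S f"
proof -
  have lin: "bounded_linear (reindex e)" "bounded_linear (reindex (inv e))"
    using linear_reindex linear_conv_bounded_linear by blast+
  have cS: "compact (reindex e ` S)"
    using assms(2) by (intro compact_continuous_image linear_continuous_on lin)
  have cf: "continuous_on (reindex e ` S) (\<lambda>y. f (reindex (inv e) y))"
    by (rule continuous_on_compose2[OF assms(3)])
      (auto intro!: linear_continuous_on lin simp: reindex_inverse[OF e])
  have ind: "indicator (reindex e ` S) (reindex e x) = (indicator S x :: real)" for x
  proof -
    have "inj (reindex e :: real^'n \<Rightarrow> _)" by (rule inj_on_inverseI) (rule reindex_inverse(1)[OF e])
    then show ?thesis by (simp add: indicator_def inj_image_mem_iff)
  qed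
  have "integral (reindex e ` S) (\<lambda>y. f (reindex (inv e) y))
      = (LINT y|distr lborel borel (reindex e). indicator (reindex e ` S) y *\<^sub>R f (reindex (inv e) y))"
    using continuous_on_compact_absolutely_integrable(2)[OF cS cf] distr_lborel_reindex[OF e] by simp
  also have "\<dots> = (LINT x|lborel. indicator (reindex e ` S) (reindex e x) *\<^sub>R f (reindex (inv e) (reindex e x)))"
  proof (rule integral_distr)
    show "reindex e \<in> measurable lborel borel"
      using borel_measurable_continuous_onI[OF linear_continuous_on[OF lin(1)]] by simp
    show "(\<lambda>y. indicator (reindex e ` S) y *\<^sub>R f (reindex (inv e) y)) \<in> borel_measurable borel"
      using borel_measurable_integrable[OF borel_integrable_compact[OF cS cf]] by simp
  qed
  also have "\<dots> = integral S f"
    using continuous_on_compact_absolutely_integrable(2)[OF assms(2,3)]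
    by (simp add: ind reindex_inverse[OF e])
  finally show ?thesis .
qed

text \<open>
  The Leibniz formula has \<open>n!\<close> terms, each a product of \<open>n\<close> entries.
\<close>

lemma abs_det_le:
  fixes A :: "real^'n^'n"
  assumes "\<And>i j. \<bar>A $ i $ j\<bar> \<le> B"
  shows "\<bar>det A\<bar> \<le> fact CARD('n) * B ^ CARD('n)"
proof -
  have "\<bar>det A\<bar> \<le> (\<Sum>p | p permutes (UNIV :: 'n set). \<bar>of_int (sign p) * (\<Prod>i\<in>UNIV. A $ i $ p i)\<bar>)"
    unfolding det_def by (rule sum_abs)
  also have "\<dots> \<le> (\<Sum>p | p permutes (UNIV :: 'n set). B ^ CARD('n))"
  proof (rule sum_mono)
    fix p :: "'n \<Rightarrow> 'n"
    have "\<bar>of_int (sign p) * (\<Prod>i\<in>UNIV. A $ i $ p i)\<bar> = (\<Prod>i\<in>UNIV. \<bar>A $ i $ p i\<bar>)"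
      by (simp add: abs_mult abs_prod sign_def)
    also have "\<dots> \<le> (\<Prod>i\<in>(UNIV :: 'n set). B)"
      by (rule prod_mono) (use assms in auto)
    finally show "\<bar>of_int (sign p) * (\<Prod>i\<in>UNIV. A $ i $ p i)\<bar> \<le> B ^ CARD('n)" by simp
  qed
  also have "\<dots> = fact CARD('n) * B ^ CARD('n)"
    by (simp add: card_permutations[OF refl])
  finally show ?thesis .
qed

lemma integral_image_le_wellorder:
  fixes \<sigma> :: "real^'n::{finite,wellorder} \<Rightarrow> real^'n::_" and F :: "real^'n::_ \<Rightarrow> real"
  assumes S: "compact S" and d: "\<And>x. x \<in> S \<Longrightarrow> (\<sigma> has_derivative \<sigma>' x) (at x within S)"
    and inj: "inj_on \<sigma> S" and B: "\<And>x v. x \<in> S \<Longrightarrow> norm (\<sigma>' x v) \<le> B * norm v"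
    and F: "continuous_on (\<sigma> ` S) F" "\<And>y. y \<in> \<sigma> ` S \<Longrightarrow> 0 \<le> F y"
  shows "integral (\<sigma> ` S) F \<le> fact CARD('n) * B ^ CARD('n) * integral S (\<lambda>x. F (\<sigma> x))"
proof -
  have cs: "continuous_on S \<sigma>"
    using d by (meson continuous_on_eq_continuous_within has_derivative_continuous)
  then have "compact (\<sigma> ` S)" using S by (rule compact_continuous_image)
  then have "F absolutely_integrable_on (\<sigma> ` S)"
    using F(1) by (rule continuous_on_compact_absolutely_integrable)
  then have 1: "(\<lambda>x. \<bar>det (matrix (\<sigma>' x))\<bar> *\<^sub>R F (\<sigma> x)) absolutely_integrable_on S"
    "integral S (\<lambda>x. \<bar>det (matrix (\<sigma>' x))\<bar> *\<^sub>R F (\<sigma> x)) = integral (\<sigma> ` S) F"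
    using has_absolute_integral_change_of_variables_compact[OF S d inj,
        of "\<lambda>y. vec (F y) :: real^1" "vec (integral (\<sigma> ` S) F)"]
    by (auto simp: absolutely_integrable_on_1_iff integral_on_1_eq vec_eq_iff)
  have "(\<lambda>x. F (\<sigma> x)) absolutely_integrable_on S"
    using S by (rule continuous_on_compact_absolutely_integrable) (rule continuous_on_compose2[OF F(1) cs], simp)
  then have 2: "(\<lambda>x. F (\<sigma> x)) integrable_on S"
    by (rule set_lebesgue_integral_eq_integral(1))
  have "integral S (\<lambda>x. \<bar>det (matrix (\<sigma>' x))\<bar> *\<^sub>R F (\<sigma> x))
      \<le> integral S (\<lambda>x. (fact CARD('n) * B ^ CARD('n)) * F (\<sigma> x))"
  proof (rule integral_le)
    show "(\<lambda>x. \<bar>det (matrix (\<sigma>' x))\<bar> *\<^sub>R F (\<sigma> x)) integrable_on S"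
      using 1(1) by (rule set_lebesgue_integral_eq_integral(1))
    show "(\<lambda>x. (fact CARD('n) * B ^ CARD('n)) * F (\<sigma> x)) integrable_on S"
      using integrable_cmul[OF 2, of "fact CARD('n) * B ^ CARD('n)"] by simp
    fix x assume x: "x \<in> S"
    have "\<bar>matrix (\<sigma>' x) $ i $ j\<bar> \<le> B" for i j
      using component_le_norm_cart[of "\<sigma>' x (axis j 1)" i] B[OF x, of "axis j 1"]
      by (simp add: matrix_def)
    then show "\<bar>det (matrix (\<sigma>' x))\<bar> *\<^sub>R F (\<sigma> x) \<le> (fact CARD('n) * B ^ CARD('n)) * F (\<sigma> x)"
      using F(2) x by (auto intro!: mult_right_mono abs_det_le)
  qed
  then show ?thesis using 1(2) by simp
qed

text \<open>
  The constant is crude, but it depends only on a bound for the derivative and not on \<open>F\<close>, which will be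
  a function of time as well.
\<close>

lemma integral_image_le:
  fixes \<sigma> :: "real^'n::finite \<Rightarrow> real^'n" and F :: "real^'n \<Rightarrow> real"
  assumes S: "compact S" and d: "\<And>x. x \<in> S \<Longrightarrow> (\<sigma> has_derivative \<sigma>' x) (at x within S)"
    and inj: "inj_on \<sigma> S" and B: "\<And>x v. x \<in> S \<Longrightarrow> norm (\<sigma>' x v) \<le> B * norm v"
    and F: "continuous_on (\<sigma> ` S) F" "\<And>y. y \<in> \<sigma> ` S \<Longrightarrow> 0 \<le> F y"
  shows "integral (\<sigma> ` S) F \<le> fact CARD('n) * B ^ CARD('n) * integral S (\<lambda>x. F (\<sigma> x))"
proof -
  obtain e :: "'n ord_index \<Rightarrow> 'n" where e: "bij e"
    using finite_same_card_bij[of "UNIV :: 'n ord_index set" "UNIV :: 'n set"]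
    by (auto simp: card_ord_index)
  let ?T = "reindex e" and ?T' = "reindex (inv e)"
  have lin: "bounded_linear ?T" "bounded_linear ?T'"
    using linear_reindex linear_conv_bounded_linear by blast+
  note inverse = reindex_inverse[OF e]
  define \<rho> where "\<rho> y = ?T (\<sigma> (?T' y))" for y
  have cs: "continuous_on S \<sigma>"
    using d by (meson continuous_on_eq_continuous_within has_derivative_continuous)
  have img: "\<rho> ` ?T ` S = ?T ` \<sigma> ` S"
    by (auto simp: \<rho>_def inverse image_iff)
  have restore: "?T' ` ?T ` S = S" by (auto simp: inverse image_iff)
  have "integral (\<rho> ` ?T ` S) (\<lambda>y. F (?T' y))
      \<le> fact CARD('n ord_index) * B ^ CARD('n ord_index) * integral (?T ` S) (\<lambda>x. F (?T' (\<rho> x)))"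
  proof (rule integral_image_le_wellorder[where \<sigma>' = "\<lambda>y v. ?T (\<sigma>' (?T' y) (?T' v))"])
    show "compact (?T ` S)"
      using S by (intro compact_continuous_image linear_continuous_on lin)
    show "inj_on \<rho> (?T ` S)"
      using inj inverse unfolding \<rho>_def by (auto simp: inj_on_def) (metis inverse(1))
    show "continuous_on (\<rho> ` ?T ` S) (\<lambda>y. F (?T' y))"
      unfolding img
      by (rule continuous_on_compose2[OF F(1)]) (auto intro!: linear_continuous_on lin simp: inverse)
    show "0 \<le> F (?T' y)" if "y \<in> \<rho> ` ?T ` S" for y
      using that F(2) unfolding img by (auto simp: inverse)
    show "(\<rho> has_derivative (\<lambda>v. ?T (\<sigma>' (?T' y) (?T' v)))) (at y within ?T ` S)" if "y \<in> ?T ` S" for y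
    proof -
      have "?T' y \<in> S" using that by (auto simp: inverse)
      then have "(\<sigma> has_derivative \<sigma>' (?T' y)) (at (?T' y) within ?T' ` ?T ` S)"
        using d restore by simp
      then have "((\<lambda>y. \<sigma> (?T' y)) has_derivative (\<lambda>v. \<sigma>' (?T' y) (?T' v))) (at y within ?T ` S)"
        using has_derivative_in_compose[OF bounded_linear_imp_has_derivative[OF lin(2)]] by blast
      then show ?thesis
        unfolding \<rho>_def by (rule bounded_linear.has_derivative[OF lin(1)])
    qed
    show "norm (?T (\<sigma>' (?T' y) (?T' v))) \<le> B * norm v" if "y \<in> ?T ` S" for y v
    proof -
      have "?T' y \<in> S" using that by (auto simp: inverse)
      then show ?thesis
        using B[of "?T' y" "?T' v"] norm_reindex[OF e] norm_reindex[OF bij_imp_bij_inv[OF e]] by simp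
    qed
  qed
  moreover have "integral (\<rho> ` ?T ` S) (\<lambda>y. F (?T' y)) = integral (\<sigma> ` S) F"
    unfolding img using compact_continuous_image[OF cs S] F(1) by (rule integral_reindex[OF e])
  moreover have "integral (?T ` S) (\<lambda>x. F (?T' (\<rho> x))) = integral S (\<lambda>x. F (\<sigma> x))"
    unfolding \<rho>_def inverse
    using S continuous_on_compose2[OF F(1) cs] by (intro integral_reindex[OF e]) auto
  ultimately show ?thesis by (simp add: card_ord_index)
qed

section \<open>Bounded frequency\<close>

text \<open>
  The hypothesis on \<open>D' E - D E'\<close> says that \<open>N = (E + D) / E\<close> satisfies \<open>N' \<le> K N\<close>, so \<open>N\<close> stays bounded
  until the first zero \<open>s\<close> of \<open>E\<close>. Then \<open>E' \<ge> - K C E\<close> before \<open>s\<close>, and \<open>E\<close> decays at most exponentially,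
  which excludes a zero at \<open>s\<close>.
\<close>

lemma frequency_bound_imp_positive:
  fixes E D E' D' :: "real \<Rightarrow> real"
  assumes ab: "a \<le> b" and "0 \<le> K"
    and dE: "\<And>t. t \<in> {a..b} \<Longrightarrow> (E has_real_derivative E' t) (at t)"
    and dD: "\<And>t. t \<in> {a..b} \<Longrightarrow> (D has_real_derivative D' t) (at t)"
    and pos: "\<And>t. t \<in> {a..b} \<Longrightarrow> 0 \<le> E t" "\<And>t. t \<in> {a..b} \<Longrightarrow> 0 \<le> D t"
    and freq: "\<And>t. t \<in> {a..b} \<Longrightarrow> D' t * E t - D t * E' t \<le> K * E t * (E t + D t)"
    and decay: "\<And>t. t \<in> {a..b} \<Longrightarrow> - K * (E t + D t) \<le> E' t"
    and "0 < E a"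
  shows "0 < E b"
proof (rule ccontr)
  assume "\<not> 0 < E b"
  then have Eb: "E b = 0" using pos(1)[of b] ab by force
  have cE: "continuous_on {a..b} E" and cD: "continuous_on {a..b} D"
    using dE dD by (meson DERIV_isCont continuous_at_imp_continuous_on)+
  define Z where "Z = {t\<in>{a..b}. E t = 0}"
  have "closed Z"
    unfolding Z_def by (rule continuous_closed_preimage_constant[OF cE closed_atLeastAtMost])
  moreover have "bounded Z"
    by (rule bounded_subset[of "{a..b}"]) (auto simp: Z_def)
  ultimately have "compact Z" by (simp add: compact_eq_bounded_closed)
  moreover have "Z \<noteq> {}" using Eb ab by (auto simp: Z_def)
  ultimately obtain s where s: "s \<in> Z" "\<And>t. t \<in> Z \<Longrightarrow> s \<le> t"
    using compact_attains_inf[of Z] by auto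
  have sab: "a \<le> s" "s \<le> b" "E s = 0" using s by (auto simp: Z_def)
  have Epos: "0 < E t" if "t \<in> {a..<s}" for t
  proof -
    have "t \<notin> Z" using s(2)[of t] that by auto
    then show ?thesis using pos(1)[of t] that sab by (force simp: Z_def)
  qed
  define N where "N t = (E t + D t) / E t" for t
  define C where "C = N a * exp (K * (b - a))"
  have N: "N t \<le> C" if t: "t \<in> {a..<s}" for t
  proof -
    have "N t * exp (- K * (t - a)) \<le> N a * exp (- K * (a - a))"
    proof (rule DERIV_nonpos_imp_decreasing_open[of _ _ "\<lambda>t. N t * exp (- K * (t - a))"])
      show "a \<le> t" using t by simp
      fix r assume r: "a < r" "r < t"
      then have rab: "r \<in> {a..b}" and Er: "0 < E r" using t sab Epos[of r] by auto
      define N' where "N' = ((E' r + D' r) * E r - (E r + D r) * E' r) / (E r * E r)"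
      have "(N has_real_derivative N') (at r)"
        unfolding N_def N'_def
        by (rule DERIV_divide) (use Er dE[OF rab] dD[OF rab] in \<open>auto intro: DERIV_add\<close>)
      then have "((\<lambda>t. N t * exp (- K * (t - a))) has_real_derivative
          (N' - K * N r) * exp (- K * (r - a))) (at r)"
        by (auto intro!: derivative_eq_intros simp: algebra_simps)
      moreover have "N' \<le> K * N r"
      proof -
        have "N' = (D' r * E r - D r * E' r) / (E r * E r)"
          by (simp add: N'_def algebra_simps)
        also have "\<dots> \<le> (K * E r * (E r + D r)) / (E r * E r)"
          using freq[OF rab] Er by (intro divide_right_mono) auto
        also have "\<dots> = K * N r" using Er by (simp add: N_def)
        finally show ?thesis .
      qed
      ultimately show "\<exists>y. ((\<lambda>t. N t * exp (- K * (t - a))) has_real_derivative y) (at r) \<and> y \<le> 0"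
        by (auto simp: mult_nonpos_nonneg)
    next
      have "{a..t} \<subseteq> {a..b}" using t sab by auto
      moreover have "E r \<noteq> 0" if "r \<in> {a..t}" for r using Epos[of r] that t by auto
      ultimately show "continuous_on {a..t} (\<lambda>t. N t * exp (- K * (t - a)))"
        unfolding N_def
        by (intro continuous_intros continuous_on_subset[OF cE] continuous_on_subset[OF cD]) auto
    qed
    then have "N t * exp (- K * (t - a)) * exp (K * (t - a)) \<le> N a * exp (K * (t - a))"
      by (intro mult_right_mono) auto
    then have "N t \<le> N a * exp (K * (t - a))"
      by (simp add: mult.assoc exp_add[symmetric])
    also have "\<dots> \<le> C"
      unfolding C_def using t sab assms(2) \<open>0 < E a\<close> pos[of a] ab
      by (intro mult_left_mono) (auto simp: N_def intro!: mult_left_mono)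
    finally show ?thesis .
  qed
  have "E a * exp (K * C * a) \<le> E s * exp (K * C * s)"
  proof (rule DERIV_nonneg_imp_increasing_open[of _ _ "\<lambda>t. E t * exp (K * C * t)", OF sab(1)])
    fix r assume r: "a < r" "r < s"
    then have rab: "r \<in> {a..b}" and Er: "0 < E r" using sab Epos[of r] by auto
    have "E r + D r \<le> C * E r"
      using N[of r] r Er by (simp add: N_def divide_le_eq)
    then have "- K * C * E r \<le> E' r"
      using decay[OF rab] mult_left_mono[of "E r + D r" "C * E r" K] assms(2) by (simp add: mult.assoc)
    moreover have "((\<lambda>t. E t * exp (K * C * t)) has_real_derivative (E' r + K * C * E r) * exp (K * C * r)) (at r)"
      using dE[OF rab] by (auto intro!: derivative_eq_intros simp: algebra_simps)
    ultimately show "\<exists>y. ((\<lambda>t. E t * exp (K * C * t)) has_real_derivative y) (at r) \<and> 0 \<le> y"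
      by (intro exI conjI) (auto intro!: mult_nonneg_nonneg)
  next
    show "continuous_on {a..s} (\<lambda>t. E t * exp (K * C * t))"
      using sab by (intro continuous_intros continuous_on_subset[OF cE]) auto
  qed
  then show False using sab(3) \<open>0 < E a\<close> by (simp add: mult_le_0_iff)
qed

text \<open>
  The relations between \<open>L\<^sup>2\<close> energy \<open>E\<close>, Dirichlet energy \<open>D\<close> and source \<open>Q = |R|\<^sup>2\<close> that hold in each chart:
  \<open>P\<close>, \<open>Y\<close> and \<open>S\<close> stand for \<open>|X|\<^sup>2\<close>, \<open>\<langle>X, w\<rangle>\<close> and \<open>\<langle>w, R\<rangle>\<close>, and \<open>Z\<close> is the part of \<open>D'\<close> that comes from the time
  dependence of the metric. Every clause is stable under addition; this is why the Cauchy-Schwarz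
  inequality appears as a family of inequalities in \<open>\<mu>\<close>.
\<close>

definition energy_balance :: "real \<Rightarrow> real \<Rightarrow> (real \<Rightarrow> real) \<Rightarrow> (real \<Rightarrow> real) \<Rightarrow> (real \<Rightarrow> real) \<Rightarrow> bool" where
  "energy_balance t0 t1 E D Q \<longleftrightarrow> (\<exists>P Y S Z C. 0 \<le> C \<and> (\<forall>t\<in>{t0..t1}.
     (E has_real_derivative 2 * Y t + S t) (at t) \<and>
     (D has_real_derivative - 2 * P t + Q t / 2 + Z t) (at t) \<and>
     D t = - Y t + S t / 2 \<and>
     (\<forall>\<mu>. 0 \<le> P t + 2 * \<mu> * Y t + \<mu>\<^sup>2 * E t) \<and>
     Z t \<le> C * D t \<and> - (Q t + E t) \<le> 2 * S t \<and> 0 \<le> E t \<and> 0 \<le> D t))"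

lemma energy_balance_add:
  assumes "energy_balance t0 t1 E1 D1 Q1" "energy_balance t0 t1 E2 D2 Q2"
  shows "energy_balance t0 t1 (\<lambda>t. E1 t + E2 t) (\<lambda>t. D1 t + D2 t) (\<lambda>t. Q1 t + Q2 t)"
proof -
  obtain P1 Y1 S1 Z1 C1 where "0 \<le> C1" and 1: "\<And>t. t \<in> {t0..t1} \<Longrightarrow>
     (E1 has_real_derivative 2 * Y1 t + S1 t) (at t) \<and>
     (D1 has_real_derivative - 2 * P1 t + Q1 t / 2 + Z1 t) (at t) \<and>
     D1 t = - Y1 t + S1 t / 2 \<and>
     (\<forall>\<mu>. 0 \<le> P1 t + 2 * \<mu> * Y1 t + \<mu>\<^sup>2 * E1 t) \<and>
     Z1 t \<le> C1 * D1 t \<and> - (Q1 t + E1 t) \<le> 2 * S1 t \<and> 0 \<le> E1 t \<and> 0 \<le> D1 t"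
    using assms(1) unfolding energy_balance_def by metis
  obtain P2 Y2 S2 Z2 C2 where "0 \<le> C2" and 2: "\<And>t. t \<in> {t0..t1} \<Longrightarrow>
     (E2 has_real_derivative 2 * Y2 t + S2 t) (at t) \<and>
     (D2 has_real_derivative - 2 * P2 t + Q2 t / 2 + Z2 t) (at t) \<and>
     D2 t = - Y2 t + S2 t / 2 \<and>
     (\<forall>\<mu>. 0 \<le> P2 t + 2 * \<mu> * Y2 t + \<mu>\<^sup>2 * E2 t) \<and>
     Z2 t \<le> C2 * D2 t \<and> - (Q2 t + E2 t) \<le> 2 * S2 t \<and> 0 \<le> E2 t \<and> 0 \<le> D2 t"
    using assms(2) unfolding energy_balance_def by metis
  show ?thesis
    unfolding energy_balance_def
  proof (rule exI[of _ "\<lambda>t. P1 t + P2 t"], rule exI[of _ "\<lambda>t. Y1 t + Y2 t"],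
      rule exI[of _ "\<lambda>t. S1 t + S2 t"], rule exI[of _ "\<lambda>t. Z1 t + Z2 t"], rule exI[of _ "C1 + C2"],
      intro conjI ballI)
    fix t assume t: "t \<in> {t0..t1}"
    note 1 = 1[OF t] and 2 = 2[OF t]
    show "((\<lambda>t. E1 t + E2 t) has_real_derivative 2 * (Y1 t + Y2 t) + (S1 t + S2 t)) (at t)"
      using DERIV_add[of E1 "2 * Y1 t + S1 t" t UNIV E2 "2 * Y2 t + S2 t"] 1 2 by (simp add: algebra_simps)
    have "((\<lambda>t. D1 t + D2 t) has_real_derivative
        (- 2 * P1 t + Q1 t / 2 + Z1 t) + (- 2 * P2 t + Q2 t / 2 + Z2 t)) (at t)"
      using 1 2 by (intro DERIV_add) auto
    then show "((\<lambda>t. D1 t + D2 t) has_real_derivative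
        - 2 * (P1 t + P2 t) + (Q1 t + Q2 t) / 2 + (Z1 t + Z2 t)) (at t)"
      by (rule DERIV_cong) (simp add: field_simps)
    show "\<forall>\<mu>. 0 \<le> P1 t + P2 t + 2 * \<mu> * (Y1 t + Y2 t) + \<mu>\<^sup>2 * (E1 t + E2 t)"
    proof
      fix \<mu>
      have "0 \<le> (P1 t + 2 * \<mu> * Y1 t + \<mu>\<^sup>2 * E1 t) + (P2 t + 2 * \<mu> * Y2 t + \<mu>\<^sup>2 * E2 t)"
        using 1 2 by (metis add_nonneg_nonneg)
      then show "0 \<le> P1 t + P2 t + 2 * \<mu> * (Y1 t + Y2 t) + \<mu>\<^sup>2 * (E1 t + E2 t)"
        by (simp add: algebra_simps)
    qed
    have "0 \<le> C1 * D2 t" "0 \<le> C2 * D1 t" using 1 2 \<open>0 \<le> C1\<close> \<open>0 \<le> C2\<close> by auto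
    moreover have "Z1 t \<le> C1 * D1 t" "Z2 t \<le> C2 * D2 t" using 1 2 by auto
    ultimately show "Z1 t + Z2 t \<le> (C1 + C2) * (D1 t + D2 t)"
      by (simp add: algebra_simps)
  qed (use 1 2 \<open>0 \<le> C1\<close> \<open>0 \<le> C2\<close> in \<open>force simp: field_simps\<close>)+
qed

lemma energy_balance_sum:
  assumes "finite I" "\<And>i. i \<in> I \<Longrightarrow> energy_balance t0 t1 (E i) (D i) (Q i)"
  shows "energy_balance t0 t1 (\<lambda>t. \<Sum>i\<in>I. E i t) (\<lambda>t. \<Sum>i\<in>I. D i t) (\<lambda>t. \<Sum>i\<in>I. Q i t)"
  using assms
proof (induction I rule: finite_induct)
  case empty
  show ?case
    unfolding energy_balance_def
    by (rule exI[of _ "\<lambda>_. 0"], rule exI[of _ "\<lambda>_. 0"], rule exI[of _ "\<lambda>_. 0"], rule exI[of _ "\<lambda>_. 0"],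
        rule exI[of _ 0]) auto
next
  case (insert i I)
  then show ?case using energy_balance_add[of t0 t1 "E i" "D i" "Q i"] by simp
qed

text \<open>
  With \<open>Y\<^sup>2 \<le> P E\<close> one finds \<open>D' E - D E' = 2 (Y\<^sup>2 - P E) - S\<^sup>2 / 2 + (Q / 2 + Z) E \<le> (Q / 2 + Z) E\<close>, and a source
  bounded by the energies makes the frequency bound applicable.
\<close>

lemma energy_balance_positive:
  assumes bal: "energy_balance t0 t1 E D Q" and "t0 \<le> t1" and "0 \<le> K"
    and Q: "\<And>t. t \<in> {t0..t1} \<Longrightarrow> Q t \<le> K * (E t + D t)"
    and pos: "0 < E t0"
  shows "0 < E t1"
proof -
  obtain P Y S Z C where "0 \<le> C" and 1: "\<And>t. t \<in> {t0..t1} \<Longrightarrow>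
     (E has_real_derivative 2 * Y t + S t) (at t) \<and>
     (D has_real_derivative - 2 * P t + Q t / 2 + Z t) (at t) \<and>
     D t = - Y t + S t / 2 \<and>
     (\<forall>\<mu>. 0 \<le> P t + 2 * \<mu> * Y t + \<mu>\<^sup>2 * E t) \<and>
     Z t \<le> C * D t \<and> - (Q t + E t) \<le> 2 * S t \<and> 0 \<le> E t \<and> 0 \<le> D t"
    using bal unfolding energy_balance_def by metis
  show ?thesis
  proof (rule frequency_bound_imp_positive[of t0 t1 "K + C + 3" E "\<lambda>t. 2 * Y t + S t" D
        "\<lambda>t. - 2 * P t + Q t / 2 + Z t"])
    fix t assume t: "t \<in> {t0..t1}"
    note 1 = 1[OF t]
    have nn: "0 \<le> E t" "0 \<le> D t" and D: "D t = - Y t + S t / 2" using 1 by auto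
    show "(E has_real_derivative 2 * Y t + S t) (at t)"
      "(D has_real_derivative - 2 * P t + Q t / 2 + Z t) (at t)" using 1 by auto
    show "0 \<le> E t" "0 \<le> D t" by (fact nn)+
    \<comment> \<open>Cauchy-Schwarz, from the discriminant of the quadratic form in \<open>\<mu>\<close>\<close>
    have CS: "(Y t)\<^sup>2 \<le> P t * E t"
    proof (cases "E t = 0")
      case True
      have "Y t = 0"
      proof (rule ccontr)
        assume "Y t \<noteq> 0"
        \<comment> \<open>the form is then affine in \<open>\<mu>\<close>; this \<open>\<mu>\<close> makes it equal to \<open>-1\<close>\<close>
        moreover have "0 \<le> P t + 2 * (- (P t + 1) / (2 * Y t)) * Y t + (- (P t + 1) / (2 * Y t))\<^sup>2 * E t"
          using 1 by blast
        ultimately show False using True by (simp add: field_simps)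
      qed
      then show ?thesis using True by simp
    next
      case False
      then have "0 < E t" using nn by simp
      have "0 \<le> P t + 2 * (- Y t / E t) * Y t + (- Y t / E t)\<^sup>2 * E t" using 1 by blast
      also have "\<dots> = P t - (Y t)\<^sup>2 / E t"
        using \<open>0 < E t\<close> by (simp add: field_simps power2_eq_square)
      finally show ?thesis using \<open>0 < E t\<close> by (simp add: field_simps)
    qed
    have "(- 2 * P t + Q t / 2 + Z t) * E t - D t * (2 * Y t + S t)
        = 2 * ((Y t)\<^sup>2 - P t * E t) - (S t)\<^sup>2 / 2 + (Q t / 2 + Z t) * E t"
      unfolding D by (simp add: power2_eq_square field_simps)
    also have "\<dots> \<le> (Q t / 2 + Z t) * E t" 
    proof -
      have "2 * ((Y t)\<^sup>2 - P t * E t) \<le> 0" using CS by simp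
      moreover have "0 \<le> (S t)\<^sup>2 / 2" by simp
      ultimately show ?thesis by linarith
    qed
    also have "\<dots> \<le> ((K + C + 3) * (E t + D t)) * E t"
    proof (rule mult_right_mono[OF _ nn(1)])
      have "Q t / 2 + Z t \<le> K * (E t + D t) + C * D t"
        using 1 Q[OF t] nn mult_nonneg_nonneg[OF \<open>0 \<le> K\<close>, of "E t + D t"] by (smt (verit, best) field_sum_of_halves)
      also have "\<dots> \<le> (K + C + 3) * (E t + D t)"
        using nn \<open>0 \<le> C\<close> by (simp add: algebra_simps)
      finally show "Q t / 2 + Z t \<le> (K + C + 3) * (E t + D t)" .
    qed
    finally show "(- 2 * P t + Q t / 2 + Z t) * E t - D t * (2 * Y t + S t) \<le> (K + C + 3) * E t * (E t + D t)"
      by (simp add: mult_ac)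
    have "2 * Y t + S t = - 2 * D t + 2 * S t" unfolding D by simp
    also have "\<dots> \<ge> - 2 * D t - (Q t + E t)" using 1 by simp
    finally have "- 2 * D t - (K * (E t + D t) + E t) \<le> 2 * Y t + S t" using Q[OF t] by linarith
    moreover have "- (K + C + 3) * (E t + D t) \<le> - 2 * D t - (K * (E t + D t) + E t)"
      using nn mult_nonneg_nonneg[OF \<open>0 \<le> C\<close> nn(1)] mult_nonneg_nonneg[OF \<open>0 \<le> C\<close> nn(2)]
      by (simp add: algebra_simps)
    ultimately show "- (K + C + 3) * (E t + D t) \<le> 2 * Y t + S t" by linarith
  qed (use assms(2,3) pos \<open>0 \<le> C\<close> in auto)
qed


section \<open>Cutoffs and time slices\<close>

lemma Ck_on_bounded_linear_functional:
  fixes L :: "'a::euclidean_space \<Rightarrow> real"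
  assumes "open U" "bounded_linear L"
  shows "Ck_on k U L"
proof (cases k)
  case 0
  then show ?thesis using linear_continuous_on[OF assms(2)] by simp
next
  case (Suc j)
  have "(L has_derivative L) (at x)" for x
    by (rule bounded_linear_imp_has_derivative[OF assms(2)])
  then have "dir_deriv w L = (\<lambda>x. L w)" "L differentiable (at x)" for w x
    by (auto simp: dir_deriv_eqI differentiable_def)
  then show ?thesis
    using Suc assms(1) Ck_on_const[OF assms(1)] by (simp add: Ck_on_Suc_open del: Ck_on.simps)
qed

lemma has_derivative_pos_part_power:
  "((\<lambda>s. (max 0 s) ^ (k + 2)) has_real_derivative real (k + 2) * (max 0 s) ^ (k + 1)) (at s)" for s :: real
proof -
  consider "s < 0" | "s > 0" | "s = 0" by linarith
  then show ?thesis
  proof cases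
    case 1
    have "((\<lambda>s. 0) has_real_derivative 0) (at s)" by simp
    then have "((\<lambda>s. (max 0 s) ^ (k + 2)) has_real_derivative 0) (at s)"
      by (rule has_field_derivative_transform_within_open[of _ _ _ "{..<0}"]) (use 1 in auto)
    then show ?thesis using 1 by simp
  next
    case 2
    have "((\<lambda>s. s ^ (k + 2)) has_real_derivative real (k + 2) * s ^ (k + 1)) (at s)"
      using DERIV_pow[of "k + 2" s] by simp
    then have "((\<lambda>s. (max 0 s) ^ (k + 2)) has_real_derivative real (k + 2) * s ^ (k + 1)) (at s)"
      by (rule has_field_derivative_transform_within_open[of _ _ _ "{0<..}"]) (use 2 in auto)
    then show ?thesis using 2 by (simp add: max_def)
  next
    \<comment> \<open>at the origin the difference quotient is itself a power of the positive part\<close>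
    case 3
    have "isCont (\<lambda>h::real. (max 0 h) ^ (k + 1)) 0" by (intro continuous_intros)
    then have "(\<lambda>h::real. (max 0 h) ^ (k + 1)) \<midarrow>0\<rightarrow> 0" by (simp add: isCont_def)
    then have "(\<lambda>h::real. ((max 0 (0 + h)) ^ (k + 2) - (max 0 0) ^ (k + 2)) / h) \<midarrow>0\<rightarrow> 0"
      by (rule Lim_transform_eventually) (auto simp: eventually_at max_def intro!: exI[of _ 1])
    then have "((\<lambda>s::real. (max 0 s) ^ (k + 2)) has_real_derivative 0) (at 0)"
      unfolding DERIV_def .
    then show ?thesis using 3 by simp
  qed
qed

text \<open>
  Powers of the positive part serve as cutoffs: they have only finitely many continuous derivatives,
  but two are enough, and all their derivatives are explicit.
\<close>

lemma Ck_on_pos_part_power: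
  fixes f :: "'a::euclidean_space \<Rightarrow> real"
  assumes "open U" "Ck_on k U f"
  shows "Ck_on k U (\<lambda>x. (max 0 (f x)) ^ (k + 1))"
  using assms(2)
proof (induction k)
  case 0
  then show ?case by (auto intro!: continuous_intros)
next
  case (Suc k)
  note f = Ck_on_SucD[OF assms(1) Suc.prems]
  have d: "((\<lambda>x. (max 0 (f x)) ^ (Suc k + 1)) has_derivative
      (\<lambda>w. real (k + 2) * (max 0 (f x)) ^ (k + 1) * dir_deriv w f x)) (at x)" if "x \<in> U" for x
    using has_derivative_compose[OF dir_deriv_works[OF f(1)[OF that]]
        has_derivative_pos_part_power[unfolded has_field_derivative_def, of k "f x"]]
    by simp
  have "Ck_on k U (dir_deriv w (\<lambda>x. (max 0 (f x)) ^ (Suc k + 1)))" for w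
  proof (rule Ck_on_cong[OF _ Ck_on_mult[OF assms(1) Ck_on_mult[OF assms(1) Ck_on_const[OF assms(1)]
            Suc.IH[OF Ck_on_Suc_imp[OF Suc.prems]]] f(2)]])
    show "real (k + 2) * (max 0 (f x)) ^ (k + 1) * dir_deriv w f x
        = dir_deriv w (\<lambda>x. (max 0 (f x)) ^ (Suc k + 1)) x" if "x \<in> U" for x
      using dir_deriv_eqI[OF d[OF that], of w] by (rule sym)
  qed
  moreover have "\<forall>x\<in>U. (\<lambda>x. (max 0 (f x)) ^ (Suc k + 1)) differentiable (at x)"
    using d unfolding differentiable_def by blast
  ultimately show ?case unfolding Ck_on_Suc_open[OF assms(1)] by blast
qed

lemma dir_deriv_mult:
  assumes "f differentiable (at x)" "g differentiable (at x)"
  shows "dir_deriv w (\<lambda>x. f x * g x) x = dir_deriv w f x * g x + f x * dir_deriv w g x"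
  by (rule dir_deriv_eqI) (auto intro!: derivative_eq_intros dir_deriv_works assms)

lemma dir_deriv_add:
  assumes "f differentiable (at x)" "g differentiable (at x)"
  shows "dir_deriv w (\<lambda>x. f x + g x) x = dir_deriv w f x + dir_deriv w g x"
  by (rule dir_deriv_eqI) (auto intro!: derivative_eq_intros dir_deriv_works assms)

lemma dir_deriv_sum:
  assumes "\<And>i. i \<in> I \<Longrightarrow> f i differentiable (at x)"
  shows "dir_deriv w (\<lambda>x. \<Sum>i\<in>I. f i x) x = (\<Sum>i\<in>I. dir_deriv w (f i) x)"
  by (rule dir_deriv_eqI) (auto intro!: derivative_eq_intros dir_deriv_works assms)

lemma dir_deriv_slice:
  assumes "f differentiable (at (y, t))"
  shows "dir_deriv e (\<lambda>y. f (y, t)) y = dir_deriv (e, 0) f (y, t)"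
    "(\<lambda>y. f (y, t)) differentiable (at y)"
    "((\<lambda>t. f (y, t)) has_real_derivative dir_deriv (0, 1) f (y, t)) (at t)"
proof -
  note d = dir_deriv_works[OF assms]
  have "((\<lambda>y. (y, t)) has_derivative (\<lambda>h. (h, 0))) (at y)"
    by (auto intro!: derivative_eq_intros)
  then have *: "((\<lambda>y. f (y, t)) has_derivative (\<lambda>h. dir_deriv (h, 0) f (y, t))) (at y)"
    using has_derivative_compose[of "\<lambda>y. (y, t)" "\<lambda>h. (h, 0)" y UNIV f "\<lambda>w. dir_deriv w f (y, t)"] d by simp
  then show "dir_deriv e (\<lambda>y. f (y, t)) y = dir_deriv (e, 0) f (y, t)"
    "(\<lambda>y. f (y, t)) differentiable (at y)"
    by (auto simp: dir_deriv_eqI differentiable_def)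
  have "f differentiable (at ((y, 0) + t *\<^sub>R (0, 1)))" using assms by simp
  from dir_deriv_line[OF this]
  show "((\<lambda>t. f (y, t)) has_real_derivative dir_deriv (0, 1) f (y, t)) (at t)" by simp
qed

lemma Ck_on_slice:
  fixes f :: "'a::euclidean_space \<times> real \<Rightarrow> real"
  assumes "open U" "open J" "t \<in> J" "Ck_on k (U \<times> J) f"
  shows "Ck_on k U (\<lambda>y. f (y, t))"
  using assms(4)
proof (induction k arbitrary: f)
  case 0
  then have "continuous_on (U \<times> J) f" by simp
  then show ?case
    using assms(3) by (auto intro!: continuous_on_compose2[of "U \<times> J" f] continuous_intros)
next
  case (Suc k)
  note f = Ck_on_SucD[OF open_Times[OF assms(1,2)] Suc.prems]
  have "Ck_on k U (dir_deriv w (\<lambda>y. f (y, t)))" for w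
    by (rule Ck_on_cong[OF _ Suc.IH[OF f(2), of "(w, 0)"]])
      (use f(1) assms(3) in \<open>simp add: dir_deriv_slice(1)\<close>)
  moreover have "(\<lambda>y. f (y, t)) differentiable (at y)" if "y \<in> U" for y
    using that assms(3) by (intro dir_deriv_slice(2) f(1)) auto
  ultimately show ?case
    unfolding Ck_on_Suc_open[OF assms(1)] by simp
qed

lemma has_real_derivative_integral_slice:
  fixes F :: "'a::euclidean_space \<times> real \<Rightarrow> real"
  assumes "open U" "open J" "t \<in> J" "cbox l u \<subseteq> U" "Ck_on 1 (U \<times> J) F"
  shows "((\<lambda>t. integral (cbox l u) (\<lambda>y. F (y, t))) has_real_derivative
     integral (cbox l u) (\<lambda>y. dir_deriv (0, 1) F (y, t))) (at t)"
proof -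
  have "Ck_on (Suc 0) (U \<times> J) F" using assms(5) by simp
  note F = Ck_on_SucD[OF open_Times[OF assms(1,2)] this]
  obtain e where e: "e > 0" "ball t e \<subseteq> J" using assms(2,3) openE by blast
  have "((\<lambda>t. integral (cbox l u) (\<lambda>y. F (y, t))) has_real_derivative
     integral (cbox l u) (\<lambda>y. dir_deriv (0, 1) F (y, t))) (at t within ball t e)"
  proof (rule leibniz_rule_field_derivative)
    fix s y assume s: "s \<in> ball t e" and y: "y \<in> cbox l u"
    then have "F differentiable (at (y, s))" using F(1) e assms(4) by blast
    then show "((\<lambda>s. F (y, s)) has_real_derivative dir_deriv (0, 1) F (y, s)) (at s within ball t e)"
      by (rule has_field_derivative_at_within[OF dir_deriv_slice(3)])
  next
    fix s assume s: "s \<in> ball t e"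
    have "continuous_on U (\<lambda>y. F (y, s))"
      using Ck_on_continuous_on[OF Ck_on_slice[OF assms(1,2) _ assms(5)]] s e by blast
    then show "(\<lambda>y. F (y, s)) integrable_on cbox l u"
      using assms(4) by (intro integrable_continuous) (rule continuous_on_subset)
  next
    have "continuous_on (U \<times> J) (dir_deriv (0, 1) F)" using F(2) by simp
    then show "continuous_on (ball t e \<times> cbox l u) (\<lambda>(s, y). dir_deriv (0, 1) F (y, s))"
      unfolding split_beta
    proof (rule continuous_on_compose2)
      show "continuous_on (ball t e \<times> cbox l u) (\<lambda>p. (snd p, fst p))"
        by (intro continuous_intros)
      show "(\<lambda>p. (snd p, fst p)) ` (ball t e \<times> cbox l u) \<subseteq> U \<times> J"
        using e assms(4) by auto
    qed
  qed (use e in auto)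
  then show ?thesis using e at_within_open[of t "ball t e"] by simp
qed

section \<open>Energies in one chart\<close>

lemma C1_D:
  assumes "open U" "Ck_on 1 U f"
  shows "x \<in> U \<Longrightarrow> f differentiable (at x)" "continuous_on U (dir_deriv w f)" "continuous_on U f"
  using Ck_on_SucD[OF assms(1), of 0 f] Ck_on_continuous_on[OF assms(2)] assms(2) by auto

lemma C2_D:
  assumes "open U" "Ck_on 2 U f"
  shows "Ck_on 1 U f" "Ck_on 1 U (dir_deriv w f)"
  using Ck_on_SucD[OF assms(1), of "Suc 0" f] Ck_on_le[OF assms(2), of 1] assms(2)
  by (auto simp: numeral_2_eq_2 simp del: Ck_on.simps)

abbreviation Dx :: "'n::finite \<Rightarrow> ((real^'n) \<times> real \<Rightarrow> real) \<Rightarrow> (real^'n) \<times> real \<Rightarrow> real" where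
  "Dx i \<equiv> dir_deriv (axis i 1, 0)"

abbreviation Dt :: "('b::euclidean_space \<times> real \<Rightarrow> real) \<Rightarrow> 'b \<times> real \<Rightarrow> real" where
  "Dt \<equiv> dir_deriv (0, 1)"

text \<open>
  The Euclidean length of the spatial gradient is comparable with the Riemannian one on compact sets.
\<close>

definition jet_density :: "((real^'n::finite) \<times> real \<Rightarrow> real) \<Rightarrow> (real^'n) \<times> real \<Rightarrow> real" where
  "jet_density V x = (V x)\<^sup>2 + (\<Sum>k\<in>UNIV. (Dx k V x)\<^sup>2)"

text \<open>
  A solution \<open>V\<close> of a linear parabolic equation on \<open>U \<times> J\<close>, where \<open>U\<close> is the image of a chart, together with
  a ball in \<open>U\<close> on which it will be cut off. All integrals are taken over a box between the ball and
  \<open>U\<close>, outside of which the cutoff and everything built from it vanish.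
\<close>

locale parabolic_chart =
  fixes U :: "(real^'n::finite) set" and J :: "real set"
    and a :: "'n \<Rightarrow> 'n \<Rightarrow> (real^'n) \<times> real \<Rightarrow> real"
    and \<beta> :: "'n \<Rightarrow> (real^'n) \<times> real \<Rightarrow> real" and q :: "real \<Rightarrow> real"
    and V :: "(real^'n) \<times> real \<Rightarrow> real"
    and c l u :: "real^'n" and r t0 t1 :: real
  assumes open_U: "open U" and open_J: "open J" and times: "{t0..t1} \<subseteq> J"
    and r_pos: "0 < r" and ball_box: "cball c r \<subseteq> cbox l u" and box_U: "cbox l u \<subseteq> U"
    and C2_V: "Ck_on 2 (U \<times> J) V"
    and C1_a: "\<And>i j. Ck_on 1 (U \<times> J) (a i j)"
    and a_sym: "\<And>i j x. x \<in> U \<times> J \<Longrightarrow> a i j x = a j i x"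
    and a_pos: "\<And>x \<xi>. x \<in> U \<times> J \<Longrightarrow> \<xi> \<noteq> (0 :: real^'n) \<Longrightarrow> 0 < (\<Sum>i\<in>UNIV. \<Sum>j\<in>UNIV. a i j x * \<xi> $ i * \<xi> $ j)"
    and cont_\<beta>: "\<And>k. continuous_on (U \<times> J) (\<beta> k)"
    and q_bounded: "\<exists>B. \<forall>t\<in>{t0..t1}. \<bar>q t\<bar> \<le> B"
    and pde: "\<And>y t. y \<in> U \<Longrightarrow> t \<in> J \<Longrightarrow> Dt V (y, t)
      = (\<Sum>i\<in>UNIV. \<Sum>j\<in>UNIV. a i j (y, t) * Dx i (Dx j V) (y, t))
        + (\<Sum>k\<in>UNIV. \<beta> k (y, t) * Dx k V (y, t)) + q t * V (y, t)"
begin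

abbreviation "\<Omega> \<equiv> U \<times> J"

text \<open>
  The third power makes \<open>\<phi>\<close> twice continuously differentiable across the boundary of the ball.
\<close>

definition \<phi> :: "(real^'n) \<times> real \<Rightarrow> real" where
  "\<phi> x = (max 0 (r\<^sup>2 - (\<Sum>i\<in>UNIV. (fst x $ i - c $ i)\<^sup>2))) ^ 3"

definition w :: "(real^'n) \<times> real \<Rightarrow> real" where "w x = \<phi> x * V x"

definition flux :: "'n \<Rightarrow> (real^'n) \<times> real \<Rightarrow> real" where
  "flux i x = (\<Sum>j\<in>UNIV. a i j x * Dx j w x)"

text \<open>
  The divergence form makes the operator symmetric for Lebesgue measure in the coordinates, whatever
  the density of the Riemannian measure is; the difference to the equation is of first order and goes
  into the error \<open>R\<close>.
\<close>

definition Lw :: "(real^'n) \<times> real \<Rightarrow> real" where "Lw x = (\<Sum>i\<in>UNIV. Dx i (flux i) x)"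

definition R :: "(real^'n) \<times> real \<Rightarrow> real" where "R x = Dt w x - Lw x"

text \<open>
  Half of the error is subtracted from \<open>\<partial>\<^sub>t w\<close>, so that \<open>\<partial>\<^sub>t w \<cdot> L w = X\<^sup>2 - R\<^sup>2 / 4\<close> has no mixed term.
\<close>

definition X :: "(real^'n) \<times> real \<Rightarrow> real" where "X x = Dt w x - R x / 2"

definition I :: "real \<Rightarrow> ((real^'n) \<times> real \<Rightarrow> real) \<Rightarrow> real" where
  "I t F = integral (cbox l u) (\<lambda>y. F (y, t))"

definition "energy t = I t (\<lambda>x. (w x)\<^sup>2)"
definition "dirichlet t = I t (\<lambda>x. \<Sum>i\<in>UNIV. \<Sum>j\<in>UNIV. a i j x * Dx i w x * Dx j w x)"
definition "dirichlet_rate t = I t (\<lambda>x. \<Sum>i\<in>UNIV. \<Sum>j\<in>UNIV. Dt (a i j) x * Dx i w x * Dx j w x)"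

lemma open_\<Omega>: "open \<Omega>"
  by (intro open_Times open_U open_J)

lemma sum_diff_squares: "(\<Sum>i\<in>UNIV. (y $ i - c $ i)\<^sup>2) = (dist y c)\<^sup>2" for y :: "real^'n"
  by (simp add: dist_norm norm_vec_def L2_set_def sum_nonneg)

lemma \<phi>_outside: "y \<notin> cball c r \<Longrightarrow> \<phi> (y, t) = 0"
  using r_pos power_strict_mono[of r "dist y c" 2]
  by (simp add: \<phi>_def sum_diff_squares dist_commute max_def)

lemma \<phi>_half_ball:
  assumes "y \<in> cball c (r / 2)"
  shows "(3 / 4 * r\<^sup>2) ^ 3 \<le> \<phi> (y, t)"
proof -
  have "(dist y c)\<^sup>2 \<le> (r / 2)\<^sup>2"
    using assms by (intro power_mono) (auto simp: dist_commute)
  then have "3 / 4 * r\<^sup>2 \<le> max 0 (r\<^sup>2 - (dist y c)\<^sup>2)"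
    by (intro max.coboundedI2) (simp add: power_divide)
  then show ?thesis by (simp add: \<phi>_def sum_diff_squares power_mono)
qed

lemma C2_\<phi>: "Ck_on 2 S \<phi>" if "open S"
proof -
  have "Ck_on 2 S (\<lambda>x. fst x $ i)" for i
    using that by (intro Ck_on_bounded_linear_functional bounded_linear_compose[OF bounded_linear_vec_nth bounded_linear_fst])
  then have "Ck_on 2 S (\<lambda>x. r\<^sup>2 + - 1 * (\<Sum>i\<in>UNIV. (fst x $ i + - c $ i) * (fst x $ i + - c $ i)))"
    using that by (intro Ck_on_add Ck_on_mult Ck_on_sum Ck_on_const)
  from Ck_on_pos_part_power[OF that this] show ?thesis
    by (rule Ck_on_cong[rotated]) (simp add: \<phi>_def power2_eq_square)
qed

lemma C2_w: "Ck_on 2 \<Omega> w"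
  unfolding w_def by (intro Ck_on_mult C2_\<phi> open_\<Omega> C2_V)

lemmas C1_\<phi> = C2_D(1)[OF open_\<Omega> C2_\<phi>[OF open_\<Omega>]]
lemmas C1_D\<phi> = C2_D(2)[OF open_\<Omega> C2_\<phi>[OF open_\<Omega>]]
lemmas C1_V = C2_D(1)[OF open_\<Omega> C2_V]
lemmas C1_DV = C2_D(2)[OF open_\<Omega> C2_V]
lemmas C1_w = C2_D(1)[OF open_\<Omega> C2_w]
lemmas C1_Dw = C2_D(2)[OF open_\<Omega> C2_w]

lemma C1_flux: "Ck_on 1 \<Omega> (flux i)"
  unfolding flux_def by (intro Ck_on_sum Ck_on_mult C1_a C1_Dw open_\<Omega>)

lemmas differentiable =
  C1_D(1)[OF open_\<Omega> C1_\<phi>] C1_D(1)[OF open_\<Omega> C1_D\<phi>] C1_D(1)[OF open_\<Omega> C1_V] C1_D(1)[OF open_\<Omega> C1_DV]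
  C1_D(1)[OF open_\<Omega> C1_w] C1_D(1)[OF open_\<Omega> C1_Dw] C1_D(1)[OF open_\<Omega> C1_a] C1_D(1)[OF open_\<Omega> C1_flux]

lemma continuous_Lw: "continuous_on \<Omega> Lw"
  unfolding Lw_def by (intro continuous_intros C1_D(2)[OF open_\<Omega> C1_flux])

lemma continuous_R: "continuous_on \<Omega> R"
  unfolding R_def by (intro continuous_intros C1_D(2)[OF open_\<Omega> C1_w] continuous_Lw)

lemma continuous_X: "continuous_on \<Omega> X"
  unfolding X_def by (intro continuous_intros C1_D(2)[OF open_\<Omega> C1_w] continuous_R) auto

lemma continuous_density: "continuous_on \<Omega> (jet_density V)"
  unfolding jet_density_def[abs_def]
  by (intro continuous_intros C1_D(2)[OF open_\<Omega> C1_V] C1_D(3)[OF open_\<Omega> C1_V])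

lemmas continuous = C1_D(3)[OF open_\<Omega> C1_\<phi>] C1_D(3)[OF open_\<Omega> C1_D\<phi>] C1_D(2)[OF open_\<Omega> C1_D\<phi>]
  C1_D(3)[OF open_\<Omega> C1_V] C1_D(3)[OF open_\<Omega> C1_DV]
  C1_D(3)[OF open_\<Omega> C1_w] C1_D(3)[OF open_\<Omega> C1_Dw] C1_D(2)[OF open_\<Omega> C1_Dw]
  C1_D(3)[OF open_\<Omega> C1_a] C1_D(2)[OF open_\<Omega> C1_a] C1_D(3)[OF open_\<Omega> C1_flux] C1_D(2)[OF open_\<Omega> C1_flux]
  continuous_Lw continuous_R continuous_X continuous_density cont_\<beta>

subsection \<open>Integrals over time slices\<close>

lemma slice_integrable:
  fixes F :: "(real^'n) \<times> real \<Rightarrow> real"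
  assumes "continuous_on \<Omega> F" "t \<in> J"
  shows "(\<lambda>y. F (y, t)) integrable_on cbox l u"
  using box_U assms
  by (intro integrable_continuous) (auto intro!: continuous_on_compose2[OF assms(1)] continuous_intros)

lemma I_add: "continuous_on \<Omega> F \<Longrightarrow> continuous_on \<Omega> G \<Longrightarrow> t \<in> J \<Longrightarrow> I t (\<lambda>x. F x + G x) = I t F + I t G"
  unfolding I_def by (intro integral_add slice_integrable)

lemma I_add3:
  assumes "continuous_on \<Omega> F" "continuous_on \<Omega> G" "continuous_on \<Omega> K" "t \<in> J"
  shows "I t (\<lambda>x. (F x + G x) + K x) = I t F + I t G + I t K"
  using assms by (simp add: I_add continuous_on_add)

lemma I_cmult: "I t (\<lambda>x. k * F x) = k * I t F"
  unfolding I_def by simp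

lemma I_sum: "finite A \<Longrightarrow> (\<And>i. i \<in> A \<Longrightarrow> continuous_on \<Omega> (F i)) \<Longrightarrow> t \<in> J \<Longrightarrow> I t (\<lambda>x. \<Sum>i\<in>A. F i x) = (\<Sum>i\<in>A. I t (F i))"
  unfolding I_def by (intro integral_sum slice_integrable)

lemma I_mono:
  assumes "continuous_on \<Omega> F" "continuous_on \<Omega> G" "t \<in> J" "\<And>y. y \<in> cbox l u \<Longrightarrow> F (y, t) \<le> G (y, t)"
  shows "I t F \<le> I t G"
  unfolding I_def using assms by (intro integral_le slice_integrable)

lemma I_cong: "(\<And>y. y \<in> cbox l u \<Longrightarrow> F (y, t) = G (y, t)) \<Longrightarrow> I t F = I t G"
  unfolding I_def by (rule integral_cong)

lemma I_nonneg:
  assumes "continuous_on \<Omega> F" "t \<in> J" "\<And>y. y \<in> cbox l u \<Longrightarrow> 0 \<le> F (y, t)"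
  shows "0 \<le> I t F"
  unfolding I_def using assms by (intro integral_nonneg slice_integrable)

lemma I_has_derivative:
  assumes "Ck_on 1 \<Omega> F" "t \<in> J"
  shows "((\<lambda>t. I t F) has_real_derivative I t (Dt F)) (at t)"
  unfolding I_def by (rule has_real_derivative_integral_slice[OF open_U open_J assms(2) box_U assms(1)])

text \<open>
  Each \<open>z \<cdot> flux\<close> vanishes outside the ball, so its divergence integrates to zero.
\<close>

lemma integral_by_parts:
  assumes t: "t \<in> J" and z: "Ck_on 1 \<Omega> z" and outside: "\<And>y. y \<in> U \<Longrightarrow> y \<notin> cball c r \<Longrightarrow> z (y, t) = 0"
  shows "I t (\<lambda>x. \<Sum>i\<in>UNIV. \<Sum>j\<in>UNIV. a i j x * Dx i z x * Dx j w x) = - I t (\<lambda>x. z x * Lw x)"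
proof -
  have div: "I t (Dx i (\<lambda>x. z x * flux i x)) = 0" for i
  proof -
    have C1: "Ck_on 1 \<Omega> (\<lambda>x. z x * flux i x)" by (intro Ck_on_mult open_\<Omega> z C1_flux)
    have "integral (cbox l u) (dir_deriv (axis i 1) (\<lambda>y. z (y, t) * flux i (y, t))) = 0"
      by (rule integral_dir_deriv_compact_support[OF open_U compact_cball ball_box box_U
            Ck_on_slice[OF open_U open_J t C1]]) (use outside in simp)
    moreover have "integral (cbox l u) (dir_deriv (axis i 1) (\<lambda>y. z (y, t) * flux i (y, t)))
        = I t (Dx i (\<lambda>x. z x * flux i x))"
      unfolding I_def
      by (rule integral_cong) (use dir_deriv_slice(1)[OF C1_D(1)[OF open_\<Omega> C1]] box_U t in auto)
    ultimately show ?thesis by simp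
  qed
  have cont: "continuous_on \<Omega> (\<lambda>x. Dx i z x * flux i x)" "continuous_on \<Omega> (\<lambda>x. z x * Dx i (flux i) x)" for i
    by (intro continuous_intros continuous C1_D(2,3)[OF open_\<Omega> z])+
  have "I t (Dx i (\<lambda>x. z x * flux i x)) = I t (\<lambda>x. Dx i z x * flux i x + z x * Dx i (flux i) x)" for i
    by (rule I_cong) (use box_U t C1_D(1)[OF open_\<Omega> z] differentiable in \<open>simp add: dir_deriv_mult subset_iff\<close>)
  then have "I t (\<lambda>x. Dx i z x * flux i x) + I t (\<lambda>x. z x * Dx i (flux i) x) = 0" for i
    using div[of i] I_add[OF cont t, of i i] by (simp only:)
  then have "I t (\<lambda>x. Dx i z x * flux i x) = - I t (\<lambda>x. z x * Dx i (flux i) x)" for i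
    by (simp add: eq_neg_iff_add_eq_0)
  then have "(\<Sum>i\<in>UNIV. I t (\<lambda>x. Dx i z x * flux i x)) = - (\<Sum>i\<in>UNIV. I t (\<lambda>x. z x * Dx i (flux i) x))"
    by (simp add: sum_negf)
  then have "I t (\<lambda>x. \<Sum>i\<in>UNIV. Dx i z x * flux i x) = - I t (\<lambda>x. \<Sum>i\<in>UNIV. z x * Dx i (flux i) x)"
    using cont t by (simp add: I_sum)
  then show ?thesis
    by (simp add: Lw_def flux_def sum_distrib_left mult_ac)
qed

subsection \<open>Rates of change\<close>

lemma Dt_w: "y \<in> U \<Longrightarrow> t \<in> J \<Longrightarrow> Dt w (y, t) = \<phi> (y, t) * Dt V (y, t)"
proof -
  assume yt: "y \<in> U" "t \<in> J"
  have "((\<lambda>t. \<phi> (y, t)) has_real_derivative Dt \<phi> (y, t)) (at t)"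
    using yt by (intro dir_deriv_slice(3) differentiable) auto
  moreover have "(\<lambda>t. \<phi> (y, t)) = (\<lambda>_. \<phi> (y, t))" by (simp add: \<phi>_def)
  ultimately have "Dt \<phi> (y, t) = 0" using DERIV_unique DERIV_const by metis
  then show ?thesis
    unfolding w_def using yt by (subst dir_deriv_mult) (auto intro!: differentiable)
qed

lemma energy_has_derivative:
  assumes "t \<in> J"
  shows "(energy has_real_derivative 2 * I t (\<lambda>x. X x * w x) + I t (\<lambda>x. w x * R x)) (at t)"
proof -
  have "I t (Dt (\<lambda>x. (w x)\<^sup>2)) = I t (\<lambda>x. 2 * (X x * w x) + w x * R x)"
    by (rule I_cong)
      (use assms box_U differentiable in \<open>simp add: power2_eq_square dir_deriv_mult subset_iff X_def algebra_simps\<close>)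
  also have "\<dots> = 2 * I t (\<lambda>x. X x * w x) + I t (\<lambda>x. w x * R x)"
    using assms by (subst I_add) (auto intro!: continuous_intros continuous simp: I_cmult)
  moreover have "energy = (\<lambda>t. I t (\<lambda>x. (w x)\<^sup>2))" by (simp add: energy_def fun_eq_iff)
  moreover have "Ck_on 1 \<Omega> (\<lambda>x. (w x)\<^sup>2)"
    unfolding power2_eq_square by (intro Ck_on_mult open_\<Omega> C1_w)
  ultimately show ?thesis using I_has_derivative[of "\<lambda>x. (w x)\<^sup>2" t] assms by (simp only:)
qed

lemma dirichlet_eq:
  assumes "t \<in> J"
  shows "dirichlet t = - I t (\<lambda>x. X x * w x) + I t (\<lambda>x. w x * R x) / 2"
proof -
  have "dirichlet t = - I t (\<lambda>x. w x * Lw x)"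
    unfolding dirichlet_def
    by (rule integral_by_parts[OF assms C1_w]) (simp add: w_def \<phi>_outside)
  also have "I t (\<lambda>x. w x * Lw x) = I t (\<lambda>x. X x * w x + (- 1 / 2) * (w x * R x))"
    by (rule I_cong) (simp add: X_def R_def field_simps)
  also have "\<dots> = I t (\<lambda>x. X x * w x) + (- 1 / 2) * I t (\<lambda>x. w x * R x)"
    using assms by (subst I_add) (auto intro!: continuous_intros continuous simp: I_cmult[symmetric])
  finally show ?thesis by simp
qed

text \<open>
  Since \<open>a\<close> is symmetric and mixed derivatives commute, the terms with a time derivative of \<open>w\<close> are
  twice \<open>\<Sum>\<^sub>i\<^sub>j a\<^sub>i\<^sub>j \<partial>\<^sub>i (\<partial>\<^sub>t w) \<partial>\<^sub>j w\<close>; integration by parts turns them into \<open>- 2 \<partial>\<^sub>t w \<cdot> L w\<close>.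
\<close>

lemma dirichlet_has_derivative:
  assumes t: "t \<in> J"
  shows "(dirichlet has_real_derivative
    - 2 * I t (\<lambda>x. (X x)\<^sup>2) + I t (\<lambda>x. (R x)\<^sup>2) / 2 + dirichlet_rate t) (at t)"
proof -
  define F where "F x = (\<Sum>i\<in>UNIV. \<Sum>j\<in>UNIV. a i j x * Dx i w x * Dx j w x)" for x
  define A where "A x = (\<Sum>i\<in>UNIV. \<Sum>j\<in>UNIV. Dt (a i j) x * Dx i w x * Dx j w x)" for x
  define B where "B x = (\<Sum>i\<in>UNIV. \<Sum>j\<in>UNIV. a i j x * Dx i (Dt w) x * Dx j w x)" for x
  have C1: "Ck_on 1 \<Omega> F"
    unfolding F_def by (intro Ck_on_sum Ck_on_mult open_\<Omega> C1_a C1_Dw)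
  have cont: "continuous_on \<Omega> A" "continuous_on \<Omega> B"
    unfolding A_def B_def by (intro continuous_intros continuous)+
  have DtF: "Dt F x = A x + 2 * B x" if x: "x \<in> \<Omega>" for x
  proof -
    have mixed: "Dt (Dx i w) x = Dx i (Dt w) x" for i
      by (rule mixed_dir_deriv_commute[OF open_\<Omega> C2_w x])
    have "Dt F x = (\<Sum>i\<in>UNIV. \<Sum>j\<in>UNIV. Dt (a i j) x * Dx i w x * Dx j w x
        + a i j x * Dx i (Dt w) x * Dx j w x + a i j x * Dx i w x * Dx j (Dt w) x)"
      unfolding F_def
      by (simp add: dir_deriv_sum dir_deriv_mult differentiable[OF x] mixed algebra_simps)
    also have "\<dots> = A x + B x + (\<Sum>i\<in>UNIV. \<Sum>j\<in>UNIV. a i j x * Dx i w x * Dx j (Dt w) x)"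
      by (simp add: A_def B_def sum.distrib)
    also have "(\<Sum>i\<in>UNIV. \<Sum>j\<in>UNIV. a i j x * Dx i w x * Dx j (Dt w) x) = B x"
      unfolding B_def by (subst sum.swap) (simp add: a_sym[OF x] mult_ac)
    finally show ?thesis by simp
  qed
  have "I t B = - I t (\<lambda>x. Dt w x * Lw x)"
    unfolding B_def
    by (rule integral_by_parts[OF t C1_Dw]) (simp add: Dt_w t \<phi>_outside)
  also have "I t (\<lambda>x. Dt w x * Lw x) = I t (\<lambda>x. (X x)\<^sup>2 + (- 1 / 4) * (R x)\<^sup>2)"
    by (rule I_cong) (simp add: X_def R_def power2_eq_square field_simps)
  also have "\<dots> = I t (\<lambda>x. (X x)\<^sup>2) + (- 1 / 4) * I t (\<lambda>x. (R x)\<^sup>2)"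
    using t by (subst I_add) (auto intro!: continuous_intros continuous simp: I_cmult[symmetric])
  finally have IB: "I t B = - I t (\<lambda>x. (X x)\<^sup>2) + I t (\<lambda>x. (R x)\<^sup>2) / 4" by simp
  have "I t (Dt F) = I t (\<lambda>x. A x + 2 * B x)"
    by (rule I_cong) (use DtF box_U t in auto)
  also have "\<dots> = I t A + 2 * I t B"
    using cont t by (subst I_add) (auto intro!: continuous_intros simp: I_cmult)
  finally have "I t (Dt F) = I t A + 2 * I t B" .
  moreover have "dirichlet_rate t = I t A" by (simp add: dirichlet_rate_def A_def[abs_def])
  ultimately have "I t (Dt F) = - 2 * I t (\<lambda>x. (X x)\<^sup>2) + I t (\<lambda>x. (R x)\<^sup>2) / 2 + dirichlet_rate t"
    using IB by simp
  moreover have "dirichlet = (\<lambda>t. I t F)" by (rule ext) (simp add: dirichlet_def F_def[abs_def])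
  ultimately show ?thesis using I_has_derivative[OF C1 t] by simp
qed

lemma shifted_square_nonneg:
  assumes "t \<in> J"
  shows "0 \<le> I t (\<lambda>x. (X x)\<^sup>2) + 2 * \<mu> * I t (\<lambda>x. X x * w x) + \<mu>\<^sup>2 * energy t"
proof -
  have "0 \<le> I t (\<lambda>x. (X x + \<mu> * w x)\<^sup>2)"
    using assms by (intro I_nonneg continuous_intros continuous) auto
  also have "\<dots> = I t (\<lambda>x. ((X x)\<^sup>2 + (2 * \<mu>) * (X x * w x)) + \<mu>\<^sup>2 * (w x)\<^sup>2)"
    by (rule I_cong) (simp add: power2_eq_square algebra_simps)
  also have "\<dots> = I t (\<lambda>x. (X x)\<^sup>2) + 2 * \<mu> * I t (\<lambda>x. X x * w x) + \<mu>\<^sup>2 * energy t"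
    unfolding energy_def I_cmult[symmetric] using assms
    by (intro I_add3 continuous_intros continuous)
  finally show ?thesis .
qed

lemma energy_nonneg: "t \<in> J \<Longrightarrow> 0 \<le> energy t"
  unfolding energy_def by (intro I_nonneg continuous_intros continuous) auto

lemma source_lower_bound:
  assumes "t \<in> J"
  shows "- (I t (\<lambda>x. (R x)\<^sup>2) + energy t) \<le> 2 * I t (\<lambda>x. w x * R x)"
proof -
  have "0 \<le> I t (\<lambda>x. (R x + w x)\<^sup>2)"
    using assms by (intro I_nonneg continuous_intros continuous) auto
  also have "\<dots> = I t (\<lambda>x. ((R x)\<^sup>2 + 2 * (w x * R x)) + (w x)\<^sup>2)"
    by (rule I_cong) (simp add: power2_eq_square algebra_simps)
  also have "\<dots> = I t (\<lambda>x. (R x)\<^sup>2) + 2 * I t (\<lambda>x. w x * R x) + energy t"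
    unfolding energy_def I_cmult[symmetric] using assms
    by (intro I_add3 continuous_intros continuous)
  finally show ?thesis by simp
qed

end

context parabolic_chart
begin

lemma bounded_above:
  fixes f :: "(real^'n) \<times> real \<Rightarrow> real"
  assumes "continuous_on \<Omega> f"
  obtains M where "0 \<le> M" "\<And>y t. y \<in> cbox l u \<Longrightarrow> t \<in> {t0..t1} \<Longrightarrow> f (y, t) \<le> M"
proof -
  have "compact (f ` (cbox l u \<times> {t0..t1}))"
    using box_U times
    by (intro compact_continuous_image compact_Times continuous_on_subset[OF assms]) auto
  then obtain M where "\<And>v. v \<in> f ` (cbox l u \<times> {t0..t1}) \<Longrightarrow> norm v \<le> M"
    using compact_imp_bounded bounded_iff by metis
  then have "f (y, t) \<le> max 0 M" if "y \<in> cbox l u" "t \<in> {t0..t1}" for y t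
    using that by (force simp: le_max_iff_disj)
  then show ?thesis using that[of "max 0 M"] by auto
qed

text \<open>
  The coefficients of \<open>V\<close> and of its first derivatives in the error \<open>R\<close>, apart from the potential \<open>q\<close>.
\<close>

definition "\<rho>0 x = - (\<Sum>i\<in>UNIV. \<Sum>j\<in>UNIV. Dx i (a i j) x * Dx j \<phi> x + a i j x * Dx i (Dx j \<phi>) x)"
definition "\<rho> k x = \<phi> x * \<beta> k x - (\<Sum>i\<in>UNIV. Dx i (a i k) x * \<phi> x + 2 * (a i k x * Dx i \<phi> x))"

text \<open>
  Both \<open>\<phi> \<partial>\<^sub>t V\<close> and \<open>L (\<phi> V)\<close> contain the second derivatives of \<open>V\<close> as \<open>\<phi> \<Sum>\<^sub>i\<^sub>j a\<^sub>i\<^sub>j \<partial>\<^sub>i\<partial>\<^sub>j V\<close>, so they cancel in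
  the difference.
\<close>

lemma R_first_order:
  assumes y: "y \<in> U" and t: "t \<in> J"
  shows "R (y, t) = V (y, t) * (\<phi> (y, t) * q t + \<rho>0 (y, t)) + (\<Sum>k\<in>UNIV. Dx k V (y, t) * \<rho> k (y, t))"
proof -
  define x where "x = (y, t)"
  have x: "x \<in> \<Omega>" using y t by (simp add: x_def)
  have Dw: "Dx j w z = Dx j \<phi> z * V z + \<phi> z * Dx j V z" if "z \<in> \<Omega>" for j z
    unfolding w_def by (rule dir_deriv_mult) (use that in \<open>auto intro: differentiable\<close>)
  have DDw: "Dx i (Dx j w) x = Dx i (Dx j \<phi>) x * V x + Dx j \<phi> x * Dx i V x
      + (Dx i \<phi> x * Dx j V x + \<phi> x * Dx i (Dx j V) x)" for i j
  proof -
    have "Dx i (Dx j w) x = Dx i (\<lambda>z. Dx j \<phi> z * V z + \<phi> z * Dx j V z) x"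
      by (rule dir_deriv_cong_open[OF open_\<Omega> x Dw])
    then show ?thesis by (simp add: dir_deriv_add dir_deriv_mult differentiable[OF x])
  qed
  define S1 where "S1 = (\<Sum>i\<in>UNIV. \<Sum>j\<in>UNIV. Dx i (a i j) x * Dx j \<phi> x + a i j x * Dx i (Dx j \<phi>) x)"
  define S2 where "S2 = (\<Sum>i\<in>UNIV. \<Sum>j\<in>UNIV. Dx i (a i j) x * \<phi> x * Dx j V x)"
  define S3 where "S3 = (\<Sum>i\<in>UNIV. \<Sum>j\<in>UNIV. a i j x * Dx j \<phi> x * Dx i V x)"
  define S4 where "S4 = (\<Sum>i\<in>UNIV. \<Sum>j\<in>UNIV. a i j x * Dx i \<phi> x * Dx j V x)"
  define S5 where "S5 = (\<Sum>i\<in>UNIV. \<Sum>j\<in>UNIV. a i j x * Dx i (Dx j V) x)"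
  have "Lw x = (\<Sum>i\<in>UNIV. \<Sum>j\<in>UNIV. Dx i (a i j) x * Dx j w x + a i j x * Dx i (Dx j w) x)"
    unfolding Lw_def flux_def by (simp add: dir_deriv_sum dir_deriv_mult differentiable[OF x])
  also have "\<dots> = (\<Sum>i\<in>UNIV. \<Sum>j\<in>UNIV.
      V x * (Dx i (a i j) x * Dx j \<phi> x + a i j x * Dx i (Dx j \<phi>) x)
      + Dx i (a i j) x * \<phi> x * Dx j V x + a i j x * Dx j \<phi> x * Dx i V x
      + a i j x * Dx i \<phi> x * Dx j V x + \<phi> x * (a i j x * Dx i (Dx j V) x))"
    by (simp add: Dw[OF x] DDw algebra_simps)
  also have "\<dots> = V x * S1 + S2 + S3 + S4 + \<phi> x * S5"
    by (simp only: sum.distrib sum_distrib_left[symmetric] S1_def S2_def S3_def S4_def S5_def)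
  also have "S3 = S4"
    unfolding S3_def S4_def by (subst sum.swap) (simp add: a_sym[OF x] mult_ac)
  finally have L: "Lw x = V x * S1 + S2 + 2 * S4 + \<phi> x * S5" by simp
  have "(\<Sum>k\<in>UNIV. Dx k V x * \<rho> k x) = (\<Sum>k\<in>UNIV. \<phi> x * (\<beta> k x * Dx k V x)
      - (\<Sum>i\<in>UNIV. Dx i (a i k) x * \<phi> x * Dx k V x + 2 * (a i k x * Dx i \<phi> x * Dx k V x)))"
    unfolding \<rho>_def by (simp add: right_diff_distrib sum_distrib_left algebra_simps)
  also have "\<dots> = \<phi> x * (\<Sum>k\<in>UNIV. \<beta> k x * Dx k V x) -
     ((\<Sum>k\<in>UNIV. \<Sum>i\<in>UNIV. Dx i (a i k) x * \<phi> x * Dx k V x)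
       + 2 * (\<Sum>k\<in>UNIV. \<Sum>i\<in>UNIV. a i k x * Dx i \<phi> x * Dx k V x))"
    by (simp only: sum_subtractf sum.distrib sum_distrib_left[symmetric])
  also have "(\<Sum>k\<in>UNIV. \<Sum>i\<in>UNIV. Dx i (a i k) x * \<phi> x * Dx k V x) = S2"
    unfolding S2_def by (rule sum.swap)
  also have "(\<Sum>k\<in>UNIV. \<Sum>i\<in>UNIV. a i k x * Dx i \<phi> x * Dx k V x) = S4"
    unfolding S4_def by (rule sum.swap)
  finally have \<rho>: "(\<Sum>k\<in>UNIV. Dx k V x * \<rho> k x) = \<phi> x * (\<Sum>k\<in>UNIV. \<beta> k x * Dx k V x) - (S2 + 2 * S4)" .
  have "R x = \<phi> x * (S5 + (\<Sum>k\<in>UNIV. \<beta> k x * Dx k V x) + q t * V x) - Lw x"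
    unfolding R_def x_def Dt_w[OF y t] pde[OF y t] S5_def by simp
  moreover have "\<rho>0 x = - S1" by (simp add: \<rho>0_def S1_def)
  ultimately show ?thesis
    unfolding x_def[symmetric] \<rho> L by (simp add: algebra_simps)
qed

lemma R_bound:
  obtains C where "0 \<le> C"
    "\<And>y t. y \<in> cbox l u \<Longrightarrow> t \<in> {t0..t1} \<Longrightarrow> (R (y, t))\<^sup>2 \<le> C * jet_density V (y, t)"
proof -
  obtain B where B: "\<And>t. t \<in> {t0..t1} \<Longrightarrow> \<bar>q t\<bar> \<le> B" using q_bounded by blast
  have c\<rho>0: "continuous_on \<Omega> \<rho>0" and c\<rho>: "continuous_on \<Omega> (\<rho> k)" for k
    unfolding \<rho>0_def[abs_def] \<rho>_def[abs_def] by (intro continuous_intros continuous)+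
  have "continuous_on \<Omega> (\<lambda>x. 2 * (\<phi> x)\<^sup>2 * B\<^sup>2 + 2 * (\<rho>0 x)\<^sup>2 + (\<Sum>k\<in>UNIV. (\<rho> k x)\<^sup>2))"
    by (intro continuous_intros continuous c\<rho> c\<rho>0)
  from bounded_above[OF this] obtain M where M: "0 \<le> M" "\<And>y t. y \<in> cbox l u \<Longrightarrow> t \<in> {t0..t1} \<Longrightarrow>
      2 * (\<phi> (y, t))\<^sup>2 * B\<^sup>2 + 2 * (\<rho>0 (y, t))\<^sup>2 + (\<Sum>k\<in>UNIV. (\<rho> k (y, t))\<^sup>2) \<le> M" by blast
  have "(R (y, t))\<^sup>2 \<le> (2 * M) * jet_density V (y, t)" if y: "y \<in> cbox l u" and t: "t \<in> {t0..t1}" for y t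
  proof -
    define s where "s = \<phi> (y, t) * q t + \<rho>0 (y, t)"
    define G where "G = (\<Sum>k\<in>UNIV. Dx k V (y, t) * \<rho> k (y, t))"
    have sq: "(p + p')\<^sup>2 \<le> 2 * p\<^sup>2 + 2 * p'\<^sup>2" for p p' :: real
      using zero_le_power2[of "p - p'"] by (simp add: power2_eq_square algebra_simps)
    have "(q t)\<^sup>2 \<le> B\<^sup>2" using B[OF t] by (meson abs_ge_zero order_trans power2_le_iff_abs_le)
    then have "2 * ((\<phi> (y, t))\<^sup>2 * (q t)\<^sup>2) \<le> 2 * ((\<phi> (y, t))\<^sup>2 * B\<^sup>2)"
      by (intro mult_left_mono) auto
    then have s: "s\<^sup>2 \<le> M"
      using sq[of "\<phi> (y, t) * q t" "\<rho>0 (y, t)"] M(2)[OF y t] sum_nonneg[of UNIV "\<lambda>k. (\<rho> k (y, t))\<^sup>2"]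
      unfolding s_def by (simp add: power_mult_distrib)
    have "(\<Sum>k\<in>UNIV. (\<rho> k (y, t))\<^sup>2) \<le> M"
      using M(2)[OF y t] by (smt (verit) mult_nonneg_nonneg zero_le_power2)
    then have "G\<^sup>2 \<le> (\<Sum>k\<in>UNIV. (Dx k V (y, t))\<^sup>2) * M"
      unfolding G_def using Cauchy_Schwarz_ineq_sum[of "\<lambda>k. Dx k V (y, t)" "\<lambda>k. \<rho> k (y, t)" UNIV]
      by (meson mult_left_mono order_trans sum_nonneg zero_le_power2)
    moreover have "(V (y, t) * s)\<^sup>2 \<le> (V (y, t))\<^sup>2 * M"
      using s by (simp add: power_mult_distrib mult_left_mono)
    moreover have "R (y, t) = V (y, t) * s + G"
      unfolding s_def G_def by (rule R_first_order) (use y t box_U times in auto)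
    ultimately show ?thesis
      using sq[of "V (y, t) * s" G] by (simp add: jet_density_def algebra_simps)
  qed
  then show ?thesis using that[of "2 * M"] M(1) by simp
qed

text \<open>
  The quadratic form attains a positive minimum on the compact set of unit vectors over the box and
  the time interval; homogeneity gives the rest.
\<close>

lemma ellipticity:
  obtains \<kappa> where "0 < \<kappa>"
    "\<And>y t \<xi>. y \<in> cbox l u \<Longrightarrow> t \<in> {t0..t1} \<Longrightarrow>
      \<kappa> * (\<Sum>i\<in>UNIV. (\<xi> i)\<^sup>2) \<le> (\<Sum>i\<in>UNIV. \<Sum>j\<in>UNIV. a i j (y, t) * \<xi> i * \<xi> j)"
proof -
  define A where "A p = (\<Sum>i\<in>UNIV. \<Sum>j\<in>UNIV. a i j (fst p) * (snd p) $ i * (snd p) $ j)"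
    for p :: "((real^'n) \<times> real) \<times> (real^'n)"
  define K where "K = (cbox l u \<times> {t0..t1}) \<times> sphere (0 :: real^'n) 1"
  have "compact K" unfolding K_def by (intro compact_Times) auto
  have K\<Omega>: "fst ` K \<subseteq> \<Omega>" using box_U times by (auto simp: K_def)
  have "continuous_on K (\<lambda>p. a i j (fst p))" for i j
    by (rule continuous_on_compose2[OF C1_D(3)[OF open_\<Omega> C1_a]]) (use K\<Omega> in \<open>auto intro: continuous_intros\<close>)
  then have "continuous_on K A"
    unfolding A_def by (intro continuous_intros)
  have "\<exists>\<kappa>>0. \<forall>p\<in>K. \<kappa> \<le> A p"
  proof (cases "K = {}")
    case False
    then obtain p where p: "p \<in> K" "\<And>p'. p' \<in> K \<Longrightarrow> A p \<le> A p'"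
      using continuous_attains_inf[OF \<open>compact K\<close> _ \<open>continuous_on K A\<close>] by blast
    have "snd p \<noteq> 0" "fst p \<in> \<Omega>" using p(1) K\<Omega> by (auto simp: K_def)
    then have "0 < A p" unfolding A_def by (intro a_pos)
    then show ?thesis using p(2) by blast
  qed (auto intro: exI[of _ 1])
  then obtain \<kappa> where \<kappa>: "0 < \<kappa>" "\<And>p. p \<in> K \<Longrightarrow> \<kappa> \<le> A p" by blast
  have "\<kappa> * (\<Sum>i\<in>UNIV. (\<xi> i)\<^sup>2) \<le> (\<Sum>i\<in>UNIV. \<Sum>j\<in>UNIV. a i j (y, t) * \<xi> i * \<xi> j)"
    if yt: "y \<in> cbox l u" "t \<in> {t0..t1}" for y t \<xi>
  proof (cases "(\<chi> i. \<xi> i) = 0")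
    case True
    then show ?thesis by (simp add: vec_eq_iff)
  next
    case False
    define \<eta> where "\<eta> = (\<chi> i. \<xi> i)"
    define k where "k = norm \<eta>"
    have k: "0 < k" using False by (simp add: k_def \<eta>_def)
    have "((y, t), (1 / k) *\<^sub>R \<eta>) \<in> K" using yt k by (simp add: K_def k_def)
    then have "\<kappa> \<le> A ((y, t), (1 / k) *\<^sub>R \<eta>)" by (rule \<kappa>(2))
    also have "\<dots> = (1 / k)\<^sup>2 * A ((y, t), \<eta>)"
      unfolding A_def by (simp add: sum_distrib_left power2_eq_square mult_ac)
    finally have "\<kappa> * k\<^sup>2 \<le> A ((y, t), \<eta>)" using k by (simp add: field_simps)
    moreover have "k\<^sup>2 = (\<Sum>i\<in>UNIV. (\<xi> i)\<^sup>2)"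
      by (simp add: k_def \<eta>_def norm_vec_def L2_set_def sum_nonneg)
    ultimately show ?thesis by (simp add: A_def \<eta>_def)
  qed
  then show ?thesis using that \<kappa>(1) by blast
qed

lemma dirichlet_nonneg:
  assumes "t \<in> J"
  shows "0 \<le> dirichlet t"
  unfolding dirichlet_def
proof (rule I_nonneg)
  fix y assume "y \<in> cbox l u"
  then have yt: "(y, t) \<in> \<Omega>" using box_U assms by auto
  show "0 \<le> (\<Sum>i\<in>UNIV. \<Sum>j\<in>UNIV. a i j (y, t) * Dx i w (y, t) * Dx j w (y, t))"
    using a_pos[OF yt, of "\<chi> i. Dx i w (y, t)"]
    by (cases "(\<chi> i. Dx i w (y, t)) = 0") (auto simp: vec_eq_iff)
qed (use assms in \<open>auto intro!: continuous_intros continuous\<close>)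

lemma dirichlet_rate_bound:
  obtains C where "0 \<le> C" "\<And>t. t \<in> {t0..t1} \<Longrightarrow> dirichlet_rate t \<le> C * dirichlet t"
proof -
  obtain \<kappa> where \<kappa>: "0 < \<kappa>" "\<And>y t \<xi>. y \<in> cbox l u \<Longrightarrow> t \<in> {t0..t1} \<Longrightarrow>
      \<kappa> * (\<Sum>i\<in>UNIV. (\<xi> i)\<^sup>2) \<le> (\<Sum>i\<in>UNIV. \<Sum>j\<in>UNIV. a i j (y, t) * \<xi> i * \<xi> j)"
    using ellipticity by blast
  have "continuous_on \<Omega> (\<lambda>x. \<Sum>i\<in>UNIV. \<Sum>j\<in>UNIV. \<bar>Dt (a i j) x\<bar>)"
    by (intro continuous_intros continuous)
  from bounded_above[OF this] obtain M where M: "0 \<le> M" "\<And>y t. y \<in> cbox l u \<Longrightarrow> t \<in> {t0..t1} \<Longrightarrow>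
      (\<Sum>i\<in>UNIV. \<Sum>j\<in>UNIV. \<bar>Dt (a i j) (y, t)\<bar>) \<le> M" by blast
  have "dirichlet_rate t \<le> (M / \<kappa>) * dirichlet t" if t: "t \<in> {t0..t1}" for t
    unfolding dirichlet_rate_def dirichlet_def I_cmult[symmetric]
  proof (rule I_mono)
    show "t \<in> J" using t times by auto
    fix y assume y: "y \<in> cbox l u"
    define \<xi> where "\<xi> i = Dx i w (y, t)" for i
    define N where "N = (\<Sum>i\<in>UNIV. (\<xi> i)\<^sup>2)"
    have "0 \<le> N" unfolding N_def by (intro sum_nonneg) auto
    have prod_le: "\<bar>\<xi> i * \<xi> j\<bar> \<le> N" for i j
    proof -
      have "(\<xi> i)\<^sup>2 \<le> N" "(\<xi> j)\<^sup>2 \<le> N" unfolding N_def by (intro member_le_sum; simp)+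
      moreover have "2 * \<bar>\<xi> i * \<xi> j\<bar> \<le> (\<xi> i)\<^sup>2 + (\<xi> j)\<^sup>2"
        using zero_le_power2[of "\<bar>\<xi> i\<bar> - \<bar>\<xi> j\<bar>"] by (simp add: power2_diff abs_mult)
      ultimately show ?thesis by linarith
    qed
    have "(\<Sum>i\<in>UNIV. \<Sum>j\<in>UNIV. Dt (a i j) (y, t) * \<xi> i * \<xi> j)
        \<le> (\<Sum>i\<in>UNIV. \<Sum>j\<in>UNIV. \<bar>Dt (a i j) (y, t)\<bar> * N)"
    proof (intro sum_mono)
      fix i j
      have "Dt (a i j) (y, t) * \<xi> i * \<xi> j \<le> \<bar>Dt (a i j) (y, t)\<bar> * \<bar>\<xi> i * \<xi> j\<bar>"
        by (metis abs_ge_self abs_mult mult.assoc)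
      also have "\<dots> \<le> \<bar>Dt (a i j) (y, t)\<bar> * N" by (intro mult_left_mono prod_le) simp
      finally show "Dt (a i j) (y, t) * \<xi> i * \<xi> j \<le> \<bar>Dt (a i j) (y, t)\<bar> * N" .
    qed
    also have "\<dots> = (\<Sum>i\<in>UNIV. \<Sum>j\<in>UNIV. \<bar>Dt (a i j) (y, t)\<bar>) * N"
      by (simp add: sum_distrib_right)
    also have "\<dots> \<le> M * N" using M(2)[OF y t] \<open>0 \<le> N\<close> by (rule mult_right_mono)
    also have "\<dots> \<le> M / \<kappa> * (\<Sum>i\<in>UNIV. \<Sum>j\<in>UNIV. a i j (y, t) * \<xi> i * \<xi> j)"
      using mult_left_mono[OF \<kappa>(2)[OF y t, of \<xi>] M(1)] \<kappa>(1) by (simp add: N_def field_simps)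
    finally show "(\<Sum>i\<in>UNIV. \<Sum>j\<in>UNIV. Dt (a i j) (y, t) * Dx i w (y, t) * Dx j w (y, t))
        \<le> M / \<kappa> * (\<Sum>i\<in>UNIV. \<Sum>j\<in>UNIV. a i j (y, t) * Dx i w (y, t) * Dx j w (y, t))"
      by (simp add: \<xi>_def)
  qed (intro continuous_intros continuous)+
  then show ?thesis using that[of "M / \<kappa>"] M(1) \<kappa>(1) by simp
qed

lemma energy_balance: "energy_balance t0 t1 energy dirichlet (\<lambda>t. I t (\<lambda>x. (R x)\<^sup>2))"
proof -
  obtain C where C: "0 \<le> C" "\<And>t. t \<in> {t0..t1} \<Longrightarrow> dirichlet_rate t \<le> C * dirichlet t"
    using dirichlet_rate_bound by blast
  show ?thesis
    unfolding energy_balance_def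
  proof (rule exI[of _ "\<lambda>t. I t (\<lambda>x. (X x)\<^sup>2)"], rule exI[of _ "\<lambda>t. I t (\<lambda>x. X x * w x)"],
      rule exI[of _ "\<lambda>t. I t (\<lambda>x. w x * R x)"], rule exI[of _ dirichlet_rate], rule exI[of _ C],
      intro conjI ballI)
    fix t assume t: "t \<in> {t0..t1}"
    then have tJ: "t \<in> J" using times by auto
    have "\<forall>\<mu>. 0 \<le> I t (\<lambda>x. (X x)\<^sup>2) + 2 * \<mu> * I t (\<lambda>x. X x * w x) + \<mu>\<^sup>2 * energy t"
      using shifted_square_nonneg[OF tJ] by blast
    note facts = this energy_has_derivative[OF tJ] dirichlet_has_derivative[OF tJ] dirichlet_eq[OF tJ]
      C(2)[OF t] source_lower_bound[OF tJ] energy_nonneg[OF tJ]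
      dirichlet_nonneg[OF tJ]
    show "(energy has_real_derivative 2 * I t (\<lambda>x. X x * w x) + I t (\<lambda>x. w x * R x)) (at t)"
      "(dirichlet has_real_derivative - 2 * I t (\<lambda>x. (X x)\<^sup>2) + I t (\<lambda>x. (R x)\<^sup>2) / 2 + dirichlet_rate t) (at t)"
      "dirichlet t = - I t (\<lambda>x. X x * w x) + I t (\<lambda>x. w x * R x) / 2"
      "\<forall>\<mu>. 0 \<le> I t (\<lambda>x. (X x)\<^sup>2) + 2 * \<mu> * I t (\<lambda>x. X x * w x) + \<mu>\<^sup>2 * energy t"
      "dirichlet_rate t \<le> C * dirichlet t"
      "- (I t (\<lambda>x. (R x)\<^sup>2) + energy t) \<le> 2 * I t (\<lambda>x. w x * R x)"
      "0 \<le> energy t" "0 \<le> dirichlet t"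
      by (fact facts)+
  qed (rule C(1))
qed

text \<open>
  On the half ball \<open>\<phi> \<ge> \<delta> > 0\<close>, and there \<open>V = w / \<phi>\<close> and \<open>\<phi> \<nabla>V = \<nabla>w - V \<nabla>\<phi>\<close>.
\<close>

lemma half_ball_bound:
  obtains C where "0 \<le> C" "\<And>t. t \<in> {t0..t1} \<Longrightarrow>
    integral (cball c (r / 2)) (\<lambda>y. jet_density V (y, t)) \<le> C * (energy t + dirichlet t)"
proof -
  define \<delta> where "\<delta> = (3 / 4 * r\<^sup>2) ^ 3"
  have \<delta>: "0 < \<delta>" using r_pos by (simp add: \<delta>_def)
  obtain \<kappa> where \<kappa>: "0 < \<kappa>" "\<And>y t \<xi>. y \<in> cbox l u \<Longrightarrow> t \<in> {t0..t1} \<Longrightarrow>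
      \<kappa> * (\<Sum>i\<in>UNIV. (\<xi> i)\<^sup>2) \<le> (\<Sum>i\<in>UNIV. \<Sum>j\<in>UNIV. a i j (y, t) * \<xi> i * \<xi> j)"
    using ellipticity by blast
  have "continuous_on \<Omega> (\<lambda>x. \<Sum>k\<in>UNIV. (Dx k \<phi> x)\<^sup>2)" by (intro continuous_intros continuous)
  from bounded_above[OF this] obtain M where M: "0 \<le> M"
    "\<And>y t. y \<in> cbox l u \<Longrightarrow> t \<in> {t0..t1} \<Longrightarrow> (\<Sum>k\<in>UNIV. (Dx k \<phi> (y, t))\<^sup>2) \<le> M" by blast
  define F where "F x = (w x)\<^sup>2 + (\<Sum>i\<in>UNIV. \<Sum>j\<in>UNIV. a i j x * Dx i w x * Dx j w x)" for x
  define K where "K = 1 + 2 * M / \<delta>\<^sup>2 + 2 / \<kappa>"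
  define C where "C = K / \<delta>\<^sup>2"
  have C: "0 \<le> C" using M(1) \<kappa>(1) by (simp add: C_def K_def)
  have contF: "continuous_on \<Omega> F" unfolding F_def by (intro continuous_intros continuous)
  have half_box: "cball c (r / 2) \<subseteq> cbox l u"
    using ball_box r_pos subset_cball[of "r / 2" r c] by force
  have FA: "0 \<le> (\<Sum>i\<in>UNIV. \<Sum>j\<in>UNIV. a i j (y, t) * Dx i w (y, t) * Dx j w (y, t))"
    if "y \<in> cbox l u" "t \<in> {t0..t1}" for y t
    using \<kappa>(2)[OF that, of "\<lambda>i. Dx i w (y, t)"] \<kappa>(1)
    by (meson mult_nonneg_nonneg order_trans sum_nonneg zero_le_power2 less_imp_le)
  have pointwise: "jet_density V (y, t) \<le> C * F (y, t)" if y: "y \<in> cball c (r / 2)" and t: "t \<in> {t0..t1}" for y t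
  proof -
    have ybox: "y \<in> cbox l u" using y half_box by blast
    have yt: "(y, t) \<in> \<Omega>" using ybox box_U t times by auto
    define A where "A = (\<Sum>i\<in>UNIV. \<Sum>j\<in>UNIV. a i j (y, t) * Dx i w (y, t) * Dx j w (y, t))"
    have \<phi>\<delta>: "\<delta>\<^sup>2 \<le> (\<phi> (y, t))\<^sup>2"
      using \<phi>_half_ball[OF y] \<delta> unfolding \<delta>_def by (intro power_mono) auto
    have w2: "\<delta>\<^sup>2 * (V (y, t))\<^sup>2 \<le> (w (y, t))\<^sup>2"
      using mult_right_mono[OF \<phi>\<delta>, of "(V (y, t))\<^sup>2"] by (simp add: w_def power_mult_distrib)
    have grad: "\<delta>\<^sup>2 * (Dx k V (y, t))\<^sup>2 \<le> 2 * (Dx k w (y, t))\<^sup>2 + 2 * (V (y, t))\<^sup>2 * (Dx k \<phi> (y, t))\<^sup>2" for k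
    proof -
      have "Dx k w (y, t) = Dx k \<phi> (y, t) * V (y, t) + \<phi> (y, t) * Dx k V (y, t)"
        unfolding w_def by (rule dir_deriv_mult) (use yt in \<open>auto intro: differentiable\<close>)
      then have e: "\<phi> (y, t) * Dx k V (y, t) = Dx k w (y, t) - Dx k \<phi> (y, t) * V (y, t)" by simp
      have "\<delta>\<^sup>2 * (Dx k V (y, t))\<^sup>2 \<le> (\<phi> (y, t) * Dx k V (y, t))\<^sup>2"
        using mult_right_mono[OF \<phi>\<delta>, of "(Dx k V (y, t))\<^sup>2"] by (simp add: power_mult_distrib)
      also have "\<dots> \<le> 2 * (Dx k w (y, t))\<^sup>2 + 2 * (V (y, t))\<^sup>2 * (Dx k \<phi> (y, t))\<^sup>2"
        unfolding e using zero_le_power2[of "Dx k w (y, t) + Dx k \<phi> (y, t) * V (y, t)"]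
        by (simp add: power2_eq_square algebra_simps)
      finally show ?thesis .
    qed
    have "\<delta>\<^sup>2 * (\<Sum>k\<in>UNIV. (Dx k V (y, t))\<^sup>2)
        \<le> (\<Sum>k\<in>UNIV. 2 * (Dx k w (y, t))\<^sup>2 + 2 * (V (y, t))\<^sup>2 * (Dx k \<phi> (y, t))\<^sup>2)"
      unfolding sum_distrib_left by (intro sum_mono grad)
    also have "\<dots> = 2 * (\<Sum>k\<in>UNIV. (Dx k w (y, t))\<^sup>2) + 2 * (V (y, t))\<^sup>2 * (\<Sum>k\<in>UNIV. (Dx k \<phi> (y, t))\<^sup>2)"
      by (simp add: sum.distrib sum_distrib_left)
    also have "\<dots> \<le> 2 * (A / \<kappa>) + 2 * ((w (y, t))\<^sup>2 / \<delta>\<^sup>2) * M"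
    proof (intro add_mono mult_mono)
      show "(\<Sum>k\<in>UNIV. (Dx k w (y, t))\<^sup>2) \<le> A / \<kappa>"
        using \<kappa>(2)[OF ybox t, of "\<lambda>k. Dx k w (y, t)"] \<kappa>(1) by (simp add: A_def field_simps)
      show "(V (y, t))\<^sup>2 \<le> (w (y, t))\<^sup>2 / \<delta>\<^sup>2" using w2 \<delta> by (simp add: field_simps)
    qed (use M(2)[OF ybox t] M(1) in \<open>auto intro!: sum_nonneg\<close>)
    finally have g: "\<delta>\<^sup>2 * (\<Sum>k\<in>UNIV. (Dx k V (y, t))\<^sup>2) \<le> 2 * (A / \<kappa>) + 2 * ((w (y, t))\<^sup>2 / \<delta>\<^sup>2) * M" .
    have "\<delta>\<^sup>2 * jet_density V (y, t) \<le> (1 + 2 * M / \<delta>\<^sup>2) * (w (y, t))\<^sup>2 + (2 / \<kappa>) * A"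
      using g w2 by (simp add: jet_density_def algebra_simps)
    also have "\<dots> \<le> (1 + 2 * M / \<delta>\<^sup>2) * F (y, t) + (2 / \<kappa>) * F (y, t)"
      using FA[OF ybox t] M(1) \<kappa>(1)
      by (intro add_mono mult_left_mono) (auto simp: F_def A_def)
    finally have "\<delta>\<^sup>2 * jet_density V (y, t) \<le> K * F (y, t)"
      by (simp add: K_def algebra_simps)
    then show ?thesis using \<delta> by (simp add: C_def field_simps)
  qed
  have "integral (cball c (r / 2)) (\<lambda>y. jet_density V (y, t)) \<le> C * (energy t + dirichlet t)"
    if t: "t \<in> {t0..t1}" for t
  proof -
    have tJ: "t \<in> J" using t times by auto
    have int: "(\<lambda>y. G (y, t)) integrable_on cball c (r / 2)" if "continuous_on \<Omega> G" for G :: "_ \<Rightarrow> real"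
      using half_box box_U tJ
      by (intro set_lebesgue_integral_eq_integral(1) continuous_on_compact_absolutely_integrable(1)
          continuous_on_compose2[OF that] continuous_intros) auto
    have cCF: "continuous_on \<Omega> (\<lambda>x. C * F x)" by (intro continuous_intros contF)
    have "integral (cball c (r / 2)) (\<lambda>y. jet_density V (y, t)) \<le> integral (cball c (r / 2)) (\<lambda>y. C * F (y, t))"
      by (rule integral_le[OF int[OF continuous_density] int[OF cCF]]) (rule pointwise[OF _ t])
    also have "\<dots> \<le> integral (cbox l u) (\<lambda>y. C * F (y, t))"
      by (rule integral_subset_le[OF half_box int[OF cCF] slice_integrable[OF cCF tJ]])
        (use C FA[OF _ t] in \<open>auto simp: F_def intro!: mult_nonneg_nonneg add_nonneg_nonneg\<close>)
    also have "\<dots> = C * I t F" using I_cmult[of t C F] by (simp add: I_def)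
    also have "I t F = energy t + dirichlet t"
      unfolding F_def energy_def dirichlet_def
      by (rule I_add) (use tJ in \<open>auto intro!: continuous_intros continuous\<close>)
    finally show ?thesis .
  qed
  then show ?thesis using that C by blast
qed

lemma energy_zero_imp:
  assumes "t \<in> J" "energy t = 0" "y \<in> cball c (r / 2)"
  shows "V (y, t) = 0"
proof -
  have "ball c r \<subseteq> box l u"
    using interior_mono[OF ball_box] by simp
  then have ne: "box l u \<noteq> {}" using r_pos by auto
  have "continuous_on \<Omega> (\<lambda>x. (w x)\<^sup>2)" by (intro continuous_intros continuous)
  then have "continuous_on (cbox l u) (\<lambda>y. (w (y, t))\<^sup>2)"
    by (rule continuous_on_compose2[where g = "\<lambda>x. (w x)\<^sup>2"])
      (use box_U assms(1) in \<open>auto intro!: continuous_intros\<close>)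
  then have "\<forall>y\<in>cbox l u. (w (y, t))\<^sup>2 = 0"
    using integral_cbox_eq_0_iff[of l u "\<lambda>y. (w (y, t))\<^sup>2"] ne assms(2) by (simp add: energy_def I_def)
  moreover have "y \<in> cbox l u" using assms(3) ball_box r_pos by (auto simp: subset_iff)
  ultimately have "\<phi> (y, t) * V (y, t) = 0" by (simp add: w_def)
  moreover have "0 < \<phi> (y, t)"
    using \<phi>_half_ball[OF assms(3)] r_pos by (intro less_le_trans[OF _ \<phi>_half_ball[OF assms(3)]]) simp
  ultimately show ?thesis by simp
qed

lemma energy_zeroI:
  assumes "\<And>y. y \<in> U \<Longrightarrow> V (y, t) = 0"
  shows "energy t = 0"
proof -
  have "energy t = I t (\<lambda>x. 0)"
    unfolding energy_def by (rule I_cong) (use assms box_U in \<open>auto simp: w_def\<close>)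
  then show ?thesis by (simp add: I_def)
qed

text \<open>
  What the other charts need to know: the source is bounded by \<open>V\<^sup>2 + |\<nabla>V|\<^sup>2\<close> on the whole box, while the
  energies control that density on the half ball only.
\<close>

lemma chart_energy:
  obtains E D Q C where "energy_balance t0 t1 E D Q" "0 \<le> C"
    "\<And>t. t \<in> {t0..t1} \<Longrightarrow> Q t \<le> C * integral (cbox l u) (\<lambda>y. jet_density V (y, t))"
    "\<And>t. t \<in> {t0..t1} \<Longrightarrow> integral (cball c (r / 2)) (\<lambda>y. jet_density V (y, t)) \<le> C * (E t + D t)"
    "\<And>t. t \<in> {t0..t1} \<Longrightarrow> 0 \<le> E t" "\<And>t. t \<in> {t0..t1} \<Longrightarrow> 0 \<le> D t"
    "\<And>t y. t \<in> {t0..t1} \<Longrightarrow> E t = 0 \<Longrightarrow> y \<in> cball c (r / 2) \<Longrightarrow> V (y, t) = 0"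
    "\<And>t. (\<And>y. y \<in> U \<Longrightarrow> V (y, t) = 0) \<Longrightarrow> E t = 0"
proof -
  obtain C1 where C1: "0 \<le> C1"
    "\<And>y t. y \<in> cbox l u \<Longrightarrow> t \<in> {t0..t1} \<Longrightarrow> (R (y, t))\<^sup>2 \<le> C1 * jet_density V (y, t)"
    using R_bound by blast
  obtain C2 where C2: "0 \<le> C2" "\<And>t. t \<in> {t0..t1} \<Longrightarrow>
    integral (cball c (r / 2)) (\<lambda>y. jet_density V (y, t)) \<le> C2 * (energy t + dirichlet t)"
    using half_ball_bound by blast
  have J: "t \<in> J" if "t \<in> {t0..t1}" for t using that times by auto
  show ?thesis
  proof (rule that[of energy dirichlet "\<lambda>t. I t (\<lambda>x. (R x)\<^sup>2)" "C1 + C2"])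
    show "energy_balance t0 t1 energy dirichlet (\<lambda>t. I t (\<lambda>x. (R x)\<^sup>2))" by (rule energy_balance)
    show "0 \<le> C1 + C2" using C1 C2 by simp
    fix t assume t: "t \<in> {t0..t1}"
    show nn: "0 \<le> energy t" "0 \<le> dirichlet t" using energy_nonneg dirichlet_nonneg J[OF t] by auto
    have "I t (\<lambda>x. (R x)\<^sup>2) \<le> I t (\<lambda>x. C1 * jet_density V x)"
      by (rule I_mono) (use C1(2)[OF _ t] J[OF t] in \<open>auto intro!: continuous_intros continuous\<close>)
    also have "\<dots> = C1 * I t (jet_density V)" by (rule I_cmult)
    also have "\<dots> \<le> (C1 + C2) * I t (jet_density V)"
      using C2(1) J[OF t] continuous_density
      by (intro mult_right_mono I_nonneg) (auto simp: jet_density_def intro!: add_nonneg_nonneg sum_nonneg)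
    finally show "I t (\<lambda>x. (R x)\<^sup>2) \<le> (C1 + C2) * integral (cbox l u) (\<lambda>y. jet_density V (y, t))"
      by (simp add: I_def)
    show "integral (cball c (r / 2)) (\<lambda>y. jet_density V (y, t)) \<le> (C1 + C2) * (energy t + dirichlet t)"
      using C2(2)[OF t] mult_right_mono[of C2 "C1 + C2" "energy t + dirichlet t"] C1(1) nn by simp
  qed (use energy_zero_imp energy_zeroI J in auto)
qed

end

section \<open>Transfer between charts\<close>

lemma derivative_bound_on_compact:
  fixes \<sigma> :: "real^'n::finite \<Rightarrow> real^'n"
  assumes "open W" "Ck_on 1 W \<sigma>" "compact S" "S \<subseteq> W"
  obtains B where "0 \<le> B"
    "\<And>z. z \<in> S \<Longrightarrow> (\<sigma> has_derivative frechet_derivative \<sigma> (at z)) (at z)"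
    "\<And>z v. z \<in> S \<Longrightarrow> norm (frechet_derivative \<sigma> (at z) v) \<le> B * norm v"
proof -
  have d: "(\<sigma> has_derivative frechet_derivative \<sigma> (at z)) (at z)" if "z \<in> W" for z
  proof -
    have "\<sigma> differentiable (at z)"
      using assms(2) that at_within_open[OF that assms(1)] by (auto simp: differentiable_on_def)
    then show ?thesis by (simp add: frechet_derivative_works)
  qed
  have cont: "continuous_on W (\<lambda>z. frechet_derivative \<sigma> (at z) v)" for v
  proof -
    have "continuous_on W (\<lambda>z. frechet_derivative \<sigma> (at z within W) v)"
      using assms(2) by simp
    then show ?thesis
      by (rule continuous_on_eq) (simp add: at_within_open[OF _ assms(1)])
  qed
  define G where "G z = (\<Sum>k\<in>UNIV. norm (frechet_derivative \<sigma> (at z) (axis k 1)))" for z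
  have "compact (G ` S)"
    unfolding G_def
    by (intro compact_continuous_image continuous_intros continuous_on_subset[OF cont] assms(3,4))
  then have "bounded (G ` S)" by (rule compact_imp_bounded)
  then obtain B where B: "\<And>z. z \<in> S \<Longrightarrow> G z \<le> B"
    unfolding bounded_iff by (auto dest: abs_le_D1)
  have "norm (frechet_derivative \<sigma> (at z) v) \<le> max 0 B * norm v" if z: "z \<in> S" for z v
  proof -
    have lin: "linear (frechet_derivative \<sigma> (at z))"
      using d z assms(4) has_derivative_linear by blast
    have "v = (\<Sum>k\<in>UNIV. (v $ k) *\<^sub>R axis k 1)"
      using basis_expansion[of v] by (simp add: scalar_mult_eq_scaleR)
    from arg_cong[OF this, of "frechet_derivative \<sigma> (at z)"]
    have "frechet_derivative \<sigma> (at z) v = (\<Sum>k\<in>UNIV. (v $ k) *\<^sub>R frechet_derivative \<sigma> (at z) (axis k 1))"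
      unfolding linear_sum[OF lin] linear_scale[OF lin] .
    then have "norm (frechet_derivative \<sigma> (at z) v) \<le> (\<Sum>k\<in>UNIV. norm ((v $ k) *\<^sub>R frechet_derivative \<sigma> (at z) (axis k 1)))"
      by (simp only: norm_sum)
    also have "\<dots> \<le> (\<Sum>k\<in>UNIV. norm v * norm (frechet_derivative \<sigma> (at z) (axis k 1)))"
      by (intro sum_mono) (use component_le_norm_cart[of v] in \<open>auto intro!: mult_right_mono\<close>)
    also have "\<dots> = G z * norm v"
      by (simp add: G_def sum_distrib_left[symmetric] mult.commute)
    also have "\<dots> \<le> max 0 B * norm v"
      using B[OF z] by (intro mult_right_mono) auto
    finally show ?thesis .
  qed
  then show ?thesis using that[of "max 0 B"] d assms(4) by auto
qed

lemma space_dir_deriv_le: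
  fixes f :: "(real^'n::finite) \<times> real \<Rightarrow> real"
  assumes "f differentiable (at (z, t))"
  shows "(dir_deriv (v, 0) f (z, t))\<^sup>2 \<le> (norm v)\<^sup>2 * (\<Sum>k\<in>UNIV. (Dx k f (z, t))\<^sup>2)"
proof -
  define L where "L h = dir_deriv (h, 0) f (z, t)" for h :: "real^'n"
  have "linear (\<lambda>h::real^'n. (h, 0::real))" by (rule linearI) auto
  from linear_compose[OF this has_derivative_linear[OF dir_deriv_works[OF assms]]]
  have lin: "linear L" by (simp add: L_def[abs_def] o_def)
  have "v = (\<Sum>k\<in>UNIV. (v $ k) *\<^sub>R axis k 1)"
    using basis_expansion[of v] by (simp add: scalar_mult_eq_scaleR)
  then have "L v = L (\<Sum>k\<in>UNIV. (v $ k) *\<^sub>R axis k 1)" by (rule arg_cong)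
  also have "\<dots> = (\<Sum>k\<in>UNIV. v $ k * Dx k f (z, t))"
    by (simp add: linear_sum[OF lin] linear_scale[OF lin]) (simp add: L_def)
  finally have "(L v)\<^sup>2 \<le> (\<Sum>k\<in>UNIV. (v $ k)\<^sup>2) * (\<Sum>k\<in>UNIV. (Dx k f (z, t))\<^sup>2)"
    using Cauchy_Schwarz_ineq_sum[of "\<lambda>k. v $ k" "\<lambda>k. Dx k f (z, t)" UNIV] by simp
  then show ?thesis by (simp add: L_def norm_vec_def L2_set_def sum_nonneg)
qed

lemma jet_density_nonneg: "0 \<le> jet_density f x"
  by (auto simp: jet_density_def intro!: add_nonneg_nonneg sum_nonneg)

text \<open>
  Under a diffeomorphism \<open>\<sigma>\<close> with inverse \<open>\<tau>\<close> both the volume element and, by the chain rule, the gradient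
  change by factors that are bounded on compact sets.
\<close>

lemma integral_jet_density_transfer:
  fixes f1 f2 :: "(real^'n::finite) \<times> real \<Rightarrow> real" and \<sigma> \<tau> :: "real^'n \<Rightarrow> real^'n"
  assumes W: "open W1" "open W2" and \<sigma>: "Ck_on 1 W2 \<sigma>" "\<And>z. z \<in> W2 \<Longrightarrow> \<sigma> z \<in> W1 \<and> \<tau> (\<sigma> z) = z"
    and \<tau>: "Ck_on 1 W1 \<tau>" "\<And>y. y \<in> W1 \<Longrightarrow> \<tau> y \<in> W2"
    and J: "open J" and f1: "Ck_on 1 (W1 \<times> J) f1" and f2: "Ck_on 1 (W2 \<times> J) f2"
    and eq: "\<And>y t. y \<in> W1 \<Longrightarrow> t \<in> J \<Longrightarrow> f1 (y, t) = f2 (\<tau> y, t)"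
    and S: "compact S" "S \<subseteq> W2"
  obtains C where "0 \<le> C" "\<And>t. t \<in> J \<Longrightarrow>
    integral (\<sigma> ` S) (\<lambda>y. jet_density f1 (y, t)) \<le> C * integral S (\<lambda>z. jet_density f2 (z, t))"
proof -
  have cont_jet: "continuous_on W' (\<lambda>z. jet_density f (z, t))"
    if "open W'" "Ck_on 1 (W' \<times> J) f" "t \<in> J" for W' f t
  proof -
    note c = C1_D(2,3)[OF open_Times[OF that(1) J] that(2)]
    have "continuous_on (W' \<times> J) (jet_density f)"
      unfolding jet_density_def[abs_def] by (intro continuous_intros c)
    then show ?thesis
      by (rule continuous_on_compose2) (use that(3) in \<open>auto intro!: continuous_intros\<close>)
  qed
  obtain B where B: "0 \<le> B" "\<And>z. z \<in> S \<Longrightarrow> (\<sigma> has_derivative frechet_derivative \<sigma> (at z)) (at z)"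
    "\<And>z v. z \<in> S \<Longrightarrow> norm (frechet_derivative \<sigma> (at z) v) \<le> B * norm v"
    using derivative_bound_on_compact[OF W(2) \<sigma>(1) S] by blast
  have c\<sigma>: "continuous_on S \<sigma>"
    using B(2) by (meson has_derivative_continuous continuous_at_imp_continuous_on)
  have S1: "compact (\<sigma> ` S)" "\<sigma> ` S \<subseteq> W1"
    using compact_continuous_image[OF c\<sigma> S(1)] \<sigma>(2) S(2) by auto
  obtain B' where B': "0 \<le> B'" "\<And>y. y \<in> \<sigma> ` S \<Longrightarrow> (\<tau> has_derivative frechet_derivative \<tau> (at y)) (at y)"
    "\<And>y v. y \<in> \<sigma> ` S \<Longrightarrow> norm (frechet_derivative \<tau> (at y) v) \<le> B' * norm v"
    using derivative_bound_on_compact[OF W(1) \<tau>(1) S1] by blast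
  define C where "C = 1 + real CARD('n) * B'\<^sup>2"
  have "1 \<le> C" by (simp add: C_def)
  have pointwise: "jet_density f1 (\<sigma> z, t) \<le> C * jet_density f2 (z, t)" if z: "z \<in> S" and t: "t \<in> J" for z t
  proof -
    define y where "y = \<sigma> z"
    have y: "y \<in> W1" "y \<in> \<sigma> ` S" "\<tau> y = z" using z \<sigma>(2) S(2) by (auto simp: y_def)
    have zW: "z \<in> W2" using z S by auto
    have d2: "f2 differentiable (at (z, t))"
      using C1_D(1)[OF open_Times[OF W(2) J] f2] zW t by auto
    have d1: "f1 differentiable (at (y, t))"
      using C1_D(1)[OF open_Times[OF W(1) J] f1] y t by auto
    have chain: "Dx k f1 (y, t) = dir_deriv (frechet_derivative \<tau> (at y) (axis k 1), 0) f2 (z, t)" for k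
    proof -
      have "((\<lambda>z. f2 (z, t)) has_derivative (\<lambda>v. dir_deriv (v, 0) f2 (z, t))) (at (\<tau> y))"
        using dir_deriv_works[OF dir_deriv_slice(2)[OF d2]] dir_deriv_slice(1)[OF d2] y(3) by simp
      from has_derivative_compose[OF B'(2)[OF y(2)] this]
      have "((\<lambda>y. f2 (\<tau> y, t)) has_derivative (\<lambda>h. dir_deriv (frechet_derivative \<tau> (at y) h, 0) f2 (z, t))) (at y)" .
      then have "dir_deriv (axis k 1) (\<lambda>y. f2 (\<tau> y, t)) y
          = dir_deriv (frechet_derivative \<tau> (at y) (axis k 1), 0) f2 (z, t)"
        by (rule dir_deriv_eqI)
      moreover have "dir_deriv (axis k 1) (\<lambda>y. f2 (\<tau> y, t)) y = dir_deriv (axis k 1) (\<lambda>y. f1 (y, t)) y"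
        by (rule dir_deriv_cong_open[OF W(1) y(1)]) (simp add: eq t)
      ultimately show ?thesis using dir_deriv_slice(1)[OF d1, of "axis k 1"] by simp
    qed
    define G where "G = (\<Sum>k\<in>UNIV. (Dx k f2 (z, t))\<^sup>2)"
    have "0 \<le> G" unfolding G_def by (intro sum_nonneg) auto
    have "(Dx k f1 (y, t))\<^sup>2 \<le> B'\<^sup>2 * G" for k
    proof -
      have "norm (frechet_derivative \<tau> (at y) (axis k 1)) \<le> B'"
        using B'(3)[OF y(2), of "axis k 1"] by simp
      then have "(norm (frechet_derivative \<tau> (at y) (axis k 1)))\<^sup>2 * G \<le> B'\<^sup>2 * G"
        using \<open>0 \<le> G\<close> by (intro mult_right_mono power_mono) auto
      then show ?thesis
        using space_dir_deriv_le[OF d2, of "frechet_derivative \<tau> (at y) (axis k 1)"]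
        unfolding chain G_def by linarith
    qed
    then have "(\<Sum>k\<in>UNIV. (Dx k f1 (y, t))\<^sup>2) \<le> (\<Sum>k\<in>(UNIV::'n set). B'\<^sup>2 * G)" by (rule sum_mono)
    also have "\<dots> = (real CARD('n) * B'\<^sup>2) * G" by simp
    finally have "(\<Sum>k\<in>UNIV. (Dx k f1 (y, t))\<^sup>2) \<le> C * G"
      using \<open>0 \<le> G\<close> by (simp add: C_def algebra_simps)
    moreover have "(f1 (y, t))\<^sup>2 \<le> C * (f2 (z, t))\<^sup>2"
      using mult_right_mono[OF \<open>1 \<le> C\<close>, of "(f2 (z, t))\<^sup>2"] eq[OF y(1) t] y(3) by simp
    ultimately show ?thesis
      by (simp add: jet_density_def G_def y_def[symmetric] algebra_simps)
  qed
  define N where "N = fact CARD('n) * B ^ CARD('n)"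
  have "0 \<le> N" using B(1) by (simp add: N_def)
  have "integral (\<sigma> ` S) (\<lambda>y. jet_density f1 (y, t)) \<le> (N * C) * integral S (\<lambda>z. jet_density f2 (z, t))"
    if t: "t \<in> J" for t
  proof -
    have c1: "continuous_on (\<sigma> ` S) (\<lambda>y. jet_density f1 (y, t))"
      by (rule continuous_on_subset[OF cont_jet[OF W(1) f1 t] S1(2)])
    have c2: "continuous_on S (\<lambda>z. C * jet_density f2 (z, t))"
      by (intro continuous_intros continuous_on_subset[OF cont_jet[OF W(2) f2 t] S(2)])
    have c3: "continuous_on S (\<lambda>z. jet_density f1 (\<sigma> z, t))"
      by (rule continuous_on_compose2[OF c1 c\<sigma>]) simp
    have "integral (\<sigma> ` S) (\<lambda>y. jet_density f1 (y, t)) \<le> N * integral S (\<lambda>z. jet_density f1 (\<sigma> z, t))"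
      unfolding N_def
    proof (rule integral_image_le[OF S(1)])
      show "inj_on \<sigma> S" using \<sigma>(2) S(2) by (metis inj_on_def subsetD)
    qed (use B(2,3) c1 jet_density_nonneg in \<open>auto intro: has_derivative_at_withinI\<close>)
    also have "\<dots> \<le> N * integral S (\<lambda>z. C * jet_density f2 (z, t))"
      by (intro mult_left_mono \<open>0 \<le> N\<close> integral_le set_lebesgue_integral_eq_integral(1)
          continuous_on_compact_absolutely_integrable(1) S(1) c2 c3 pointwise t)
    finally show ?thesis by simp
  qed
  then show ?thesis using that[of "N * C"] \<open>0 \<le> N\<close> \<open>1 \<le> C\<close> by simp
qed

lemma atlas_chart:
  assumes "smooth_atlas M A" "c \<in> A"
  shows "open (chart_img c)" "fst c \<subseteq> M"
    "x \<in> fst c \<Longrightarrow> snd c x \<in> chart_img c" "x \<in> fst c \<Longrightarrow> chart_inv c (snd c x) = x"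
    "y \<in> chart_img c \<Longrightarrow> chart_inv c y \<in> fst c" "y \<in> chart_img c \<Longrightarrow> snd c (chart_inv c y) = y"
    "continuous_on (chart_img c) (chart_inv c)"
    "openin (top_of_set M) (fst c)" "homeomorphism (fst c) (chart_img c) (snd c) (chart_inv c)"
proof -
  show h: "homeomorphism (fst c) (chart_img c) (snd c) (chart_inv c)"
    and "open (chart_img c)" "openin (top_of_set M) (fst c)" "fst c \<subseteq> M"
    using assms unfolding smooth_atlas_def by blast+
  show "x \<in> fst c \<Longrightarrow> snd c x \<in> chart_img c" by (simp add: chart_img_def)
  show "x \<in> fst c \<Longrightarrow> chart_inv c (snd c x) = x" "y \<in> chart_img c \<Longrightarrow> chart_inv c y \<in> fst c"
    "y \<in> chart_img c \<Longrightarrow> snd c (chart_inv c y) = y" "continuous_on (chart_img c) (chart_inv c)"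
    using h unfolding homeomorphism_def by auto
qed

lemma atlas_overlap:
  assumes "smooth_atlas M A" "c \<in> A" "d \<in> A"
  shows "open (snd c ` (fst c \<inter> fst d))"
    "Ck_on 1 (snd c ` (fst c \<inter> fst d)) (transition c d)"
proof -
  note c = atlas_chart[OF assms(1,2)] and d = atlas_chart[OF assms(1,3)]
  have "openin (top_of_set (fst c)) (fst c \<inter> fst d)"
    by (rule openin_subset_trans[OF openin_Int[OF c(8) d(8)] _ c(2)]) blast
  then have "openin (top_of_set (chart_img c)) (snd c ` (fst c \<inter> fst d))"
    using homeomorphism_imp_open_map[OF c(9)] by blast
  then show "open (snd c ` (fst c \<inter> fst d))"
    using c(1) openin_open_eq by blast
  show "Ck_on 1 (snd c ` (fst c \<inter> fst d)) (transition c d)"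
    using assms unfolding smooth_atlas_def smooth_on_def by blast
qed

text \<open>
  The balls are indexed by points of the manifold, each point being the centre of its ball.
\<close>

lemma finite_chart_ball_cover:
  fixes M :: "'a::t2_space set" and A :: "('a, 'n::finite) chart set"
  assumes "smooth_atlas M A" "compact M"
  obtains I ch lo hi rad where "finite I" "I \<subseteq> M"
    "\<And>x. x \<in> I \<Longrightarrow> ch x \<in> A" "\<And>x. x \<in> I \<Longrightarrow> 0 < rad x"
    "\<And>x. x \<in> I \<Longrightarrow> cball (snd (ch x) x) (rad x) \<subseteq> cbox (lo x) (hi x)"
    "\<And>x. x \<in> I \<Longrightarrow> cbox (lo x) (hi x) \<subseteq> chart_img (ch x)"
    "M \<subseteq> (\<Union>x\<in>I. chart_inv (ch x) ` cball (snd (ch x) x) (rad x / 2))"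
proof -
  have "\<exists>c l u r. c \<in> A \<and> x \<in> fst c \<and> 0 < r \<and> cball (snd c x) r \<subseteq> cbox l u \<and> cbox l u \<subseteq> chart_img c"
    if x: "x \<in> M" for x
  proof -
    obtain c where c: "c \<in> A" "x \<in> fst c" using assms(1) x unfolding smooth_atlas_def by blast
    obtain l u where lu: "snd c x \<in> box l u" "cbox l u \<subseteq> chart_img c"
      using open_contains_cbox[OF atlas_chart(1)[OF assms(1) c(1)] atlas_chart(3)[OF assms(1) c]] by metis
    obtain r where "0 < r" "cball (snd c x) r \<subseteq> box l u"
      using open_contains_cball open_box lu(1) by blast
    then show ?thesis using c lu box_subset_cbox[of l u] by blast
  qed
  then obtain ch lo hi rad where P: "\<And>x. x \<in> M \<Longrightarrow> ch x \<in> A \<and> x \<in> fst (ch x) \<and> 0 < rad x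
      \<and> cball (snd (ch x) x) (rad x) \<subseteq> cbox (lo x) (hi x) \<and> cbox (lo x) (hi x) \<subseteq> chart_img (ch x)"
    by metis
  define N where "N x = chart_inv (ch x) ` ball (snd (ch x) x) (rad x / 2)" for x
  have sub: "ball (snd (ch x) x) (rad x / 2) \<subseteq> chart_img (ch x)" if "x \<in> M" for x
  proof -
    have "ball (snd (ch x) x) (rad x / 2) \<subseteq> cball (snd (ch x) x) (rad x)"
      using P[OF that] by (auto simp: subset_iff)
    then show ?thesis using P[OF that] by blast
  qed
  have openN: "openin (top_of_set M) (N x)" if x: "x \<in> M" for x
  proof -
    note c = atlas_chart[OF assms(1), of "ch x"]
    have "openin (top_of_set (chart_img (ch x))) (ball (snd (ch x) x) (rad x / 2))"
      by (rule open_subset[OF sub[OF x] open_ball])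
    then have "openin (top_of_set (fst (ch x))) (N x)"
      unfolding N_def using homeomorphism_imp_open_map[OF homeomorphism_symD[OF c(9)]] P[OF x] by blast
    then show ?thesis using c(8) P[OF x] openin_trans by blast
  qed
  have mem: "x \<in> N x" if x: "x \<in> M" for x
    unfolding N_def using atlas_chart(4)[OF assms(1), of "ch x" x] P[OF x]
    by (intro image_eqI[of _ _ "snd (ch x) x"]) auto
  have "(\<forall>c\<in>N ` M. openin (top_of_set M) c) \<and> M \<subseteq> \<Union>(N ` M)"
    using openN mem by blast
  then obtain D where D: "D \<subseteq> N ` M" "finite D" "M \<subseteq> \<Union>D"
    using compact_eq_openin_cover[THEN iffD1, OF assms(2), rule_format, of "N ` M"] by blast
  then obtain I where I: "I \<subseteq> M" "finite I" "D = N ` I"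
    using finite_subset_image by metis
  have "M \<subseteq> (\<Union>x\<in>I. chart_inv (ch x) ` cball (snd (ch x) x) (rad x / 2))"
  proof
    fix y assume "y \<in> M"
    then obtain x where "x \<in> I" "y \<in> N x" using D(3) I(3) by blast
    then show "y \<in> (\<Union>x\<in>I. chart_inv (ch x) ` cball (snd (ch x) x) (rad x / 2))"
      unfolding N_def by force
  qed
  then show ?thesis using that[of I ch rad lo hi] I P by blast
qed

definition chart_rep :: "(real \<Rightarrow> 'a \<Rightarrow> real) \<Rightarrow> ('a, 'n::finite) chart \<Rightarrow> (real^'n) \<times> real \<Rightarrow> real" where
  "chart_rep v c = (\<lambda>(y, t). v t (chart_inv c y))"

text \<open>
  The part of \<open>K\<close> that represents points of \<open>B\<close> is the image, under the transition map, of a closed and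
  hence compact part of \<open>B\<close>.
\<close>

lemma chart_overlap_transfer:
  fixes M :: "'a::t2_space set" and A :: "('a, 'n::finite) chart set"
  assumes M: "smooth_atlas M A" and cA: "c \<in> A" and dA: "d \<in> A" and J: "open J"
    and vc: "Ck_on 1 (chart_img c \<times> J) (chart_rep v c)" and vd: "Ck_on 1 (chart_img d \<times> J) (chart_rep v d)"
    and K: "compact K" "K \<subseteq> chart_img c" and B: "compact B" "B \<subseteq> chart_img d"
  obtains C where "0 \<le> C" "compact {y\<in>K. chart_inv c y \<in> chart_inv d ` B}"
    "\<And>t. t \<in> J \<Longrightarrow> integral {y\<in>K. chart_inv c y \<in> chart_inv d ` B} (\<lambda>y. jet_density (chart_rep v c) (y, t))
      \<le> C * integral B (\<lambda>z. jet_density (chart_rep v d) (z, t))"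
proof -
  note c = atlas_chart[OF M cA] and d = atlas_chart[OF M dA]
  define W1 where "W1 = snd c ` (fst c \<inter> fst d)"
  define W2 where "W2 = snd d ` (fst d \<inter> fst c)"
  define \<sigma> where "\<sigma> = transition d c"
  define \<tau> where "\<tau> = transition c d"
  define S where "S = {z\<in>B. chart_inv d z \<in> chart_inv c ` K}"
  have W: "open W1" "open W2" "W1 \<subseteq> chart_img c" "W2 \<subseteq> chart_img d"
    using atlas_overlap(1)[OF M cA dA] atlas_overlap(1)[OF M dA cA] c(3) d(3)
    by (auto simp: W1_def W2_def)
  have \<sigma>W: "\<sigma> z \<in> W1 \<and> \<tau> (\<sigma> z) = z" if "z \<in> W2" for z
    using that c(3,4) d(3,4) by (auto simp: W1_def W2_def \<sigma>_def \<tau>_def transition_def)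
  have \<tau>W: "\<tau> y \<in> W2" if "y \<in> W1" for y
    using that c(3,4) d(3,4) by (auto simp: W1_def W2_def \<tau>_def transition_def)
  have eq: "chart_rep v c (y, t) = chart_rep v d (\<tau> y, t)" if "y \<in> W1" for y t
    using that c(3,4) d(3,4) by (auto simp: W1_def \<tau>_def transition_def chart_rep_def)
  have SW: "S \<subseteq> W2"
  proof
    fix z assume "z \<in> S"
    then have "z \<in> chart_img d" "chart_inv d z \<in> fst d \<inter> fst c"
      using B(2) K(2) c(5) d(5) by (auto simp: S_def)
    then show "z \<in> W2" unfolding W2_def using d(6) by (metis image_eqI)
  qed
  have "compact (chart_inv c ` K)"
    by (rule compact_continuous_image[OF continuous_on_subset[OF c(7) K(2)] K(1)])
  then have "closed (chart_inv c ` K)" by (rule compact_imp_closed)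
  then have "closedin (top_of_set B) (B \<inter> chart_inv d -` (chart_inv c ` K))"
    by (rule continuous_closedin_preimage[OF continuous_on_subset[OF d(7) B(2)]])
  then have "compact (B \<inter> chart_inv d -` (chart_inv c ` K))"
    by (rule closedin_compact[OF B(1)])
  moreover have "S = B \<inter> chart_inv d -` (chart_inv c ` K)" by (auto simp: S_def)
  ultimately have S: "compact S" by simp
  have img: "\<sigma> ` S = {y\<in>K. chart_inv c y \<in> chart_inv d ` B}"
  proof (intro set_eqI iffI)
    fix y assume "y \<in> \<sigma> ` S"
    then obtain z k where zk: "z \<in> B" "k \<in> K" "chart_inv d z = chart_inv c k" "y = snd c (chart_inv d z)"
      by (auto simp: S_def \<sigma>_def transition_def)
    then have "y = k" using c(6) K(2) by auto
    then show "y \<in> {y\<in>K. chart_inv c y \<in> chart_inv d ` B}" using zk by (auto intro: image_eqI[of _ _ z])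
  next
    fix y assume "y \<in> {y\<in>K. chart_inv c y \<in> chart_inv d ` B}"
    then obtain z where z: "y \<in> K" "z \<in> B" "chart_inv c y = chart_inv d z" by auto
    have "chart_inv d z \<in> chart_inv c ` K" using z(1) unfolding z(3)[symmetric] by (rule imageI)
    then have "z \<in> S" using z(2) by (simp add: S_def)
    moreover have "y = \<sigma> z"
      using c(6)[of y] z K(2) by (auto simp: \<sigma>_def transition_def)
    ultimately show "y \<in> \<sigma> ` S" by blast
  qed
  have \<sigma>\<tau>: "Ck_on 1 W2 \<sigma>" "Ck_on 1 W1 \<tau>"
    unfolding W1_def W2_def \<sigma>_def \<tau>_def by (intro atlas_overlap(2)[OF M] cA dA)+
  have "open (W1 \<times> J)" "open (W2 \<times> J)" using W J by (auto intro: open_Times)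
  moreover have "W1 \<times> J \<subseteq> chart_img c \<times> J" "W2 \<times> J \<subseteq> chart_img d \<times> J" using W by auto
  ultimately have f: "Ck_on 1 (W1 \<times> J) (chart_rep v c)" "Ck_on 1 (W2 \<times> J) (chart_rep v d)"
    using Ck_on_open_subset[OF vc] Ck_on_open_subset[OF vd] by blast+
  obtain C where "0 \<le> C" "\<And>t. t \<in> J \<Longrightarrow> integral (\<sigma> ` S) (\<lambda>y. jet_density (chart_rep v c) (y, t))
      \<le> C * integral S (\<lambda>z. jet_density (chart_rep v d) (z, t))"
    using integral_jet_density_transfer[OF W(1,2) \<sigma>\<tau>(1) \<sigma>W \<sigma>\<tau>(2) \<tau>W J f eq S SW] by blast
  moreover have "integral S (\<lambda>z. jet_density (chart_rep v d) (z, t))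
      \<le> integral B (\<lambda>z. jet_density (chart_rep v d) (z, t))" if t: "t \<in> J" for t
  proof -
    note cd = C1_D(2,3)[OF open_Times[OF d(1) J] vd]
    have "continuous_on (chart_img d \<times> J) (jet_density (chart_rep v d))"
      unfolding jet_density_def[abs_def] by (intro continuous_intros cd)
    then have cont: "continuous_on B (\<lambda>z. jet_density (chart_rep v d) (z, t))"
      by (rule continuous_on_compose2) (use B t in \<open>auto intro!: continuous_intros\<close>)
    have SB: "S \<subseteq> B" by (auto simp: S_def)
    show ?thesis
      by (intro integral_subset_le SB set_lebesgue_integral_eq_integral(1)
          continuous_on_compact_absolutely_integrable(1) S B(1) cont continuous_on_subset[OF cont SB]
          ballI jet_density_nonneg)
  qed
  moreover have "compact (\<sigma> ` S)"
  proof -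
    have "continuous_on W2 \<sigma>" using \<sigma>\<tau>(1) by (rule Ck_on_continuous_on)
    then show ?thesis using S SW by (meson compact_continuous_image continuous_on_subset)
  qed
  ultimately show ?thesis
    using that[of C] unfolding img by (meson mult_left_mono order_trans)
qed

lemma integral_le_sum_cover:
  fixes F :: "'b::euclidean_space \<Rightarrow> real"
  assumes "finite I" "compact K" "continuous_on K F" "\<And>y. y \<in> K \<Longrightarrow> 0 \<le> F y"
    and L: "\<And>i. i \<in> I \<Longrightarrow> compact (L i)" "\<And>i. i \<in> I \<Longrightarrow> L i \<subseteq> K" "K \<subseteq> (\<Union>i\<in>I. L i)"
  shows "integral K F \<le> (\<Sum>i\<in>I. integral (L i) F)"
proof -
  have int: "F integrable_on S" if "compact S" "S \<subseteq> K" for S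
    using that assms(3)
    by (intro set_lebesgue_integral_eq_integral(1) continuous_on_compact_absolutely_integrable(1))
      (auto intro: continuous_on_subset)
  have L_int: "(\<lambda>y. if y \<in> L i then F y else 0) integrable_on K"
    "integral K (\<lambda>y. if y \<in> L i then F y else 0) = integral (L i) F" if i: "i \<in> I" for i
  proof -
    have "(F has_integral integral (L i) F) (L i)" using int[OF L(1)[OF i] L(2)[OF i]] by blast
    then have "((\<lambda>y. if y \<in> L i then F y else 0) has_integral integral (L i) F) K"
      using has_integral_restrict[OF L(2)[OF i]] by blast
    then show "(\<lambda>y. if y \<in> L i then F y else 0) integrable_on K"
      "integral K (\<lambda>y. if y \<in> L i then F y else 0) = integral (L i) F"
      by (auto simp: has_integral_iff)
  qed
  have "integral K F \<le> integral K (\<lambda>y. \<Sum>i\<in>I. if y \<in> L i then F y else 0)"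
  proof (rule integral_le)
    show "F integrable_on K" using int assms(2) by simp
    show "(\<lambda>y. \<Sum>i\<in>I. if y \<in> L i then F y else 0) integrable_on K"
      by (intro integrable_sum assms(1) L_int(1))
    fix y assume y: "y \<in> K"
    then obtain i where i: "i \<in> I" "y \<in> L i" using L(3) by auto
    have "F y = (if y \<in> L i then F y else 0)" using i by simp
    also have "\<dots> \<le> (\<Sum>i\<in>I. if y \<in> L i then F y else 0)"
      by (rule member_le_sum[OF i(1) _ assms(1)]) (use assms(4)[OF y] in auto)
    finally show "F y \<le> (\<Sum>i\<in>I. if y \<in> L i then F y else 0)" .
  qed
  also have "\<dots> = (\<Sum>i\<in>I. integral (L i) F)"
    using assms(1) L_int by (simp add: integral_sum)
  finally show ?thesis .
qed

section \<open>The heat equation in a chart\<close>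

lemma positive_definite_invertible:
  fixes G :: "real^'n^'n"
  assumes "\<And>\<xi>. \<xi> \<noteq> 0 \<Longrightarrow> 0 < \<xi> \<bullet> (G *v \<xi>)"
  shows "invertible G"
proof -
  have "G *v \<xi> = 0 \<Longrightarrow> \<xi> = 0" for \<xi>
    using assms[of \<xi>] by (cases "\<xi> = 0") auto
  then show ?thesis
    by (metis invertible_left_inverse matrix_left_invertible_ker)
qed

lemma matrix_inv_symmetric:
  fixes G :: "real^'n^'n"
  assumes "invertible G" "transpose G = G"
  shows "matrix_inv G $ i $ j = matrix_inv G $ j $ i"
proof -
  define B where "B = matrix_inv G"
  have GB: "G ** B = mat 1" using matrix_inv_works(1)[OF assms(1)] by (simp add: B_def)
  have "transpose B ** G = mat 1"
    using arg_cong[OF GB, of transpose] assms(2) by (simp add: matrix_transpose_mul)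
  then have "transpose B ** (G ** B) = B" by (simp add: matrix_mul_assoc)
  then have "transpose B = B" by (simp add: GB)
  then have "transpose B $ i $ j = B $ i $ j" by simp
  then show ?thesis by (simp add: transpose_def B_def)
qed

lemma matrix_inv_positive_definite:
  fixes G :: "real^'n^'n"
  assumes pos: "\<And>\<xi>. \<xi> \<noteq> 0 \<Longrightarrow> 0 < \<xi> \<bullet> (G *v \<xi>)" and "\<xi> \<noteq> 0"
  shows "0 < (\<Sum>i\<in>UNIV. \<Sum>j\<in>UNIV. matrix_inv G $ i $ j * \<xi> $ i * \<xi> $ j)"
proof -
  note inv = matrix_inv_works(1)[OF positive_definite_invertible[OF pos]]
  define \<eta> where "\<eta> = matrix_inv G *v \<xi>"
  have \<xi>: "\<xi> = G *v \<eta>" by (simp add: \<eta>_def matrix_vector_mul_assoc inv)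
  then have "\<eta> \<noteq> 0" using assms(2) by auto
  then have "0 < \<eta> \<bullet> (G *v \<eta>)" by (rule pos)
  also have "\<dots> = \<xi> \<bullet> (matrix_inv G *v \<xi>)" using \<xi> by (simp add: \<eta>_def inner_commute)
  also have "\<dots> = (\<Sum>i\<in>UNIV. \<Sum>j\<in>UNIV. matrix_inv G $ i $ j * \<xi> $ i * \<xi> $ j)"
    by (simp add: inner_vec_def matrix_vector_mult_def sum_distrib_left mult_ac)
  finally show ?thesis .
qed

text \<open>
  In coordinates \<open>\<Delta> u = \<Sum>\<^sub>i\<^sub>j g\<^sup>i\<^sup>j \<partial>\<^sub>i\<partial>\<^sub>j u + \<Sum>\<^sub>k b\<^sup>k \<partial>\<^sub>k u\<close> with \<open>b\<^sup>k = - \<Sum>\<^sub>i\<^sub>j g\<^sup>i\<^sup>j \<Gamma>\<^sup>k\<^sub>i\<^sub>j\<close>.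
\<close>

definition inverse_metric :: "(real \<Rightarrow> ('a, 'n) tensor2) \<Rightarrow> ('a, 'n::finite) chart \<Rightarrow> 'n \<Rightarrow> 'n \<Rightarrow> (real^'n) \<times> real \<Rightarrow> real" where
  "inverse_metric g c i j = (\<lambda>(y, t). matrix_inv (g t c y) $ i $ j)"

definition laplacian_drift :: "(real \<Rightarrow> ('a, 'n) tensor2) \<Rightarrow> ('a, 'n::finite) chart \<Rightarrow> 'n \<Rightarrow> (real^'n) \<times> real \<Rightarrow> real" where
  "laplacian_drift g c k = (\<lambda>(y, t). - (\<Sum>i\<in>UNIV. \<Sum>j\<in>UNIV. matrix_inv (g t c y) $ i $ j * christoffel (g t c) k i j y))"

lemma Laplacian_chart:
  fixes c :: "('a, 'n::finite) chart"
  assumes U: "open (chart_img c)" and J: "open J" and t: "t \<in> J" and y: "y \<in> chart_img c"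
    and inv: "snd c (chart_inv c y) = y" and V: "Ck_on 2 (chart_img c \<times> J) (chart_rep v c)"
  shows "Laplacian (g t) c (v t) (chart_inv c y)
    = (\<Sum>i\<in>UNIV. \<Sum>j\<in>UNIV. inverse_metric g c i j (y, t) * Dx i (Dx j (chart_rep v c)) (y, t))
      + (\<Sum>k\<in>UNIV. laplacian_drift g c k (y, t) * Dx k (chart_rep v c) (y, t))"
proof -
  note op = open_Times[OF U J]
  define F where "F = v t \<circ> chart_inv c"
  have F: "F = (\<lambda>y. chart_rep v c (y, t))" by (simp add: F_def chart_rep_def fun_eq_iff)
  have pd1: "pd k F z = Dx k (chart_rep v c) (z, t)" if "z \<in> chart_img c" for k z
    using dir_deriv_slice(1)[OF C1_D(1)[OF op C2_D(1)[OF op V]], of z t "axis k 1"] that t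
    by (simp add: pd_def F dir_deriv_def)
  have pd2: "pd i (pd j F) y = Dx i (Dx j (chart_rep v c)) (y, t)" for i j
  proof -
    have "pd i (pd j F) y = dir_deriv (axis i 1) (pd j F) y" by (simp add: pd_def dir_deriv_def)
    also have "\<dots> = dir_deriv (axis i 1) (\<lambda>z. Dx j (chart_rep v c) (z, t)) y"
      by (rule dir_deriv_cong_open[OF U y pd1])
    also have "\<dots> = Dx i (Dx j (chart_rep v c)) (y, t)"
      using dir_deriv_slice(1)[OF C1_D(1)[OF op C2_D(2)[OF op V]], of y t "axis i 1"] y t by simp
    finally show ?thesis .
  qed
  define a where "a i j = matrix_inv (g t c y) $ i $ j" for i j
  define G where "G k i j = christoffel (g t c) k i j y" for k i j
  define P where "P k = Dx k (chart_rep v c) (y, t)" for k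
  have "Laplacian (g t) c (v t) (chart_inv c y)
      = (\<Sum>i\<in>UNIV. \<Sum>j\<in>UNIV. a i j * (Dx i (Dx j (chart_rep v c)) (y, t) - (\<Sum>k\<in>UNIV. G k i j * P k)))"
    unfolding Laplacian_def Hess_def hess_coord_def tr_metric_def metric_at_def inv F_def[symmetric]
    by (simp add: pd1[OF y] pd2 a_def G_def P_def)
  also have "\<dots> = (\<Sum>i\<in>UNIV. \<Sum>j\<in>UNIV. a i j * Dx i (Dx j (chart_rep v c)) (y, t))
      - (\<Sum>i\<in>UNIV. \<Sum>j\<in>UNIV. \<Sum>k\<in>UNIV. a i j * G k i j * P k)"
    by (simp add: right_diff_distrib sum_subtractf sum_distrib_left mult.assoc)
  also have "(\<Sum>i\<in>UNIV. \<Sum>j\<in>UNIV. \<Sum>k\<in>UNIV. a i j * G k i j * P k)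
      = (\<Sum>k\<in>UNIV. \<Sum>i\<in>UNIV. \<Sum>j\<in>UNIV. a i j * G k i j * P k)"
    by (subst (2) sum.swap) (subst sum.swap, rule refl)
  also have "\<dots> = - (\<Sum>k\<in>UNIV. laplacian_drift g c k (y, t) * P k)"
    by (simp add: laplacian_drift_def a_def G_def sum_negf[symmetric] sum_distrib_right)
  finally show ?thesis by (simp add: inverse_metric_def a_def P_def)
qed

lemma heat_solution_parabolic_chart:
  fixes M :: "'a::t2_space set" and A :: "('a, 'n::finite) chart set"
  assumes M: "smooth_atlas M A" and cA: "c \<in> A" and g: "smooth_metric_family A T g"
    and v: "heat_solution A T g q v" and t01: "0 < t0" "t1 < T"
    and q: "\<exists>B. \<forall>t\<in>{t0..t1}. \<bar>q t\<bar> \<le> B"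
    and box: "0 < r" "cball y0 r \<subseteq> cbox l u" "cbox l u \<subseteq> chart_img c"
  shows "parabolic_chart (chart_img c) {0<..<T} (inverse_metric g c) (laplacian_drift g c) q
    (chart_rep v c) y0 l u r t0 t1"
proof -
  note c = atlas_chart[OF M cA]
  define \<Omega> where "\<Omega> = chart_img c \<times> {0<..<T}"
  have op: "open \<Omega>" unfolding \<Omega>_def by (intro open_Times c(1)) simp
  have sub: "\<Omega> \<subseteq> chart_img c \<times> {0..<T}" by (auto simp: \<Omega>_def)
  have V: "Ck_on k \<Omega> (chart_rep v c)" for k
    using v cA Ck_on_open_subset[OF _ sub op]
    unfolding heat_solution_def smooth_fun_family_def smooth_on_def chart_rep_def by blast
  define G where "G = (\<lambda>(y, t). g t c y)"
  have G: "Ck_on k \<Omega> G" for k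
    using g cA Ck_on_open_subset[OF _ sub op]
    unfolding smooth_metric_family_def smooth_on_def G_def by blast
  have metric: "transpose (g t c y) = g t c y" "\<xi> \<noteq> 0 \<Longrightarrow> 0 < \<xi> \<bullet> (g t c y *v \<xi>)"
    if "y \<in> chart_img c" "t \<in> {0<..<T}" for y t \<xi>
    using g cA that unfolding smooth_metric_family_def riemannian_metric_def by auto
  have inv: "invertible (G x)" if "x \<in> \<Omega>" for x
    using that metric(2) by (auto simp: \<Omega>_def G_def intro!: positive_definite_invertible)
  have ginv: "inverse_metric g c i j = (\<lambda>x. matrix_inv (G x) $ i $ j)" for i j
    by (auto simp: inverse_metric_def G_def)
  have a: "Ck_on 1 \<Omega> (inverse_metric g c i j)" for i j
    unfolding ginv by (rule Ck_on_matrix_inv[OF op G inv])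
  have entry: "Ck_on 1 \<Omega> (\<lambda>x. G x $ i $ j)" for i j
    using Ck_on_bounded_linear[OF op _ G, of "\<lambda>A. A $ i $ j"]
    by (simp add: bounded_linear_compose[OF bounded_linear_vec_nth bounded_linear_vec_nth])
  have pd: "pd k (\<lambda>z. g t c z $ i $ j) y = Dx k (\<lambda>x. G x $ i $ j) (y, t)"
    if "(y, t) \<in> \<Omega>" for k i j y t
    using dir_deriv_slice(1)[OF C1_D(1)[OF op entry that], of "axis k 1" i j]
    by (simp add: G_def pd_def dir_deriv_def)
  define \<Gamma> where "\<Gamma> k i j x = (1/2) * (\<Sum>l\<in>UNIV. inverse_metric g c k l x *
      (Dx i (\<lambda>x. G x $ j $ l) x + Dx j (\<lambda>x. G x $ i $ l) x - Dx l (\<lambda>x. G x $ i $ j) x))" for k i j x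
  have "continuous_on \<Omega> (\<lambda>x. - (\<Sum>i\<in>UNIV. \<Sum>j\<in>UNIV. inverse_metric g c i j x * \<Gamma> k i j x))" for k
    unfolding \<Gamma>_def by (intro continuous_intros C1_D(2)[OF op entry] C1_D(3)[OF op a])
  moreover have "- (\<Sum>i\<in>UNIV. \<Sum>j\<in>UNIV. inverse_metric g c i j x * \<Gamma> k i j x) = laplacian_drift g c k x"
    if "x \<in> \<Omega>" for k x
    using that pd by (cases x) (simp add: laplacian_drift_def christoffel_def \<Gamma>_def inverse_metric_def)
  ultimately have \<beta>: "continuous_on \<Omega> (laplacian_drift g c k)" for k
    using continuous_on_eq by blast
  have pde: "Dt (chart_rep v c) (y, t)
      = (\<Sum>i\<in>UNIV. \<Sum>j\<in>UNIV. inverse_metric g c i j (y, t) * Dx i (Dx j (chart_rep v c)) (y, t))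
        + (\<Sum>k\<in>UNIV. laplacian_drift g c k (y, t) * Dx k (chart_rep v c) (y, t))
        + q t * chart_rep v c (y, t)" if y: "y \<in> chart_img c" and t: "t \<in> {0<..<T}" for y t
  proof -
    have "((\<lambda>s. v s (chart_inv c y)) has_real_derivative
        Laplacian (g t) c (v t) (chart_inv c y) + q t * v t (chart_inv c y)) (at t within {0..<T})"
      using v cA c(5)[OF y] t unfolding heat_solution_def by auto
    moreover have "at t within {0..<T} = at t"
      using t by (intro at_within_interior) (simp add: interior_atLeastLessThan)
    ultimately have 1: "((\<lambda>s. v s (chart_inv c y)) has_real_derivative
        Laplacian (g t) c (v t) (chart_inv c y) + q t * v t (chart_inv c y)) (at t)" by simp
    have "(y, t) \<in> \<Omega>" using y t by (simp add: \<Omega>_def)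
    from dir_deriv_slice(3)[OF C1_D(1)[OF op V this]]
    have "((\<lambda>s. v s (chart_inv c y)) has_real_derivative Dt (chart_rep v c) (y, t)) (at t)"
      by (simp add: chart_rep_def)
    from DERIV_unique[OF this 1] show ?thesis
      using Laplacian_chart[OF c(1) _ t y c(6)[OF y] V[unfolded \<Omega>_def], of g]
      by (simp add: chart_rep_def)
  qed
  show ?thesis
  proof
    show "inverse_metric g c i j x = inverse_metric g c j i x" if "x \<in> chart_img c \<times> {0<..<T}" for i j x
      using that metric(1) inv[unfolded \<Omega>_def G_def]
      by (cases x) (auto simp: inverse_metric_def intro!: matrix_inv_symmetric)
    show "0 < (\<Sum>i\<in>UNIV. \<Sum>j\<in>UNIV. inverse_metric g c i j x * \<xi> $ i * \<xi> $ j)"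
      if "x \<in> chart_img c \<times> {0<..<T}" "\<xi> \<noteq> 0" for x \<xi>
      using that metric(2) by (cases x) (auto simp: inverse_metric_def intro!: matrix_inv_positive_definite)
    show "{t0..t1} \<subseteq> {0<..<T}" using t01 by auto
  qed (use c(1) box q pde V a \<beta> in \<open>auto simp: \<Omega>_def\<close>)
qed

section \<open>Backward uniqueness\<close>

text \<open>
  The energies of all charts are added. The source of chart \<open>i\<close> is bounded by an integral over its box,
  the box is covered by the parts \<open>L i j\<close> that lie in the half ball of chart \<open>j\<close>, and there the integral is
  controlled by the energies of chart \<open>j\<close>. If \<open>v\<close> did not vanish at time \<open>t0\<close>, the total energy would be
  positive then and hence also at time \<open>t1\<close>.
\<close>

lemma heat_equation_backward_uniqueness:
  fixes M :: "'a::t2_space set" and A :: "('a, 'n::finite) chart set"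
  assumes M: "smooth_atlas M A" "compact M" and g: "smooth_metric_family A T g"
    and v: "heat_solution A T g q v" and t01: "0 < t0" "t0 \<le> t1" "t1 < T"
    and q: "\<exists>B. \<forall>t\<in>{t0..t1}. \<bar>q t\<bar> \<le> B"
    and final: "\<And>x. x \<in> M \<Longrightarrow> v t1 x = 0" and x: "x \<in> M"
  shows "v t0 x = 0"
proof (rule ccontr)
  assume nz: "v t0 x \<noteq> 0"
  obtain I ch lo hi rad where I: "finite I" "I \<subseteq> M" and ch: "\<And>i. i \<in> I \<Longrightarrow> ch i \<in> A"
    and rad: "\<And>i. i \<in> I \<Longrightarrow> 0 < rad i"
    and ball: "\<And>i. i \<in> I \<Longrightarrow> cball (snd (ch i) i) (rad i) \<subseteq> cbox (lo i) (hi i)"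
    and box: "\<And>i. i \<in> I \<Longrightarrow> cbox (lo i) (hi i) \<subseteq> chart_img (ch i)"
    and cover: "M \<subseteq> (\<Union>i\<in>I. chart_inv (ch i) ` cball (snd (ch i) i) (rad i / 2))"
    by (rule finite_chart_ball_cover[OF M]) (rule that)
  define V where "V i = chart_rep v (ch i)" for i
  define Box where "Box i = cbox (lo i) (hi i)" for i
  define Half where "Half i = cball (snd (ch i) i) (rad i / 2)" for i
  define J where "J = {0<..<T}"
  have open_J: "open J" by (simp add: J_def)
  have J: "t \<in> J" if "t \<in> {t0..t1}" for t using that t01 by (auto simp: J_def)
  have pc: "parabolic_chart (chart_img (ch i)) J (inverse_metric g (ch i)) (laplacian_drift g (ch i)) q
      (V i) (snd (ch i) i) (lo i) (hi i) (rad i) t0 t1" if "i \<in> I" for i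
    unfolding V_def J_def
    by (rule heat_solution_parabolic_chart[OF M(1) ch[OF that] g v t01(1,3) q rad[OF that] ball[OF that] box[OF that]])
  \<comment> \<open>abbreviations for what each chart provides, so that functions and constants can be chosen for all charts at once\<close>
  define sys where "sys i E D Q C \<longleftrightarrow> energy_balance t0 t1 E D Q \<and> 0 \<le> C \<and>
      (\<forall>t\<in>{t0..t1}. Q t \<le> C * integral (Box i) (\<lambda>y. jet_density (V i) (y, t)) \<and>
        integral (Half i) (\<lambda>y. jet_density (V i) (y, t)) \<le> C * (E t + D t) \<and> 0 \<le> E t \<and> 0 \<le> D t \<and>
        (E t = 0 \<longrightarrow> (\<forall>y\<in>Half i. V i (y, t) = 0)) \<and>
        ((\<forall>y\<in>chart_img (ch i). V i (y, t) = 0) \<longrightarrow> E t = 0))" for i E D Q C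
  have "\<exists>E D Q C. sys i E D Q C" if i: "i \<in> I" for i
  proof -
    obtain E D Q C where e: "energy_balance t0 t1 E D Q" "0 \<le> C"
      "\<And>t. t \<in> {t0..t1} \<Longrightarrow> Q t \<le> C * integral (cbox (lo i) (hi i)) (\<lambda>y. jet_density (V i) (y, t))"
      "\<And>t. t \<in> {t0..t1} \<Longrightarrow> integral (cball (snd (ch i) i) (rad i / 2)) (\<lambda>y. jet_density (V i) (y, t)) \<le> C * (E t + D t)"
      "\<And>t. t \<in> {t0..t1} \<Longrightarrow> 0 \<le> E t" "\<And>t. t \<in> {t0..t1} \<Longrightarrow> 0 \<le> D t"
      "\<And>t y. t \<in> {t0..t1} \<Longrightarrow> E t = 0 \<Longrightarrow> y \<in> cball (snd (ch i) i) (rad i / 2) \<Longrightarrow> V i (y, t) = 0"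
      "\<And>t. (\<And>y. y \<in> chart_img (ch i) \<Longrightarrow> V i (y, t) = 0) \<Longrightarrow> E t = 0"
      using parabolic_chart.chart_energy[OF pc[OF i]] by blast
    have "sys i E D Q C"
      unfolding sys_def Box_def Half_def by (intro conjI ballI impI) (simp_all add: e)
    then show ?thesis by blast
  qed
  then obtain E D Q C where "\<And>i. i \<in> I \<Longrightarrow> sys i (E i) (D i) (Q i) (C i)" by metis
  note sys = this[unfolded sys_def]
  define L where "L i j = {y\<in>Box i. chart_inv (ch i) y \<in> chart_inv (ch j) ` Half j}" for i j
  have V: "Ck_on 2 (chart_img (ch i) \<times> J) (V i)" if "i \<in> I" for i
    using pc[OF that] by (rule parabolic_chart.C2_V)
  have V1: "Ck_on 1 (chart_img (ch i) \<times> J) (V i)" if "i \<in> I" for i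
    using Ck_on_le[OF V[OF that], of 1] by simp
  have half_box: "Half i \<subseteq> Box i" if "i \<in> I" for i
    using ball[OF that] rad[OF that] subset_cball[of "rad i / 2" "rad i" "snd (ch i) i"]
    by (force simp: Half_def Box_def)
  define tr where "tr i j K \<longleftrightarrow> 0 \<le> K \<and> compact (L i j) \<and> (\<forall>t\<in>J. integral (L i j) (\<lambda>y. jet_density (V i) (y, t))
      \<le> K * integral (Half j) (\<lambda>z. jet_density (V j) (z, t)))" for i j K
  have "\<exists>K. tr i j K" if i: "i \<in> I" and j: "j \<in> I" for i j
  proof -
    have "compact (Box i)" "Box i \<subseteq> chart_img (ch i)" "compact (Half j)" "Half j \<subseteq> chart_img (ch j)"
      using box[OF i] box[OF j] half_box[OF j] by (auto simp: Box_def Half_def)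
    note compacts = this
    obtain K where "0 \<le> K" "compact {y\<in>Box i. chart_inv (ch i) y \<in> chart_inv (ch j) ` Half j}"
      "\<And>t. t \<in> J \<Longrightarrow> integral {y\<in>Box i. chart_inv (ch i) y \<in> chart_inv (ch j) ` Half j}
          (\<lambda>y. jet_density (chart_rep v (ch i)) (y, t))
        \<le> K * integral (Half j) (\<lambda>z. jet_density (chart_rep v (ch j)) (z, t))"
      by (rule chart_overlap_transfer[OF M(1) ch[OF i] ch[OF j] open_J V1[OF i, unfolded V_def]
            V1[OF j, unfolded V_def] compacts]) (rule that)
    then have "tr i j K" by (simp add: tr_def L_def V_def)
    then show ?thesis by blast
  qed
  then obtain K where "\<And>i j. i \<in> I \<Longrightarrow> j \<in> I \<Longrightarrow> tr i j (K i j)" by metis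
  note tr = this[unfolded tr_def]
  define Es where "Es t = (\<Sum>i\<in>I. E i t)" for t
  define Ds where "Ds t = (\<Sum>i\<in>I. D i t)" for t
  define Qs where "Qs t = (\<Sum>i\<in>I. Q i t)" for t
  define N where "N = (\<Sum>i\<in>I. \<Sum>j\<in>I. C i * (K i j * C j))"
  have "energy_balance t0 t1 Es Ds Qs"
    unfolding Es_def Ds_def Qs_def by (rule energy_balance_sum[OF I(1)]) (use sys in blast)
  moreover have "0 \<le> N"
    unfolding N_def using sys tr by (intro sum_nonneg mult_nonneg_nonneg) auto
  moreover have "Qs t \<le> N * (Es t + Ds t)" if t: "t \<in> {t0..t1}" for t
  proof -
    have tJ: "t \<in> J" using J[OF t] by simp
    have nn: "0 \<le> E i t" "0 \<le> D i t" "0 \<le> C i" if "i \<in> I" for i using sys[OF that] t by auto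
    have part: "E j t + D j t \<le> Es t + Ds t" if "j \<in> I" for j
      unfolding Es_def Ds_def using nn that
      by (intro add_mono member_le_sum[OF _ _ I(1)]) auto
    have "Q i t \<le> (\<Sum>j\<in>I. C i * (K i j * C j)) * (Es t + Ds t)" if i: "i \<in> I" for i
    proof -
      have "continuous_on (chart_img (ch i) \<times> J) (jet_density (V i))"
        using parabolic_chart.continuous_density[OF pc[OF i]] .
      then have cont: "continuous_on (Box i) (\<lambda>y. jet_density (V i) (y, t))"
        by (rule continuous_on_compose2) (use box[OF i] tJ in \<open>auto simp: Box_def intro!: continuous_intros\<close>)
      have "Box i \<subseteq> (\<Union>j\<in>I. L i j)"
      proof
        fix y assume y: "y \<in> Box i"
        then have "chart_inv (ch i) y \<in> M"
          using atlas_chart(2,5)[OF M(1) ch[OF i]] box[OF i] by (auto simp: Box_def)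
        then obtain j where "j \<in> I" "chart_inv (ch i) y \<in> chart_inv (ch j) ` Half j"
          using cover unfolding Half_def by blast
        then show "y \<in> (\<Union>j\<in>I. L i j)" using y by (auto simp: L_def)
      qed
      then have "integral (Box i) (\<lambda>y. jet_density (V i) (y, t)) \<le> (\<Sum>j\<in>I. integral (L i j) (\<lambda>y. jet_density (V i) (y, t)))"
        using tr[OF i] by (intro integral_le_sum_cover I(1) cont jet_density_nonneg) (auto simp: Box_def L_def)
      also have "\<dots> \<le> (\<Sum>j\<in>I. (K i j * C j) * (Es t + Ds t))"
      proof (rule sum_mono)
        fix j assume j: "j \<in> I"
        have "integral (L i j) (\<lambda>y. jet_density (V i) (y, t)) \<le> K i j * integral (Half j) (\<lambda>z. jet_density (V j) (z, t))"
          using tr[OF i j] tJ by blast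
        also have "\<dots> \<le> K i j * (C j * (E j t + D j t))"
          using tr[OF i j] sys[OF j] t by (intro mult_left_mono) auto
        also have "\<dots> \<le> K i j * (C j * (Es t + Ds t))"
          using tr[OF i j] nn(3)[OF j] part[OF j] by (intro mult_left_mono) auto
        finally show "integral (L i j) (\<lambda>y. jet_density (V i) (y, t)) \<le> (K i j * C j) * (Es t + Ds t)"
          by (simp add: mult.assoc)
      qed
      finally have "C i * integral (Box i) (\<lambda>y. jet_density (V i) (y, t)) \<le> C i * (\<Sum>j\<in>I. (K i j * C j) * (Es t + Ds t))"
        using nn(3)[OF i] by (rule mult_left_mono)
      moreover have "Q i t \<le> C i * integral (Box i) (\<lambda>y. jet_density (V i) (y, t))"
        using sys[OF i] t by blast
      ultimately show ?thesis by (simp add: sum_distrib_left sum_distrib_right mult.assoc)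
    qed
    then have "Qs t \<le> (\<Sum>i\<in>I. (\<Sum>j\<in>I. C i * (K i j * C j)) * (Es t + Ds t))"
      unfolding Qs_def by (rule sum_mono)
    then show ?thesis by (simp add: N_def sum_distrib_right)
  qed
  moreover have "0 < Es t0"
  proof -
    obtain i where i: "i \<in> I" "x \<in> chart_inv (ch i) ` Half i" using cover x by (auto simp: Half_def)
    then obtain y where y: "y \<in> Half i" "x = chart_inv (ch i) y" by blast
    have "V i (y, t0) \<noteq> 0" using nz y(2) by (simp add: V_def chart_rep_def)
    then have "E i t0 \<noteq> 0" using sys[OF i(1)] y(1) t01(2) by auto
    moreover have "0 \<le> E j t0" if "j \<in> I" for j using sys[OF that] t01(2) by auto
    ultimately show ?thesis
      unfolding Es_def using i(1) by (intro sum_pos2[OF I(1) i(1)]) (auto simp: less_le)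
  qed
  ultimately have "0 < Es t1" by (intro energy_balance_positive[of t0 t1 Es Ds Qs N] t01(2))
  moreover have "E i t1 = 0" if i: "i \<in> I" for i
  proof -
    have "V i (y, t1) = 0" if "y \<in> chart_img (ch i)" for y
      using final atlas_chart(2,5)[OF M(1) ch[OF i]] that by (auto simp: V_def chart_rep_def)
    then show ?thesis using sys[OF i] t01(2) by auto
  qed
  ultimately show False by (simp add: Es_def)
qed

text \<open>
  Applied to the pressure \<open>p\<close>, this shows that the potential \<open>max\<^sub>x p(x, t)\<close> of the heat equation is bounded on compact time
  intervals.
\<close>

lemma smooth_fun_family_bounded:
  fixes M :: "'a::t2_space set" and A :: "('a, 'n::finite) chart set"
  assumes M: "smooth_atlas M A" "compact M" and p: "smooth_fun_family A T p" and "0 \<le> t0" "t1 < T"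
  obtains B where "\<And>t x. t \<in> {t0..t1} \<Longrightarrow> x \<in> M \<Longrightarrow> \<bar>p t x\<bar> \<le> B"
proof -
  obtain I ch lo hi rad where I: "finite I" "I \<subseteq> M" and ch: "\<And>i. i \<in> I \<Longrightarrow> ch i \<in> A"
    and rad: "\<And>i. i \<in> I \<Longrightarrow> 0 < rad i"
    and ball: "\<And>i. i \<in> I \<Longrightarrow> cball (snd (ch i) i) (rad i) \<subseteq> cbox (lo i) (hi i)"
    and box: "\<And>i. i \<in> I \<Longrightarrow> cbox (lo i) (hi i) \<subseteq> chart_img (ch i)"
    and cover: "M \<subseteq> (\<Union>i\<in>I. chart_inv (ch i) ` cball (snd (ch i) i) (rad i / 2))"
    by (rule finite_chart_ball_cover[OF M]) (rule that)
  have "\<exists>B. \<forall>y\<in>cbox (lo i) (hi i). \<forall>t\<in>{t0..t1}. \<bar>chart_rep p (ch i) (y, t)\<bar> \<le> B" if i: "i \<in> I" for i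
  proof -
    have "Ck_on 0 (chart_img (ch i) \<times> {0..<T}) (chart_rep p (ch i))"
      using p ch[OF i] unfolding smooth_fun_family_def smooth_on_def chart_rep_def by blast
    then have "continuous_on (chart_img (ch i) \<times> {0..<T}) (chart_rep p (ch i))" by simp
    moreover have "cbox (lo i) (hi i) \<times> {t0..t1} \<subseteq> chart_img (ch i) \<times> {0..<T}"
      using box[OF i] assms(4,5) by (intro Sigma_mono) auto
    ultimately have "continuous_on (cbox (lo i) (hi i) \<times> {t0..t1}) (chart_rep p (ch i))"
      by (rule continuous_on_subset)
    then have "bounded (chart_rep p (ch i) ` (cbox (lo i) (hi i) \<times> {t0..t1}))"
      by (intro compact_imp_bounded compact_continuous_image compact_Times) auto
    then show ?thesis unfolding bounded_iff by auto
  qed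
  then obtain B where B: "\<And>i y t. i \<in> I \<Longrightarrow> y \<in> cbox (lo i) (hi i) \<Longrightarrow> t \<in> {t0..t1} \<Longrightarrow>
      \<bar>chart_rep p (ch i) (y, t)\<bar> \<le> B i" by metis
  have "\<bar>p t x\<bar> \<le> (\<Sum>i\<in>I. \<bar>B i\<bar>)" if t: "t \<in> {t0..t1}" and x: "x \<in> M" for t x
  proof -
    obtain i y where i: "i \<in> I" "y \<in> cball (snd (ch i) i) (rad i / 2)" "x = chart_inv (ch i) y"
      using cover x by blast
    have "y \<in> cball (snd (ch i) i) (rad i)" using i(2) rad[OF i(1)] by auto
    then have "\<bar>p t x\<bar> \<le> B i" using B[OF i(1) _ t, of y] ball[OF i(1)] i(3) by (auto simp: chart_rep_def)
    also have "\<dots> \<le> \<bar>B i\<bar>" by simp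
    also have "\<dots> \<le> (\<Sum>i\<in>I. \<bar>B i\<bar>)" by (rule member_le_sum[OF i(1) _ I(1)]) simp
    finally show ?thesis .
  qed
  then show ?thesis using that by blast
qed

theorem corollary1p2:
  fixes M :: "'a::t2_space set" and A :: "('a, 'n::finite) chart set"
    and g :: "real \<Rightarrow> ('a, 'n) tensor2"
    and p f H v :: "real \<Rightarrow> 'a \<Rightarrow> real"
    and h k :: "real \<Rightarrow> real"
    and m :: nat and T a b :: real
  assumes "closed_connected_manifold M A"
    and "CARD('n) = m + 1" and "m + 1 \<ge> 3" and "T > 0"
    and "conformal_ricci_flow m M A T g p"
    and "\<forall>t\<in>{0..<T}. \<forall>c\<in>A. \<forall>x\<in>fst c. scalar_curv (g t) c x = - (real m * (real m + 1))"
    and "conjugate_fundamental_solution m M A T g p H"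
    and "\<forall>t\<in>{0..<T}. emeasure (weighted_measure M A (g t) (H t)) M = 1"
    and "\<forall>t\<in>{0..<T}. \<forall>x\<in>M.
           H t x = (4 * pi * (T - t)) powr (- ((real m + 1) / 2)) * exp (- f t x)"
    and "heat_solution A T g (pmax M p) v"
    and "\<forall>t\<in>{0..<T}. v t \<in> W22_0 A (g t) (weighted_measure M A (g t) (H t))"
    and "\<forall>t\<in>{0..<T}. (\<lambda>x. vector_derivative (\<lambda>s. v s x) (at t within {0..<T}))
           \<in> W22_0 A (g t) (weighted_measure M A (g t) (H t))"
    and "smooth_on {0..<T} h" and "smooth_on {0..<T} k"
    and "\<forall>t\<in>{0..<T}. \<forall>c\<in>A. \<forall>x\<in>fst c.
           quad_le (Ric_BE (g t) (f t) c x)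
             ((k t / (2 * h t) + scalar_curv (g t) c x / (real m + 1)) *\<^sub>R metric_at (g t) c x)"
    and "0 < a" and "a < b" and "b < T"
    and "\<forall>t\<in>{0..<T}. h t < 0"
    and "\<forall>x\<in>M. v b x = 0"
  shows "\<forall>t\<in>{a..<b}. \<forall>x\<in>M. v t x = 0"
proof (intro ballI)
  fix t x assume t: "t \<in> {a..<b}" and x: "x \<in> M"
  have M: "smooth_atlas M A" "compact M" "M \<noteq> {}"
    using assms(1) unfolding closed_connected_manifold_def by auto
  have flow: "smooth_metric_family A T g" "smooth_fun_family A T p"
    using assms(5) unfolding conformal_ricci_flow_def by auto
  obtain B where B: "\<And>s x. s \<in> {t..b} \<Longrightarrow> x \<in> M \<Longrightarrow> \<bar>p s x\<bar> \<le> B"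
    using smooth_fun_family_bounded[OF M(1,2) flow(2), of t b] t \<open>0 < a\<close> \<open>b < T\<close> by auto
  have "\<bar>pmax M p s\<bar> \<le> B" if "s \<in> {t..b}" for s
    unfolding pmax_def by (rule cSup_abs_le) (use M(3) B[OF that] in auto)
  then have "\<exists>B. \<forall>s\<in>{t..b}. \<bar>pmax M p s\<bar> \<le> B" by blast
  moreover have "0 < t" "t \<le> b" using t \<open>0 < a\<close> by auto
  moreover have "v b y = 0" if "y \<in> M" for y using assms(20) that by blast
  ultimately show "v t x = 0"
    using heat_equation_backward_uniqueness[OF M(1,2) flow(1) assms(10) _ _ \<open>b < T\<close>] x by blast
qed

end
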